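(* Let $\Omega\subset\mathbb{R}^2$ be a bounded strictly convex domain whose boundary is a $C^2$ curve of positive curvature, let $|\partial\Omega|$ be its perimeter, let $\beta_\Omega$ be Mather's $\beta$-function of the Birkhoff billiard map in $\Omega$, and let $\mathcal D$ be the unit disk. (i) The following inequality holds: $$\beta_\Omega(\rho)\le \frac{|\partial\Omega|}{2\pi}\,\beta_{\mathcal D}(\rho)\qquad\forall\,\rho\in\big[0,\tfrac12\big].\qquad ( * )$$ (ii) If equality is achieved in $( * )$ at some $\rho$, then the billiard map in $\Omega$ admits an invariant curve with constant angle of reflection equal to $\pi\rho$ (i.e. $\Omega$ is a so-called Gutkin billiard). In particular, if equality is achieved at $\tfrac12$, then $\Omega$ is a constant width domain. (iii) There exists an explicit set $\mathcal R\supset\mathbb{Q}\cap(0,\tfrac12)$, whose complement is countable and dense in $(0,\tfrac12]$, such that if equality is achieved in $( * )$ at some $\rho\in\mathcal R$, then $\Omega$ is a disk.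
   Context: Birkhoff billiard: the Birkhoff billiard map acts on oriented lines crossing $\Omega$ by the law "angle of reflection equals angle of incidence" at $\partial\Omega$. Assume the origin lies in $\Omega$, and let $h$ be the support function of $\Omega$ with respect to the origin, as a function of the angle $\phi$ of the outer normal. An oriented line is described by coordinates $(p,\phi)$, where $\phi\in\mathbb{R}/2\pi\mathbb{Z}$ is the angle between its right unit normal and the horizontal axis, and $p$ is its signed distance to the origin. In these coordinates the billiard map is an exact symplectic positive twist map with generating function $$S(\phi_0,\phi_1)=-2\,h\Big(\frac{\phi_0+\phi_1}{2}\Big)\sin\Big(\frac{\phi_1-\phi_0}{2}\Big),\qquad 0<\phi_1-\phi_0<2\pi .$$ Mather's $\beta$-function: an (admissible) configuration is a sequence $(\phi_i)_{i\in\mathbb{Z}}$ of reals with $0\le\phi_{i+1}-\phi_i\le 2\pi$. It is action-minimizing if every finite segment $(\phi_m,\dots,\phi_n)$ minimizes $\sum_{i=m}^{n-1}S(\phi_i,\phi_{i+1})$ among admissible segments with the same endpoints $\phi_m,\phi_n$. Its rotation number is $\lim_{i\to\pm\infty}\phi_i/(2\pi i)$ when this limit exists. For $\rho\in(0,1)$ action-minimizing configurations of rotation number $\rho$ exist, and $$\beta_\Omega(\rho):=\lim_{N\to\infty}\frac1{2N}\sum_{i=-N}^{N-1}S(\phi_i,\phi_{i+1})$$ for any such configuration (the value does not depend on the choice). The function $\beta_\Omega$ is continuous and is extended by continuity to $\rho=0$, with value $0$. For coprime $p,q$ with $p/q\in(0,\frac12]$, $\beta_\Omega(p/q)=-\frac1q\mathcal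 L^{\rm ins}_\Omega(p/q)$, where $\mathcal L^{\rm ins}_\Omega(p/q)$ is the maximal perimeter of inscribed $q$-gons with winding number $p$. For the unit disk, $\beta_{\mathcal D}(\rho)=-2\sin(\pi\rho)$. "An invariant curve with constant angle of reflection $\pi\rho$" means that the set of all oriented chords of $\Omega$ which leave $\partial\Omega$ at angle $\pi\rho$ with the positively oriented tangent at the starting point is invariant under the billiard map; i.e. every billiard trajectory starting with angle $\pi\rho$ makes angle $\pi\rho$ with $\partial\Omega$ at every reflection. A Gutkin billiard is a table with this property for some angle. For $\rho=0$ this is degenerate and trivial: the curve is the boundary of the phase space, formed by the lines tangent to $\partial\Omega$. On the word "explicit" in (iii): the set $(0,\frac12)\setminus\mathcal R$ consists of those $\rho\in(0,\frac12)$ which satisfy $\tan(n\pi\rho)=n\tan(\pi\rho)$ for some integer $n\ge2$. *)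

theory Defs
  imports "HOL-Analysis.Analysis"
begin

(* The Euclidean plane is the type complex: cis \<phi> is the unit vector of angle \<phi>,
   multiplication by \<i> is the counterclockwise quarter turn, and inner is the dot product. *)

section \<open>Convex domains\<close>

definition strictly_convex :: "complex set \<Rightarrow> bool" where
  "strictly_convex \<Omega> \<longleftrightarrow> convex \<Omega> \<and>
     (\<forall>x \<in> closure \<Omega>. \<forall>y \<in> closure \<Omega>. x \<noteq> y \<longrightarrow> open_segment x y \<subseteq> interior \<Omega>)"

definition velocity :: "(real \<Rightarrow> complex) \<Rightarrow> real \<Rightarrow> complex" where
  "velocity \<gamma> t = vector_derivative \<gamma> (at t)"

definition signed_curvature :: "(real \<Rightarrow> complex) \<Rightarrow> real \<Rightarrow> real" where
  "signed_curvature \<gamma> t =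
     Im (cnj (velocity \<gamma> t) * velocity (velocity \<gamma>) t) / norm (velocity \<gamma> t) ^ 3"

(* \<gamma> is a regular 1-periodic C^2 parametrisation of the frontier, simple on one period.
   Since it is counterclockwise exactly when its signed curvature is positive, the last clause
   says that the curvature is positive and also fixes the orientation. *)
definition C2_positively_curved_boundary :: "complex set \<Rightarrow> (real \<Rightarrow> complex) \<Rightarrow> bool" where
  "C2_positively_curved_boundary \<Omega> \<gamma> \<longleftrightarrow>
     (\<forall>t. \<gamma> (t + 1) = \<gamma> t) \<and>
     \<gamma> C1_differentiable_on UNIV \<and>
     velocity \<gamma> C1_differentiable_on UNIV \<and>
     (\<forall>t. velocity \<gamma> t \<noteq> 0) \<and>
     simple_path \<gamma> \<and>
     path_image \<gamma> = frontier \<Omega> \<and>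
     (\<forall>t. signed_curvature \<gamma> t > 0)"

definition closed_curve_length :: "(real \<Rightarrow> complex) \<Rightarrow> real" where
  "closed_curve_length \<gamma> = integral {0..1} (\<lambda>t. norm (velocity \<gamma> t))"

definition support_function :: "complex set \<Rightarrow> real \<Rightarrow> real" where
  "support_function \<Omega> \<phi> = (SUP x\<in>\<Omega>. inner x (cis \<phi>))"

definition constant_width :: "complex set \<Rightarrow> bool" where
  "constant_width \<Omega> \<longleftrightarrow>
     (\<exists>w. \<forall>\<phi>. support_function \<Omega> \<phi> + support_function \<Omega> (\<phi> + pi) = w)"

section \<open>Mather's beta function\<close>

definition billiard_gen :: "complex set \<Rightarrow> real \<Rightarrow> real \<Rightarrow> real" where
  "billiard_gen \<Omega> \<phi>0 \<phi>1 =
     - 2 * support_function \<Omega> ((\<phi>0 + \<phi>1) / 2) * sin ((\<phi>1 - \<phi>0) / 2)"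

definition admissible_on :: "int set \<Rightarrow> (int \<Rightarrow> real) \<Rightarrow> bool" where
  "admissible_on I \<phi> \<longleftrightarrow> (\<forall>i\<in>I. 0 \<le> \<phi> (i + 1) - \<phi> i \<and> \<phi> (i + 1) - \<phi> i \<le> 2 * pi)"

definition action :: "complex set \<Rightarrow> int \<Rightarrow> int \<Rightarrow> (int \<Rightarrow> real) \<Rightarrow> real" where
  "action \<Omega> m n \<phi> = (\<Sum>i\<in>{m..<n}. billiard_gen \<Omega> (\<phi> i) (\<phi> (i + 1)))"

(* The values of \<psi> outside {m..n} are irrelevant: \<psi> stands for a finite segment. *)
definition action_minimizing :: "complex set \<Rightarrow> (int \<Rightarrow> real) \<Rightarrow> bool" where
  "action_minimizing \<Omega> \<phi> \<longleftrightarrow>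
     admissible_on UNIV \<phi> \<and>
     (\<forall>m n \<psi>. m < n \<and> admissible_on {m..<n} \<psi> \<and> \<psi> m = \<phi> m \<and> \<psi> n = \<phi> n
        \<longrightarrow> action \<Omega> m n \<phi> \<le> action \<Omega> m n \<psi>)"

definition has_rotation_number :: "(int \<Rightarrow> real) \<Rightarrow> real \<Rightarrow> bool" where
  "has_rotation_number \<phi> \<rho> \<longleftrightarrow>
     ((\<lambda>i. \<phi> i / (2 * pi * of_int i)) \<longlongrightarrow> \<rho>) at_top \<and>
     ((\<lambda>i. \<phi> i / (2 * pi * of_int i)) \<longlongrightarrow> \<rho>) at_bot"

(* Intended for \<rho> in [0,1). For \<rho> in (0,1) minimizing configurations of rotation number \<rho>
   exist and all have the same mean action, so the choice is immaterial; the value 0 at \<rho> = 0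
   is the extension by continuity. *)
definition mather_beta :: "complex set \<Rightarrow> real \<Rightarrow> real" where
  "mather_beta \<Omega> \<rho> =
     (if \<rho> = 0 then 0
      else let \<phi> = (SOME \<phi>. action_minimizing \<Omega> \<phi> \<and> has_rotation_number \<phi> \<rho>)
           in lim (\<lambda>N::nat. action \<Omega> (- int N) (int N) \<phi> / (2 * real N)))"

section \<open>The billiard map and Gutkin billiards\<close>

(* The unique outer unit normal at a frontier point of a convex domain with C^1 boundary. *)
definition outer_normal :: "complex set \<Rightarrow> complex \<Rightarrow> complex" where
  "outer_normal \<Omega> x = (THE u. norm u = 1 \<and> (\<forall>z\<in>\<Omega>. inner (z - x) u \<le> 0))"

definition positive_tangent :: "complex set \<Rightarrow> complex \<Rightarrow> complex" where
  "positive_tangent \<Omega> x = \<i> * outer_normal \<Omega> x"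

definition exit_point :: "complex set \<Rightarrow> complex \<Rightarrow> complex \<Rightarrow> complex" where
  "exit_point \<Omega> x v = x + Sup {t::real. 0 \<le> t \<and> x + t *\<^sub>R v \<in> closure \<Omega>} *\<^sub>R v"

(* An oriented line meeting the closure of \<Omega> is represented by the pair (x, v) of the frontier
   point x at which it enters and its unit direction v. For a tangent line the exit point is x
   itself, and such a line is fixed. *)
definition billiard_map :: "complex set \<Rightarrow> complex \<times> complex \<Rightarrow> complex \<times> complex" where
  "billiard_map \<Omega> = (\<lambda>(x, v).
     let y = exit_point \<Omega> x v; n = outer_normal \<Omega> y
     in (y, v - (2 * inner v n) *\<^sub>R n))"

definition constant_angle_chords :: "complex set \<Rightarrow> real \<Rightarrow> (complex \<times> complex) set" where
  "constant_angle_chords \<Omega> \<alpha> = (\<lambda>x. (x, cis \<alpha> * positive_tangent \<Omega> x)) ` frontier \<Omega>"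

definition constant_angle_invariant_curve :: "complex set \<Rightarrow> real \<Rightarrow> bool" where
  "constant_angle_invariant_curve \<Omega> \<alpha> \<longleftrightarrow>
     billiard_map \<Omega> ` constant_angle_chords \<Omega> \<alpha> = constant_angle_chords \<Omega> \<alpha>"

section \<open>The exceptional rotation numbers\<close>

(* On (0,1/2) we have tan (pi * \<rho>) > 0. So where tan (n * pi * \<rho>) is undefined, HOL's value 0
   for it makes the inequality true, in accordance with the equation having no solution there. *)
definition rigid_rotation_numbers :: "real set" where
  "rigid_rotation_numbers =
     {\<rho>. 0 < \<rho> \<and> \<rho> < 1 / 2 \<and>
          (\<forall>n::nat. n \<ge> 2 \<longrightarrow> tan (real n * pi * \<rho>) \<noteq> real n * tan (pi * \<rho>))}"

end

theory Submission
  imports Defs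
begin

text \<open>Parametrise the boundary by the angle \<open>s\<close> of the outer normal, so that
  \<open>z'(s) = R(s) \<i> cis s\<close> with \<open>R > 0\<close>. Then \<open>\<partial>\<^sub>1S(x, y) = z((x + y)/2) \<bullet> cis x\<close> and
  \<open>\<partial>\<^sub>2S(x, y) = - z((x + y)/2) \<bullet> cis y\<close>, which makes \<open>S\<close> submodular on admissible pairs. Minimizers
  among periodic configurations are therefore closed under pointwise minima, and the minimum of
  suitable translates is ordered; limits of such configurations are minimizers of every rotation
  number with bounded deviation.

  A minimizer is cheaper than any admissible configuration of the same rotation number, up to
  sublinear errors. Averaging the action of \<open>i \<mapsto> b(x + 2\<pi>\<rho>i)\<close> over \<open>x\<close> thus bounds \<open>\<beta>(\<rho>)\<close> for every circle
  map lift \<open>b\<close>. The identity gives (i). In case of equality it is a critical point, so all rigid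
  rotations satisfy the Euler--Lagrange equation \<open>(z(u + \<pi>\<rho>) - z(u - \<pi>\<rho>)) \<bullet> cis u = 0\<close>, which says that the
  chord from \<open>z(u - \<pi>\<rho>)\<close> to \<open>z(u + \<pi>\<rho>)\<close> makes the angle \<open>\<pi>\<rho>\<close> with the boundary at both ends. On the
  \<open>n\<close>-th Fourier coefficient of the support function the equation acts as multiplication by
  \<open>sin(n\<pi>\<rho>) cos(\<pi>\<rho>) - n cos(n\<pi>\<rho>) sin(\<pi>\<rho>)\<close>, so only the harmonics \<open>\<bar>n\<bar> \<le> 1\<close> survive for rigid \<open>\<rho>\<close>.

  For rational \<open>\<rho>\<close> this factor vanishes at all conjugates of \<open>exp(2\<pi>i\<rho>)\<close> simultaneously; at the
  conjugate closest to \<open>-1\<close> the tangent is too large for \<open>tan(n a) = n tan a\<close> to hold.\<close>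

section \<open>Conjugate roots of unity\<close>

text \<open>\<open>mather_beta\<close> is a limit along an arbitrary minimizer picked by
  \<open>SOME\<close>, so existence of minimizers, convergence of the mean action and independence
  of the choice must all be established. A minimizer that merely has a rotation number may drift
  sublinearly, and its mean action is not visibly convergent. An ordered one stays at bounded
  distance from a line, which makes its action quasi-additive; the chosen minimizer inherits that
  limit by comparison. The comparison needs room for reconnecting two configurations: for 0 < \<rho>
  < 1 a mean step \<alpha> = 2 pi \<rho> lies at distance min \<alpha> (2 pi - \<alpha>) from the
  ends of the admissible range.

  Averaging over the phase x replaces equidistribution, so rational and irrational \<rho> are
  treated alike.

  For rational \<rho> the obstacle is a denominator m = 2 mod 4: there m/2 - 1 is even, so the
  admissible numerator below m/2 is m/2 - 2. The doubled gap weakens the estimate, and n = 2 as well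
  as m = 6, n = 3 have to be excluded by hand.\<close>

definition ipoly :: "int poly \<Rightarrow> 'a::comm_ring_1 \<Rightarrow> 'a" where
  "ipoly P x = poly (map_poly of_int P) x"

lemma ipoly_0 [simp]: "ipoly 0 x = 0"
  by (simp add: ipoly_def)

lemma ipoly_pCons [simp]: "ipoly (pCons a P) x = of_int a + x * ipoly P x"
  by (simp add: ipoly_def map_poly_pCons)

lemma ipoly_1 [simp]: "ipoly 1 x = 1"
  by (simp add: ipoly_def)

lemma ipoly_add [simp]: "ipoly (P + Q) x = ipoly P x + ipoly Q x"
  by (induction P Q rule: poly_induct2) (simp_all add: algebra_simps)

lemma ipoly_uminus [simp]: "ipoly (- P) x = - ipoly P x"
  by (induction P) (simp_all add: algebra_simps)

lemma ipoly_diff [simp]: "ipoly (P - Q) x = ipoly P x - ipoly Q x"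
  by (metis diff_conv_add_uminus ipoly_add ipoly_uminus)

lemma ipoly_smult [simp]: "ipoly (smult a P) x = of_int a * ipoly P x"
  by (induction P) (simp_all add: algebra_simps)

lemma ipoly_mult [simp]: "ipoly (P * Q) x = ipoly P x * ipoly Q x"
  by (induction P) (simp_all add: algebra_simps)

lemma ipoly_power [simp]: "ipoly (P ^ n) x = ipoly P x ^ n"
  by (induction n) simp_all

lemma ipoly_monom [simp]: "ipoly (monom a n) x = of_int a * x ^ n"
  by (induction n) (simp_all add: monom_0 monom_Suc algebra_simps)

lemma ipoly_pcompose [simp]: "ipoly (pcompose P Q) x = ipoly P (ipoly Q x)"
  by (induction P) (simp_all add: pcompose_pCons)

lemma freshman_dvd:
  fixes a b :: "'a::comm_ring_1"
  assumes "prime p"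
  shows "of_nat p dvd (a + b) ^ p - (a ^ p + b ^ p)"
proof -
  have p: "p > 0" using assms prime_gt_0_nat by auto
  have "(a + b) ^ p = (\<Sum>k\<le>p. of_nat (p choose k) * a ^ k * b ^ (p - k))"
    by (rule binomial_ring)
  also have "\<dots> = (\<Sum>k\<in>{0,p}. of_nat (p choose k) * a ^ k * b ^ (p - k))
      + (\<Sum>k\<in>{..p}-{0,p}. of_nat (p choose k) * a ^ k * b ^ (p - k))"
    by (subst sum.subset_diff[of "{0,p}"]) auto
  also have "(\<Sum>k\<in>{0,p}. of_nat (p choose k) * a ^ k * b ^ (p - k)) = a ^ p + b ^ p"
    using p by (simp add: add_ac)
  finally have "(a + b) ^ p - (a ^ p + b ^ p) =
      (\<Sum>k\<in>{..p}-{0,p}. of_nat (p choose k) * a ^ k * b ^ (p - k))" by simp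
  also have "of_nat p dvd \<dots>"
  proof (intro dvd_sum dvd_mult2)
    fix k assume "k \<in> {..p} - {0, p}"
    then have "p dvd (p choose k)"
      by (intro dvd_choose_prime) (use assms in auto)
    then show "(of_nat p :: 'a) dvd of_nat (p choose k)"
      by (metis dvdE dvdI of_nat_mult)
  qed
  finally show ?thesis .
qed

lemma int_power_prime_dvd:
  fixes a :: int
  assumes "prime p"
  shows "int p dvd a ^ p - a"
proof (induction a rule: int_induct[where k = 0])
  case base
  then show ?case using assms prime_gt_0_nat[of p] by (simp add: zero_power)
next
  case (step1 i)
  have "int p dvd ((i + 1) ^ p - (i ^ p + 1 ^ p)) + (i ^ p - i)"
    using dvd_add[OF freshman_dvd[OF assms, of i 1] step1(2)] by simp
  then show ?case by (simp add: algebra_simps)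
next
  case (step2 i)
  have "int p dvd (i ^ p - i) - ((i - 1 + 1) ^ p - ((i - 1) ^ p + 1 ^ p))"
    using dvd_diff[OF step2(2) freshman_dvd[OF assms, of "i - 1" 1]] by simp
  then show ?case by (simp add: algebra_simps)
qed

text \<open>The Frobenius congruence F(X^p) = F(X)^p mod p: Fermat's little theorem handles the
  coefficients, \<open>freshman_dvd\<close> the sums.\<close>

lemma pcompose_monom_prime:
  fixes F :: "int poly"
  assumes "prime p"
  shows "of_nat p dvd pcompose F (monom 1 p) - F ^ p"
proof (induction F)
  case 0
  then show ?case using assms prime_gt_0_nat[of p] by (auto simp: zero_power)
next
  case (pCons a F)
  let ?X = "[:0, 1:] :: int poly"
  have X: "?X ^ p = monom 1 p"
    by (simp add: monom_altdef)
  have eq: "pCons a F = [:a:] + ?X * F" by simp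
  have "of_nat p dvd ([:a:] - [:a:] ^ p :: int poly)"
  proof -
    obtain t where "a ^ p - a = int p * t" using int_power_prime_dvd[OF assms, of a] by auto
    then have "[:a:] - [:a:] ^ p = of_nat p * [:- t:]"
      by (simp add: poly_const_pow of_nat_poly algebra_simps)
    then show ?thesis by (rule dvdI)
  qed
  moreover have "of_nat p dvd monom 1 p * (pcompose F (monom 1 p) - F ^ p)"
    using pCons(2) by (rule dvd_mult)
  moreover have "of_nat p dvd ([:a:] + ?X * F) ^ p - ([:a:] ^ p + (?X * F) ^ p)"
    by (rule freshman_dvd[OF assms])
  ultimately have "of_nat p dvd ([:a:] - [:a:] ^ p) + monom 1 p * (pcompose F (monom 1 p) - F ^ p)
     - (([:a:] + ?X * F) ^ p - ([:a:] ^ p + (?X * F) ^ p))"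
    by (rule dvd_diff[OF dvd_add])
  also have "\<dots> = pcompose (pCons a F) (monom 1 p) - pCons a F ^ p"
    unfolding eq power_mult_distrib X by (simp add: pcompose_pCons algebra_simps)
  finally show ?case .
qed

text \<open>Gauss's lemma inside Z[X]: pseudo-division of P by F leaves a remainder that vanishes at
  z and would have smaller degree, hence is 0. In a P = F q the content of F is 1, so a divides q
  and can be cancelled.\<close>

lemma primitive_vanishing_dvd:
  fixes F P :: "int poly" and z :: complex
  assumes F: "F \<noteq> 0" "content F = 1" "ipoly F z = 0"
    and min: "\<And>G. G \<noteq> 0 \<Longrightarrow> ipoly G z = 0 \<Longrightarrow> degree F \<le> degree G"
    and P: "ipoly P z = 0"
  shows "F dvd P"
proof -
  obtain a q where aq: "a \<noteq> 0" "smult a P = F * q + pseudo_mod P F"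
    using pseudo_mod(1)[OF F(1)] by blast
  have "ipoly (smult a P - F * q) z = 0" using P F by simp
  then have "ipoly (pseudo_mod P F) z = 0" using aq(2) by simp
  then have "pseudo_mod P F = 0"
    using pseudo_mod(2)[OF F(1), of P] min[of "pseudo_mod P F"] by (meson leD)
  with aq have eq: "smult a P = F * q" by simp
  then have "content (smult a P) = content q" using F by (simp add: content_mult)
  then have "a dvd content q" by (metis content_smult dvd_normalize_iff dvd_triv_left normalize_dvd_iff dvd_mult2 dvd_refl)
  then have "[:a:] dvd q" by (simp add: const_poly_dvd_iff_dvd_content)
  then obtain q' where "q = smult a q'" by (auto simp: dvd_def)
  with eq have "smult a P = smult a (F * q')" by simp
  with aq have "P = F * q'" by (metis smult_cancel)
  then show ?thesis by simp
qed

text \<open>The primitive part of a polynomial of least degree vanishing at z divides X^m - 1, so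
  its leading coefficient is a unit; fixing the sign makes it monic.\<close>

lemma exists_monic_minimal:
  fixes z :: complex
  assumes "z ^ m = 1" "m > 0"
  obtains F :: "int poly" where "lead_coeff F = 1" "ipoly F z = 0"
    "\<And>P. ipoly P z = 0 \<Longrightarrow> F dvd P" "degree F > 0"
proof -
  define G where "G = (ARG_MIN degree G. G \<noteq> 0 \<and> ipoly G z = 0)"
  let ?U = "monom 1 m - 1 :: int poly"
  have cU: "coeff ?U m = 1" using assms by simp
  have U: "?U \<noteq> 0 \<and> ipoly ?U z = 0" using assms cU by (metis coeff_0 zero_neq_one ipoly_diff ipoly_monom ipoly_1 of_int_1 mult_1 diff_self)
  have "G \<noteq> 0 \<and> ipoly G z = 0"
    unfolding G_def by (rule arg_min_natI[of "\<lambda>G. G \<noteq> 0 \<and> ipoly G z = 0", OF U])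
  moreover have "degree G \<le> degree H" if "H \<noteq> 0" "ipoly H z = 0" for H
    unfolding G_def by (rule arg_min_nat_le) (use that in auto)
  ultimately have G: "G \<noteq> 0" "ipoly G z = 0" "\<And>H. H \<noteq> 0 \<Longrightarrow> ipoly H z = 0 \<Longrightarrow> degree G \<le> degree H"
    by blast+
  define H where "H = primitive_part G"
  have GH: "G = smult (content G) H" by (simp add: H_def)
  have "of_int (content G) * ipoly H z = 0"
    using G(2) by (subst (asm) GH) simp
  then have H: "H \<noteq> 0" "content H = 1" "ipoly H z = 0" "degree H = degree G"
    using G(1) by (auto simp: H_def)
  have dvd: "H dvd P" if "ipoly P z = 0" for P
    by (rule primitive_vanishing_dvd[OF H(1-3) _ that]) (use G H in auto)
  have "H dvd ?U" using dvd U by blast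
  then obtain K where K: "?U = H * K" by auto
  have "lead_coeff ?U = 1"
  proof -
    have "degree ?U = m"
      using assms by (intro antisym degree_le le_degree) (auto simp: coeff_monom)
    then show ?thesis using cU by simp
  qed
  then have "lead_coeff H dvd 1" using K by (metis dvd_triv_left lead_coeff_mult)
  then have lc: "lead_coeff H = 1 \<or> lead_coeff H = - 1" by auto
  define F where "F = smult (lead_coeff H) H"
  have "lead_coeff F = 1" using lc by (auto simp: F_def)
  moreover have "ipoly F z = 0" using H by (simp add: F_def)
  moreover have "F dvd P" if "ipoly P z = 0" for P
    using dvd[OF that] lc by (auto simp: F_def)
  moreover have "degree F > 0"
  proof (rule ccontr)
    assume "\<not> degree F > 0"
    then obtain c where "F = [:c:]" by (metis degree_eq_zeroE gr0I)
    with calculation(1,2) show False by simp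
  qed
  ultimately show ?thesis using that by blast
qed

text \<open>The classical argument for irreducibility of cyclotomic polynomials, carried out by
  evaluation at z. With X^m - 1 = F g and F(z^p) nonzero, g vanishes at z^p, so differentiating the
  factorization there gives m z^(p(m-1)) = F(z^p) g'(z^p). By Frobenius F(z^p) lies in p Z[z]; so p
  divides m in Z[z] and, F being monic, also in Z.\<close>

lemma ipoly_root_of_unity_prime_power:
  fixes z :: complex
  assumes z: "z ^ m = 1" "m > 0" and p: "prime p" "\<not> p dvd m" and P: "ipoly P z = 0"
  shows "ipoly P (z ^ p) = 0"
proof -
  obtain F :: "int poly" where F: "lead_coeff F = 1" "ipoly F z = 0"
    "\<And>P. ipoly P z = 0 \<Longrightarrow> F dvd P" "degree F > 0"
    using exists_monic_minimal[OF z] by metis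
  let ?U = "monom 1 m - 1 :: int poly"
  have "F dvd ?U" using F(3) z by simp
  then obtain g where g: "?U = F * g" by auto
  have "ipoly F (z ^ p) = 0"
  proof (rule ccontr)
    assume nz: "ipoly F (z ^ p) \<noteq> 0"
    have "ipoly ?U (z ^ p) = 0" using z by (simp add: power_mult[symmetric] mult.commute[of p]) (simp add: power_mult)
    then have gz: "ipoly g (z ^ p) = 0" using g nz by simp
    have "pderiv ?U = F * pderiv g + g * pderiv F"
      unfolding g pderiv_mult by (simp add: algebra_simps)
    then have "monom (int m) (m - 1) = F * pderiv g + g * pderiv F"
      by (simp add: pderiv_diff pderiv_monom)
    from arg_cong[OF this, of "\<lambda>Q. ipoly Q (z ^ p)"]
    have 1: "of_nat m * (z ^ p) ^ (m - 1) = ipoly F (z ^ p) * ipoly (pderiv g) (z ^ p)"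
      using gz by simp
    obtain B where "pcompose F (monom 1 p) - F ^ p = of_nat p * B"
      using pcompose_monom_prime[OF p(1)] by auto
    from arg_cong[OF this, of "\<lambda>Q. ipoly Q z"]
    have 2: "ipoly F (z ^ p) = of_nat p * ipoly B z"
      using F(2) p prime_gt_0_nat[of p] by (simp add: of_nat_poly zero_power)
    \<comment> \<open>The factor X^p turns (z^p)^(m-1) into 1, so that m = p C(z).\<close>
    define C where "C = B * pcompose (pderiv g) (monom 1 p) * monom 1 p"
    have zz: "(z ^ p) ^ (m - 1) * z ^ p = 1"
      using z by (metis power_minus_mult power_mult mult.commute power_one)
    have "ipoly ([:int m:] - smult (int p) C) z = 0"
    proof -
      have "of_nat m = of_nat m * (z ^ p) ^ (m - 1) * z ^ p" using zz by (simp add: mult.assoc)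
      also have "\<dots> = of_nat p * ipoly C z" unfolding 1 2 C_def by simp
      finally show ?thesis by simp
    qed
    then have "F dvd [:int m:] - smult (int p) C" by (rule F)
    then obtain D where D: "[:int m:] - smult (int p) C = F * D" by auto
    \<comment> \<open>Downward induction on j: as F is monic, the coefficient of F D at degree F + j
      is that of D at j plus terms with higher coefficients of D. Modulo p, F D is constant, and
      degree F > 0.\<close>
    have "int p dvd coeff D j" for j
    proof (induction "Suc (degree D) - j" arbitrary: j rule: less_induct)
      case less
      show ?case
      proof (cases "j > degree D")
        case True
        then show ?thesis by (simp add: coeff_eq_0)
      next
        case False
        have "coeff (F * D) (degree F + j) = (\<Sum>i\<le>degree F + j. coeff F i * coeff D (degree F + j - i))"
          by (rule coeff_mult)
        also have "\<dots> = coeff F (degree F) * coeff D (degree F + j - degree F)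
            + (\<Sum>i\<in>{..degree F + j}-{degree F}. coeff F i * coeff D (degree F + j - i))"
          by (rule sum.remove) auto
        finally have *: "coeff (F * D) (degree F + j) = coeff D j
            + (\<Sum>i\<in>{..degree F + j}-{degree F}. coeff F i * coeff D (degree F + j - i))"
          using F by simp
        have "int p dvd (\<Sum>i\<in>{..degree F + j}-{degree F}. coeff F i * coeff D (degree F + j - i))"
        proof (intro dvd_sum)
          fix i assume i: "i \<in> {..degree F + j}-{degree F}"
          show "int p dvd coeff F i * coeff D (degree F + j - i)"
          proof (cases "i > degree F")
            case True
            then show ?thesis by (simp add: coeff_eq_0)
          next
            case False
            then have "degree F + j - i > j" using i by auto
            then have "int p dvd coeff D (degree F + j - i)"
              using \<open>\<not> j > degree D\<close> by (intro less.hyps) arith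
            then show ?thesis by simp
          qed
        qed
        moreover have "int p dvd coeff (F * D) (degree F + j)"
          unfolding D[symmetric] using F(4) by (simp add: coeff_pCons split: nat.split)
        ultimately show ?thesis using * by (simp add: dvd_add_left_iff)
      qed
    qed
    then have "int p dvd coeff (F * D) 0" by (simp add: coeff_mult)
    then have "int p dvd int m - int p * coeff C 0" unfolding D[symmetric] by simp
    then have "int p dvd int m" by (simp add: dvd_diff_left_iff)
    then show False using p by simp
  qed
  moreover have "F dvd P" using F P by blast
  ultimately show ?thesis by auto
qed

text \<open>Factor k into primes, none of which divides m; each power of z met on the way is again
  an m-th root of unity. For k = 0 coprimality forces m = 1.\<close>

lemma ipoly_root_of_unity_conjugate:
  fixes z :: complex
  assumes "z ^ m = 1" "m > 0" and "coprime k m" and P: "ipoly P z = 0"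
  shows "ipoly P (z ^ k) = 0"
  using assms
proof (induction k arbitrary: z rule: prime_divisors_induct)
  case zero
  then show ?case by auto
next
  case (unit k)
  then show ?case by simp
next
  case (factor p k)
  have cop: "coprime p m" "coprime k m" using factor.prems by auto
  then have "\<not> p dvd m" using factor(1)
    by (metis coprime_absorb_left not_prime_unit)
  then have "ipoly P (z ^ p) = 0"
    using ipoly_root_of_unity_prime_power[of z m p P] factor by auto
  moreover have "(z ^ p) ^ m = 1" using factor(3) by (metis mult.commute power_mult power_one)
  ultimately have "ipoly P ((z ^ p) ^ k) = 0" using factor cop by blast
  then show ?case by (simp add: power_mult)
qed

section \<open>The equation tan(n a) = n tan(a) at rational multiples of pi\<close>

text \<open>A pole of tan(n a) cannot slip in: HOL's value there is 0, while n tan a > 0.\<close>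

lemma tan_multiple_eq:
  assumes a: "0 < a" "a < pi / 2" and "n > 0" and eq: "tan (real n * a) = real n * tan a"
  shows "sin (real n * a) * cos a = real n * cos (real n * a) * sin a"
proof -
  have "tan a > 0" using a tan_gt_zero by auto
  then have "tan (real n * a) \<noteq> 0" using eq \<open>n > 0\<close> by auto
  then have "cos (real n * a) \<noteq> 0" by (auto simp: tan_def)
  moreover have "cos a \<noteq> 0" using cos_gt_zero[of a] a by auto
  ultimately show ?thesis using eq by (simp add: tan_def field_simps)
qed

text \<open>Since i tan b = (x - 1)/(x + 1) for x = exp(2 i b), this is tan(n a) = n tan a with
  denominators cleared, as a polynomial in exp(2 i a).\<close>

definition gutkin_poly :: "nat \<Rightarrow> int poly" where
  "gutkin_poly n = (monom 1 n - 1) * [:1, 1:] - smult (int n) ([:-1, 1:] * (monom 1 n + 1))"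

lemma ipoly_gutkin_poly:
  "ipoly (gutkin_poly n) (cis (2 * a)) = 4 * \<i> * cis (real n * a) * cis a *
     of_real (sin (real n * a) * cos a - real n * cos (real n * a) * sin a)"
proof -
  have c: "cis (2 * b) - 1 = 2 * \<i> * cis b * of_real (sin b)"
    "cis (2 * b) + 1 = 2 * cis b * of_real (cos b)" for b
    by (simp_all add: complex_eq_iff sin_double cos_double_sin power2_eq_square)
      (simp add: sin_squared_eq[unfolded power2_eq_square] algebra_simps)
  have p: "cis (2 * a) ^ n = cis (2 * (real n * a))"
    by (simp add: Complex.DeMoivre mult_ac)
  have "ipoly (gutkin_poly n) (cis (2 * a)) =
    (cis (2 * (real n * a)) - 1) * (cis (2 * a) + 1) - of_nat n * ((cis (2 * a) - 1) * (cis (2 * (real n * a)) + 1))"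
    unfolding p[symmetric] by (simp add: gutkin_poly_def algebra_simps)
  also have "\<dots> = 4 * \<i> * cis (real n * a) * cis a *
     of_real (sin (real n * a) * cos a - real n * cos (real n * a) * sin a)"
    unfolding c by (simp add: algebra_simps)
  finally show ?thesis .
qed

lemma gutkin_poly_root_iff:
  "ipoly (gutkin_poly n) (cis (2 * a)) = 0 \<longleftrightarrow>
     sin (real n * a) * cos a = real n * cos (real n * a) * sin a"
  unfolding ipoly_gutkin_poly
  by (simp only: mult_eq_0_iff of_real_eq_0_iff cis_neq_zero) auto

text \<open>The bound |cot w| <= cot(pi/M) without division: a multiple of pi/M that is no multiple
  of pi stays at distance at least pi/M from all multiples of pi.\<close>

lemma abs_cos_sin_le:
  fixes u :: int and M :: nat
  assumes M: "M \<ge> 3" and u: "sin (pi * of_int u / real M) \<noteq> 0"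
  shows "\<bar>cos (pi * of_int u / real M)\<bar> * sin (pi / real M) \<le> \<bar>sin (pi * of_int u / real M)\<bar> * cos (pi / real M)"
proof -
  define v where "v = u mod int M"
  define q where "q = u div int M"
  define x where "x = pi * of_int v / real M"
  define y where "y = pi / real M"
  have "u = v + int M * q" by (simp add: v_def q_def)
  then have "of_int u = of_int v + real M * of_int q" by simp
  then have eq: "pi * of_int u / real M = x + of_int q * pi"
    using M by (simp add: x_def field_simps)
  have sq: "\<bar>sin (x + of_int q * pi)\<bar> = \<bar>sin x\<bar>" "\<bar>cos (x + of_int q * pi)\<bar> = \<bar>cos x\<bar>"
    using sin_npi_int[of q] cos_npi_int[of q]
    by (simp_all add: sin_add cos_add mult.commute[of pi] abs_mult)
  have "v \<noteq> 0" using u unfolding eq by (auto simp: x_def sin_npi_int[of q] mult.commute)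
  then have v: "1 \<le> v" "v + 1 \<le> int M"
    using M pos_mod_sign[of "int M" u] pos_mod_bound[of "int M" u] unfolding v_def by linarith+
  have "0 \<le> x - y" "x + y \<le> pi" "0 \<le> y" "x \<le> pi"
  proof -
    have "of_int 1 \<le> (of_int v :: real)" "of_int (v + 1) \<le> (of_int (int M) :: real)"
      using v by (simp_all only: of_int_le_iff)
    then show "0 \<le> x - y" "x + y \<le> pi" "0 \<le> y" "x \<le> pi"
      using M mult_left_mono[of "1 + of_int v" "real M" pi] by (auto simp: x_def y_def field_simps)
  qed
  \<comment> \<open>The first two inequalities expand to cos x sin y <= sin x cos y and - cos x sin
    y <= sin x cos y.\<close>
  then have "sin (x - y) \<ge> 0" "sin (x + y) \<ge> 0" "sin x \<ge> 0" "sin y \<ge> 0"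
    by (auto intro!: sin_ge_zero)
  then have "\<bar>cos x\<bar> * sin y \<le> \<bar>sin x\<bar> * cos y"
    by (auto simp: sin_add sin_diff abs_if algebra_simps)
  then show ?thesis unfolding eq sq y_def .
qed

text \<open>This is the equation at a = pi/2 - y with y = pi/M, rewritten for w = pi/2 - n a. When w
  is a multiple of y, the cotangent bound limits the left side to |sin w| cos y and so forces n <=
  1.\<close>

lemma gutkin_equation_unsolvable_near_half:
  fixes u :: int
  assumes M: "M \<ge> 3" and n: "n \<ge> 2"
  shows "cos (pi * of_int u / real M) * sin (pi / real M) \<noteq>
    real n * sin (pi * of_int u / real M) * cos (pi / real M)"
proof
  let ?w = "pi * of_int u / real M" and ?y = "pi / real M"
  assume eq: "cos ?w * sin ?y = real n * sin ?w * cos ?y"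
  have y: "0 < ?y" "?y < pi / 2" using M by (auto simp: field_simps)
  then have pos: "sin ?y > 0" "cos ?y > 0" using sin_gt_zero[of ?y] cos_gt_zero[of ?y] by linarith+
  have nz: "sin ?w \<noteq> 0"
  proof
    assume 0: "sin ?w = 0"
    then have "cos ?w = 0" using eq pos by auto
    with 0 show False using sin_cos_squared_add[of ?w] by simp
  qed
  have "\<bar>cos ?w * sin ?y\<bar> = real n * (\<bar>sin ?w\<bar> * cos ?y)"
    unfolding eq using pos by (simp add: abs_mult)
  then have "real n * (\<bar>sin ?w\<bar> * cos ?y) \<le> \<bar>sin ?w\<bar> * cos ?y"
    using abs_cos_sin_le[OF M nz] pos by (simp add: abs_mult)
  then have "real n \<le> 1" using nz pos by (simp add: mult_le_cancel_right1)
  then show False using n by simp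
qed

text \<open>Bezout gives s with r s = 1 mod m, and the power s j carries exp(2 pi i r/m) to exp(2 pi
  i j/m).\<close>

lemma root_of_unity_conjugate_cis:
  assumes cop: "coprime r m" "coprime j m" and m: "m > 0" "r > 0"
    and P: "ipoly P (cis (2 * (pi * (real r / real m)))) = 0"
  shows "ipoly P (cis (2 * (pi * (real j / real m)))) = 0"
proof -
  let ?z = "cis (2 * (pi * (real r / real m)))"
  obtain s t where st: "r * s = m * t + 1"
    using bezout_nat[of r m] m cop by (auto simp: coprime_iff_gcd_eq_1)
  have "coprime s m"
  proof (rule coprimeI)
    fix c assume "c dvd s" "c dvd m"
    then have "c dvd r * s - m * t" by (simp add: dvd_diff_nat)
    then show "is_unit c" using st by simp
  qed
  then have "coprime (s * j) m" using cop(2) unfolding coprime_mult_left_iff by blast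
  moreover have "?z ^ m = 1"
  proof -
    have "real m * (2 * (pi * (real r / real m))) = 2 * pi * of_int (int r)"
      using m by (simp add: field_simps)
    then show ?thesis unfolding Complex.DeMoivre by (simp only: cis_multiple_2pi Ints_of_int)
  qed
  ultimately have "ipoly P (?z ^ (s * j)) = 0"
    using ipoly_root_of_unity_conjugate m P by blast
  also have "?z ^ (s * j) = cis (2 * (pi * (real j / real m)))"
  proof -
    have "real (s * j) * (2 * (pi * (real r / real m))) = 2 * pi * real j / real m * real (r * s)"
      by (simp add: field_simps)
    also have "\<dots> = 2 * (pi * (real j / real m)) + 2 * pi * of_int (int (j * t))"
      unfolding st using m by (simp add: field_simps)
    finally have e: "real (s * j) * (2 * (pi * (real r / real m))) = 2 * (pi * (real j / real m)) + 2 * pi * of_int (int (j * t))" .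
    show ?thesis unfolding Complex.DeMoivre e cis_mult[symmetric]
      by (simp only: cis_multiple_2pi Ints_of_int mult_1_right)
  qed
  finally show ?thesis .
qed

text \<open>The double-angle formulas reduce the equation to sin(a)^2 = 0. This n is treated
  separately because the estimate for denominators m = 2 mod 4 does not contradict it.\<close>

lemma gutkin_equation_unsolvable_2:
  fixes a :: real
  assumes "0 < a" "a < pi"
  shows "sin (2 * a) * cos a \<noteq> 2 * cos (2 * a) * sin a"
proof
  assume eq: "sin (2 * a) * cos a = 2 * cos (2 * a) * sin a"
  have s: "sin a > 0" using assms by (rule sin_gt_zero)
  have "2 * sin a * (cos a)\<^sup>2 = 2 * sin a * (2 * (cos a)\<^sup>2 - 1)"
    using eq unfolding sin_double[of a] cos_double_cos[of a] by (simp add: power2_eq_square mult_ac)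
  then have "(cos a)\<^sup>2 = 2 * (cos a)\<^sup>2 - 1" using s by simp
  then have "(sin a)\<^sup>2 = 0" by (simp add: sin_squared_eq)
  then show False using s by simp
qed

text \<open>The conjugate j/m just below 1/2 has j = (m-1)/2 for odd m, m/2 - 1 for 4 | m and m/2 -
  2 for m = 2 mod 4. In the first two cases w is a multiple of y, as the preceding estimate
  requires. In the third it is only a multiple of y/2, which yields no more than (n - 1) cos y <=
  1.\<close>

lemma gutkin_equation_unsolvable_rational:
  assumes \<rho>: "\<rho> \<in> \<rat>" "0 < \<rho>" "\<rho> < 1 / 2" and n: "n \<ge> 2"
  shows "sin (real n * (pi * \<rho>)) * cos (pi * \<rho>) \<noteq> real n * cos (real n * (pi * \<rho>)) * sin (pi * \<rho>)"
proof
  assume eq: "sin (real n * (pi * \<rho>)) * cos (pi * \<rho>) = real n * cos (real n * (pi * \<rho>)) * sin (pi * \<rho>)"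
  obtain r m :: nat where rm: "m \<noteq> 0" "\<bar>\<rho>\<bar> = real r / real m" "coprime r m"
    using Rats_abs_nat_div_natE[OF \<rho>(1)] by blast
  have \<rho>_eq: "\<rho> = real r / real m" using rm \<rho> by simp
  have r: "r > 0" "2 * r < m" using \<rho> \<rho>_eq rm by (auto simp: field_simps zero_less_divide_iff)
  then have m3: "m \<ge> 3" by simp
  have P: "ipoly (gutkin_poly n) (cis (2 * (pi * (real r / real m)))) = 0"
    unfolding gutkin_poly_root_iff using eq \<rho>_eq by simp
  have conj: "sin (real n * (pi * (real j / real m))) * cos (pi * (real j / real m)) =
      real n * cos (real n * (pi * (real j / real m))) * sin (pi * (real j / real m))"
    if "coprime j m" for j
    using root_of_unity_conjugate_cis[OF rm(3) that _ r(1) P] rm(1)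
    unfolding gutkin_poly_root_iff by blast
  \<comment> \<open>Complementary angles y = pi/2 - a and w = pi/2 - n a for a = pi j/m.\<close>
  have flip: "cos w * sin y = real n * sin w * cos y"
    if "coprime j m" "y = pi / 2 - pi * (real j / real m)" "w = pi / 2 - real n * (pi * (real j / real m))" for j w y
  proof -
    have "cos w = sin (real n * (pi * (real j / real m)))" "sin w = cos (real n * (pi * (real j / real m)))"
      "sin y = cos (pi * (real j / real m))" "cos y = sin (pi * (real j / real m))"
      unfolding that(2,3) cos_diff sin_diff by simp_all
    then show ?thesis using conj[OF that(1)] by (simp only:)
  qed
  have "odd m \<or> 4 dvd m \<or> m mod 4 = 2" by presburger
  then consider "odd m" | "4 dvd m" | "m mod 4 = 2" by blast
  then show False
  proof cases
    case 1
    define j where "j = (m - 1) div 2"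
    have jm: "2 * j + 1 = m" using 1 unfolding j_def by (auto elim: oddE)
    have "coprime j m"
      by (rule coprimeI) (metis jm dvd_mult dvd_add_right_iff)
    moreover have "pi / real (2 * m) = pi / 2 - pi * (real j / real m)"
    proof -
      have "real m = 2 * real j + 1" using jm by linarith
      then show ?thesis using m3 by (simp add: field_simps)
    qed
    moreover have "pi * of_int (int m - 2 * int n * int j) / real (2 * m) = pi / 2 - real n * (pi * (real j / real m))"
      using m3 by (simp add: field_simps)
    ultimately have "cos (pi * of_int (int m - 2 * int n * int j) / real (2 * m)) * sin (pi / real (2 * m)) =
        real n * sin (pi * of_int (int m - 2 * int n * int j) / real (2 * m)) * cos (pi / real (2 * m))"
      by (rule flip)
    moreover have "2 * m \<ge> 3" using m3 by simp
    ultimately show False using gutkin_equation_unsolvable_near_half n by blast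
  next
    case 2
    then obtain i where i: "m = 4 * i" by auto
    have i0: "i > 0" using m3 i by simp
    have "coprime (2 * i - 1) (2 * (2 * i - 1) + 2)"
      unfolding coprime_iff_gcd_eq_1 gcd_add_mult by (simp add: i0 flip: coprime_iff_gcd_eq_1)
    moreover have "2 * (2 * i - 1) + 2 = m" using i i0 by simp
    ultimately have "coprime (2 * i - 1) m" by simp
    moreover have j: "real (2 * i - 1) = 2 * real i - 1" using i0 by (simp add: of_nat_diff)
    have "pi / real m = pi / 2 - pi * (real (2 * i - 1) / real m)"
      unfolding j i using i0 by (simp add: field_simps)
    moreover have "pi * of_int (2 * int i - int n * (2 * int i - 1)) / real m = pi / 2 - real n * (pi * (real (2 * i - 1) / real m))"
      unfolding j i using i0 by (simp add: field_simps)
    ultimately have "cos (pi * of_int (2 * int i - int n * (2 * int i - 1)) / real m) * sin (pi / real m) =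
        real n * sin (pi * of_int (2 * int i - int n * (2 * int i - 1)) / real m) * cos (pi / real m)"
      by (rule flip)
    then show False using gutkin_equation_unsolvable_near_half m3 n by blast
  next
    case 3
    then obtain i where i: "m = 4 * i + 2" by (metis mult.commute mult_div_mod_eq)
    have i0: "i > 0" using m3 i by simp
    define M where "M = 2 * i + 1"
    have M: "m = 2 * M" "M \<ge> 3" using i i0 by (auto simp: M_def)
    have "coprime (2 * i - 1) (2 ^ 2)" unfolding coprime_power_right_iff using i0 by simp
    then have "coprime (2 * i - 1) (2 * (2 * i - 1) + 2 ^ 2)"
      unfolding coprime_iff_gcd_eq_1 gcd_add_mult .
    moreover have "2 * (2 * i - 1) + 2 ^ 2 = m" using i i0 by simp
    ultimately have cop: "coprime (2 * i - 1) m" by simp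
    define u where "u = int M - int n * (2 * int i - 1)"
    define y where "y = pi / real M"
    define w where "w = pi * of_int u / real (2 * M)"
    have "cos w * sin y = real n * sin w * cos y"
    proof (rule flip[OF cop])
      have j: "real (2 * i - 1) = 2 * real i - 1" using i0 by (simp add: of_nat_diff)
      have M': "real M = 2 * real i + 1" "real m = 2 * (2 * real i + 1)" by (simp_all add: M M_def)
      show "y = pi / 2 - pi * (real (2 * i - 1) / real m)"
        unfolding y_def j M' by (simp add: field_simps)
      show "w = pi / 2 - real n * (pi * (real (2 * i - 1) / real m))"
        unfolding w_def u_def j M'(2) by (simp add: M_def field_simps)
    qed
    have y2: "y / 2 = pi / real (2 * M)" by (simp add: y_def)
    have ypos: "0 < y / 2" "y / 2 < pi / 2" "y < pi / 2" "0 < y" using M by (auto simp: y_def field_simps)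
    then have pos: "sin (y / 2) > 0" "cos (y / 2) > 0" "sin y > 0" "cos y > 0"
      by (auto intro!: sin_gt_zero cos_gt_zero)
    have eq1: "cos w * sin y = real n * sin w * cos y" by fact
    have nz: "sin w \<noteq> 0"
    proof
      assume 0: "sin w = 0"
      then have "cos w = 0" using eq1 pos by auto
      with 0 show False using sin_cos_squared_add[of w] by simp
    qed
    have le1: "\<bar>cos w\<bar> * sin (y / 2) \<le> \<bar>sin w\<bar> * cos (y / 2)"
      using abs_cos_sin_le[of "2 * M" u] nz M unfolding w_def y2 by simp
    have "\<bar>cos w * sin y\<bar> = \<bar>real n * sin w * cos y\<bar>" unfolding eq1 ..
    then have "real n * \<bar>sin w\<bar> * cos y = \<bar>cos w\<bar> * sin y"
      using pos by (simp add: abs_mult)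
    also have "\<dots> = (\<bar>cos w\<bar> * sin (y / 2)) * (2 * cos (y / 2))"
      using sin_double[of "y / 2"] by simp
    also have "\<dots> \<le> (\<bar>sin w\<bar> * cos (y / 2)) * (2 * cos (y / 2))"
      using le1 pos by (intro mult_right_mono) auto
    finally have "real n * \<bar>sin w\<bar> * cos y \<le> (\<bar>sin w\<bar> * cos (y / 2)) * (2 * cos (y / 2))" .
    then have "\<bar>sin w\<bar> * (real n * cos y) \<le> \<bar>sin w\<bar> * (2 * (cos (y / 2))\<^sup>2)"
      by (simp add: power2_eq_square algebra_simps)
    then have "real n * cos y \<le> 2 * (cos (y / 2))\<^sup>2" using nz by simp
    moreover have "cos (2 * (y / 2)) = 2 * (cos (y / 2))\<^sup>2 - 1" by (rule cos_double_cos)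
    ultimately have le: "real n * cos y \<le> 1 + cos y" by simp
    have n3: "n \<ge> 3"
    proof (rule ccontr)
      assume "\<not> n \<ge> 3"
      then have n2: "n = 2" using n by simp
      have "0 < pi * \<rho>" "pi * \<rho> < pi" using \<rho> by auto
      from gutkin_equation_unsolvable_2[OF this] eq show False unfolding n2 of_nat_numeral by blast
    qed
    \<comment> \<open>For n >= 3 this leaves only y = pi/3, that is m = 6, and then n = 3; but there
      w = 0, against \<open>nz\<close>.\<close>
    have "(real n - 1) * cos y \<le> 1" using le by (simp add: algebra_simps)
    moreover have "(real n - 1) * cos y \<ge> 2 * cos y" using n3 pos by (intro mult_right_mono) auto
    ultimately have "cos y \<le> cos (pi / 3)" by (simp add: cos_60)
    then have "pi / 3 \<le> y" using ypos by (subst (asm) cos_mono_le_eq) auto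
    then have M3: "M = 3" using M(2) by (simp add: y_def field_simps)
    then have "cos y = 1 / 2" by (simp add: y_def cos_60)
    with le have "real n \<le> 3" by simp
    with n3 have "n = 3" by simp
    moreover have "i = 1" using M3 by (simp add: M_def)
    ultimately have "w = 0" by (simp add: w_def u_def M3)
    with nz show False by simp
  qed
qed

section \<open>The exceptional set\<close>

text \<open>The sine form is free of poles: as cos(pi \<rho>) > 0, a zero of cos(n pi \<rho>) would
  force sin(n pi \<rho>) = 0 as well.\<close>

lemma mem_rigid_rotation_numbers_iff:
  "\<rho> \<in> rigid_rotation_numbers \<longleftrightarrow> 0 < \<rho> \<and> \<rho> < 1 / 2 \<and>
     (\<forall>n\<ge>2. sin (real n * (pi * \<rho>)) * cos (pi * \<rho>) \<noteq> real n * cos (real n * (pi * \<rho>)) * sin (pi * \<rho>))"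
proof -
  have "tan (real n * pi * \<rho>) = real n * tan (pi * \<rho>) \<longleftrightarrow>
      sin (real n * (pi * \<rho>)) * cos (pi * \<rho>) = real n * cos (real n * (pi * \<rho>)) * sin (pi * \<rho>)"
    if \<rho>: "0 < \<rho>" "\<rho> < 1 / 2" and n: "n \<ge> 2" for n
  proof
    have a: "0 < pi * \<rho>" "pi * \<rho> < pi / 2" using \<rho> by (auto simp: field_simps)
    then have c: "cos (pi * \<rho>) > 0" by (intro cos_gt_zero)
    show "sin (real n * (pi * \<rho>)) * cos (pi * \<rho>) = real n * cos (real n * (pi * \<rho>)) * sin (pi * \<rho>)"
      if "tan (real n * pi * \<rho>) = real n * tan (pi * \<rho>)"
      using tan_multiple_eq[of "pi * \<rho>" n] a n that by (simp add: mult.assoc)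
    assume eq: "sin (real n * (pi * \<rho>)) * cos (pi * \<rho>) = real n * cos (real n * (pi * \<rho>)) * sin (pi * \<rho>)"
    have "cos (real n * (pi * \<rho>)) \<noteq> 0"
    proof
      assume 0: "cos (real n * (pi * \<rho>)) = 0"
      then have "sin (real n * (pi * \<rho>)) = 0" using eq c by simp
      with 0 show False using sin_cos_squared_add[of "real n * (pi * \<rho>)"] by simp
    qed
    then show "tan (real n * pi * \<rho>) = real n * tan (pi * \<rho>)"
      using eq c by (simp add: tan_def mult.assoc frac_eq_eq mult_ac)
  qed
  then show ?thesis unfolding rigid_rotation_numbers_def by auto
qed

lemma rationals_subset_rigid: "\<rat> \<inter> {0<..<1/2} \<subseteq> rigid_rotation_numbers"
  using gutkin_equation_unsolvable_rational by (auto simp: mem_rigid_rotation_numbers_iff)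

text \<open>For each n the solutions inject into the roots of \<open>gutkin_poly n\<close>, which is
  nonzero because its constant coefficient is n - 1. The end point 1/2, never rigid by definition,
  is added by hand.\<close>

lemma countable_non_rigid: "countable ({0<..1/2} - rigid_rotation_numbers)"
proof -
  define Z where "Z n = {\<rho>. 0 < \<rho> \<and> \<rho> < 1 / 2 \<and> ipoly (gutkin_poly n) (cis (2 * (pi * \<rho>))) = 0}" for n
  have fin: "finite (Z n)" if n: "n \<ge> 2" for n
  proof -
    let ?P = "map_poly of_int (gutkin_poly n) :: complex poly"
    have "coeff (gutkin_poly n) 0 = int n - 1"
      unfolding poly_0_coeff_0[symmetric] gutkin_poly_def using n
      by (simp add: poly_monom zero_power)
    then have "coeff ?P 0 \<noteq> 0" using n by (simp add: coeff_map_poly)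
    then have "?P \<noteq> 0" by auto
    then have "finite {z. poly ?P z = 0}" by (rule poly_roots_finite)
    moreover have "inj_on (\<lambda>\<rho>. cis (2 * (pi * \<rho>))) (Z n)"
    proof (rule inj_onI)
      fix x y assume xy: "x \<in> Z n" "y \<in> Z n" and e: "cis (2 * (pi * x)) = cis (2 * (pi * y))"
      have "cos (2 * (pi * x)) = cos (2 * (pi * y))" using arg_cong[OF e, of Re] unfolding cis.sel .
      moreover have "0 \<le> 2 * (pi * x)" "2 * (pi * x) \<le> pi" "0 \<le> 2 * (pi * y)" "2 * (pi * y) \<le> pi"
      proof -
        have "0 < x" "x < 1 / 2" "0 < y" "y < 1 / 2" using xy unfolding Z_def by blast+
        then show "0 \<le> 2 * (pi * x)" "2 * (pi * x) \<le> pi" "0 \<le> 2 * (pi * y)" "2 * (pi * y) \<le> pi"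
          by (auto simp: field_simps)
      qed
      ultimately have "2 * (pi * x) = 2 * (pi * y)" by (blast intro: cos_inj_pi)
      then show "x = y" by simp
    qed
    moreover have "(\<lambda>\<rho>. cis (2 * (pi * \<rho>))) ` Z n \<subseteq> {z. poly ?P z = 0}"
      by (auto simp: Z_def ipoly_def)
    ultimately show ?thesis using finite_imageD[OF finite_subset] by blast
  qed
  have "{0<..1/2} - rigid_rotation_numbers \<subseteq> insert (1/2) (\<Union>n\<in>{2..}. Z n)"
  proof
    fix x assume x: "x \<in> {0<..1/2} - rigid_rotation_numbers"
    show "x \<in> insert (1/2) (\<Union>n\<in>{2..}. Z n)"
    proof (cases "x = 1 / 2")
      case False
      with x have x': "0 < x" "x < 1 / 2" "x \<notin> rigid_rotation_numbers" by simp_all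
      then obtain n where "n \<ge> 2"
        "sin (real n * (pi * x)) * cos (pi * x) = real n * cos (real n * (pi * x)) * sin (pi * x)"
        unfolding mem_rigid_rotation_numbers_iff by blast
      then have "x \<in> Z n" using x' unfolding Z_def gutkin_poly_root_iff by blast
      with \<open>n \<ge> 2\<close> show ?thesis by blast
    qed simp
  qed
  moreover have "countable (insert (1/2) (\<Union>n\<in>{2..}. Z n))"

  proof (intro countable_insert countable_UN)
    show "countable (Z n)" if "n \<in> {2..}" for n
      using fin[of n] that by (intro countable_finite) simp
  qed simp
  ultimately show ?thesis by (rule countable_subset)
qed

text \<open>At the zeros of cos(n pi x) the difference of the two sides equals sin(n pi x) cos(pi
  x), whose sign alternates from one zero to the next. For large n every interval contains two
  consecutive zeros, hence a solution.\<close>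

lemma dense_non_rigid: "{0<..1/2} \<subseteq> closure ({0<..1/2} - rigid_rotation_numbers)"
proof
  have meet: "\<exists>x\<in>{a<..<b}. x \<in> {0<..1/2} - rigid_rotation_numbers"
    if ab: "0 \<le> a" "a < b" "b \<le> 1 / 2" for a b :: real
  proof -
    \<comment> \<open>A length above 3/n leaves room for two consecutive points (k + 1/2)/n.\<close>
    obtain n :: nat where n: "real n > 3 / (b - a)" using reals_Archimedean2 by blast
    have "3 / (b - a) > 3" using ab by (simp add: field_simps)
    then have n2: "n \<ge> 2" using n by linarith
    have n3: "real n * (b - a) > 3" using n ab by (simp add: field_simps)
    define k where "k = \<lfloor>real n * a\<rfloor> + 1"
    define f where "f x = sin (real n * (pi * x)) * cos (pi * x) - real n * cos (real n * (pi * x)) * sin (pi * x)" for x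
    define u where "u j = (of_int j + 1 / 2) / real n" for j :: int
    have fu: "f (u j) = (if even j then 1 else - 1) * cos (pi * u j)" for j
    proof -
      have "real n * (pi * u j) = of_int j * pi + pi / 2" using n2 by (simp add: u_def field_simps)
      then show ?thesis using sin_npi_int[of j] cos_npi_int[of j]
        by (simp add: f_def sin_add cos_add mult.commute[of pi])
    qed
    have ka: "real n * a < of_int k" "of_int k \<le> real n * a + 1" unfolding k_def by linarith+
    have ua: "a < u k" "u k < u (k + 1)" "u (k + 1) < b"
      using ka n3 n2 by (auto simp: u_def field_simps)
    have cpos: "cos (pi * u j) > 0" if "j = k \<or> j = k + 1" for j
    proof (rule cos_gt_zero)
      have "0 < u j" "u j < 1 / 2" using ua ab that by auto
      then show "0 < pi * u j" "pi * u j < pi / 2" by auto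
    qed
    have cont: "continuous_on S f" for S unfolding f_def by (intro continuous_intros)
    have "\<exists>x. u k \<le> x \<and> x \<le> u (k + 1) \<and> f x = 0"
    proof (cases "even k")
      case True
      then have "f (u k) \<ge> 0" "f (u (k + 1)) \<le> 0" unfolding fu using cpos[of k] cpos[of "k + 1"] by auto
      then show ?thesis using ua cont by (intro IVT2') auto
    next
      case False
      then have "f (u k) \<le> 0" "f (u (k + 1)) \<ge> 0" unfolding fu using cpos[of k] cpos[of "k + 1"] by auto
      then show ?thesis using ua cont by (intro IVT') auto
    qed
    then obtain x where x: "u k \<le> x" "x \<le> u (k + 1)" "f x = 0" by blast
    have "x \<notin> rigid_rotation_numbers"
      unfolding mem_rigid_rotation_numbers_iff using x(3) n2 by (auto simp: f_def)
    then show ?thesis using x ua ab by (intro bexI[of _ x]) auto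
  qed
  fix x :: real assume x: "x \<in> {0<..1/2}"
  show "x \<in> closure ({0<..1/2} - rigid_rotation_numbers)"
    unfolding closure_approachable
  proof (intro allI impI)
    fix e :: real assume "e > 0"
    then have "0 \<le> max 0 (x - e)" "max 0 (x - e) < x" "x \<le> 1 / 2" using x by auto
    from meet[OF this] obtain y where "y \<in> {max 0 (x - e)<..<x}" "y \<in> {0<..1/2} - rigid_rotation_numbers" by blast
    then show "\<exists>y\<in>{0<..1/2} - rigid_rotation_numbers. dist y x < e"
      by (intro bexI[of _ y]) (auto simp: dist_real_def)
  qed
qed

section \<open>Parametrisation of the boundary by the normal angle\<close>

lemma shift_int_multiple:
  fixes f :: "'a::ring_1 \<Rightarrow> 'b::ring_1"
  assumes "\<And>x. f (x + p) = f x + c"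
  shows "f (x + of_int k * p) = f x + of_int k * c"
proof (induction k rule: int_induct[where k = 0])
  case (step1 k)
  then show ?case using assms[of "x + of_int k * p"] by (simp add: algebra_simps)
next
  case (step2 k)
  then show ?case using assms[of "x + of_int (k - 1) * p"] by (simp add: algebra_simps)
qed simp

lemma floor_two_pi:
  "2 * pi * of_int \<lfloor>x / (2 * pi)\<rfloor> \<le> x" "x \<le> 2 * pi * of_int \<lfloor>x / (2 * pi)\<rfloor> + 2 * pi"
proof -
  have "2 * pi * of_int \<lfloor>x / (2 * pi)\<rfloor> \<le> 2 * pi * (x / (2 * pi))"
    by (intro mult_left_mono) auto
  moreover have "2 * pi * (x / (2 * pi)) \<le> 2 * pi * (of_int \<lfloor>x / (2 * pi)\<rfloor> + 1)"
    by (intro mult_left_mono) (auto simp: real_of_int_floor_add_one_ge)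
  moreover have "2 * pi * (x / (2 * pi)) = x" by simp
  ultimately show "2 * pi * of_int \<lfloor>x / (2 * pi)\<rfloor> \<le> x" "x \<le> 2 * pi * of_int \<lfloor>x / (2 * pi)\<rfloor> + 2 * pi"
    by (simp_all add: distrib_left)
qed

lemma exists_antiderivative:
  fixes f :: "real \<Rightarrow> 'a::euclidean_space"
  assumes "continuous_on UNIV f"
  obtains F where "\<And>x. (F has_vector_derivative f x) (at x)"
proof -
  have "\<exists>F. \<forall>x :: real. -\<infinity> < ereal x \<longrightarrow> ereal x < \<infinity> \<longrightarrow> (F has_vector_derivative f x) (at x)"
    by (rule einterval_antiderivative) (use assms in \<open>auto simp: continuous_on_eq_continuous_at\<close>)
  then show ?thesis using that by auto
qed

lemma constant_if_vector_derivative_0: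
  fixes f :: "real \<Rightarrow> 'a::real_normed_vector"
  assumes "\<And>x. (f has_vector_derivative 0) (at x)"
  shows "f x = f y"
proof -
  obtain c where "\<And>x. x \<in> UNIV \<Longrightarrow> f x = c"
    using has_vector_derivative_zero_constant[of UNIV f] assms by auto
  then show ?thesis by auto
qed

lemma has_vector_derivative_shift:
  fixes f :: "real \<Rightarrow> 'a::real_normed_vector"
  assumes "(f has_vector_derivative f') (at (x + d))"
  shows "((\<lambda>x. f (x + d)) has_vector_derivative f') (at x)"
proof -
  have "((\<lambda>x. x + d) has_vector_derivative 1) (at x)"
    unfolding has_real_derivative_iff_has_vector_derivative[symmetric]
    by (auto intro!: derivative_eq_intros)
  from vector_diff_chain_at[OF this assms] show ?thesis by (simp add: o_def)
qed

text \<open>For an antiderivative F, the increment F(x + 2 pi) - F(x) has derivative 0 and so does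
  not depend on x.\<close>

lemma periodic_integral_shift:
  fixes f :: "real \<Rightarrow> 'a::euclidean_space"
  assumes cont: "continuous_on UNIV f" and per: "\<And>x. f (x + 2 * pi) = f x"
  shows "integral {0..2 * pi} (\<lambda>x. f (x + c)) = integral {0..2 * pi} f"
proof -
  obtain F where F: "\<And>x. (F has_vector_derivative f x) (at x)"
    using exists_antiderivative[OF cont] by blast
  note shift = has_vector_derivative_shift[OF F]
  have int: "integral {0..2 * pi} (\<lambda>x. f (x + d)) = F (2 * pi + d) - F (0 + d)" for d
    by (intro integral_unique fundamental_theorem_of_calculus)
      (auto intro: has_vector_derivative_at_within shift)
  have "((\<lambda>x. F (x + 2 * pi) - F x) has_vector_derivative f (x + 2 * pi) - f x) (at x)" for x
    by (intro has_vector_derivative_diff shift F)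
  then have "F (c + 2 * pi) - F c = F (0 + 2 * pi) - F 0"
    by (intro constant_if_vector_derivative_0[of "\<lambda>x. F (x + 2 * pi) - F x"]) (simp add: per)
  then show ?thesis using int[of c] int[of 0] by (simp add: add.commute)
qed

lemma inner_complex_Re: "inner x y = Re (cnj x * y)"
  by (simp add: inner_complex_def)

lemma inner_cis_cis: "inner (cis a) (cis b) = cos (b - a)"
  by (simp add: inner_complex_def cos_diff)

lemma inner_icis_cis: "inner (\<i> * cis a) (cis b) = sin (b - a)"
  by (simp add: inner_complex_def sin_diff)

lemma cis_has_vector_derivative:
  assumes "(f has_real_derivative d) (at t)"
  shows "((\<lambda>t. cis (f t)) has_vector_derivative d *\<^sub>R (\<i> * cis (f t))) (at t)"
  unfolding has_vector_derivative_complex_iff using assms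
  by (auto intro!: derivative_eq_intros)

lemma inner_has_real_derivative:
  fixes f g :: "real \<Rightarrow> complex"
  assumes "(f has_vector_derivative f') (at t)" "(g has_vector_derivative g') (at t)"
  shows "((\<lambda>t. inner (f t) (g t)) has_real_derivative (inner (f t) g' + inner f' (g t))) (at t)"
  using assms unfolding has_vector_derivative_def has_field_derivative_def
  by (auto intro!: derivative_eq_intros simp: algebra_simps fun_eq_iff)

text \<open>Otherwise the midpoint would be an interior point with the same maximal value, and a
  small push along u would exceed it.\<close>

lemma strictly_convex_unique_maximizer:
  assumes sc: "strictly_convex \<Omega>" and xy: "x \<in> closure \<Omega>" "y \<in> closure \<Omega>" and u: "u \<noteq> 0"
    and max: "\<And>p. p \<in> closure \<Omega> \<Longrightarrow> inner p u \<le> inner x u" "\<And>p. p \<in> closure \<Omega> \<Longrightarrow> inner p u \<le> inner y u"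
  shows "x = y"
proof (rule ccontr)
  assume "x \<noteq> y"
  define m where "m = midpoint x y"
  have "m \<in> open_segment x y" using \<open>x \<noteq> y\<close> by (simp add: m_def)
  then have "m \<in> interior \<Omega>" using sc xy \<open>x \<noteq> y\<close> unfolding strictly_convex_def by blast
  then obtain e where e: "e > 0" "ball m e \<subseteq> \<Omega>" unfolding mem_interior by blast
  define p where "p = m + (e / (2 * norm u)) *\<^sub>R u"
  have "p \<in> ball m e" using e u by (simp add: p_def dist_norm)
  then have "p \<in> closure \<Omega>" using e closure_subset by blast
  moreover have "inner m u = inner x u"
    using max(1)[OF xy(2)] max(2)[OF xy(1)] by (simp add: m_def midpoint_def inner_add_left)
  moreover have "inner p u > inner m u"
    using e u by (simp add: p_def inner_add_left)
  ultimately show False using max(1)[of p] by simp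
qed

lemma support_function_eq:
  assumes "x \<in> closure \<Omega>" "\<And>p. p \<in> closure \<Omega> \<Longrightarrow> inner p (cis s) \<le> inner x (cis s)"
  shows "support_function \<Omega> s = inner x (cis s)"
  unfolding support_function_def
proof (rule cSup_eq_non_empty)
  show "(\<lambda>x. inner x (cis s)) ` \<Omega> \<noteq> {}" using assms(1) by auto
  show "y \<le> inner x (cis s)" if "y \<in> (\<lambda>x. inner x (cis s)) ` \<Omega>" for y
    using that assms(2) closure_subset by auto
  fix y assume "\<And>z. z \<in> (\<lambda>x. inner x (cis s)) ` \<Omega> \<Longrightarrow> z \<le> y"
  then have "\<Omega> \<subseteq> {p. inner p (cis s) \<le> y}" by auto
  moreover have "closed {p. inner p (cis s) \<le> y}"
    by (intro closed_Collect_le continuous_intros)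
  ultimately show "inner x (cis s) \<le> y" using assms(1) closure_minimal by blast
qed

lemma second_derivative_nonpos_at_max:
  fixes f :: "real \<Rightarrow> real"
  assumes f: "\<And>x. (f has_real_derivative f' x) (at x)"
    and f': "(f' has_real_derivative d) (at t)" and max: "\<And>x. f x \<le> f t"
  shows "f' t = 0" "d \<le> 0"
proof -
  show 0: "f' t = 0"
    using DERIV_local_max[OF f[of t], of 1] max by auto
  show "d \<le> 0"
  proof (rule ccontr)
    assume "\<not> d \<le> 0"
    then obtain e where e: "e > 0" "\<And>h. h > 0 \<Longrightarrow> h < e \<Longrightarrow> f' t < f' (t + h)"
      using has_real_derivative_pos_inc_right[of f' d t UNIV] f' by auto
    obtain x where x: "t < x" "x < t + e / 2" "f (t + e / 2) - f t = (t + e / 2 - t) * f' x"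
      using MVT2[of t "t + e / 2" f f'] f e(1) by auto
    have "f' x > 0" using e(2)[of "x - t"] x 0 by auto
    then have "f (t + e / 2) - f t > 0" unfolding x(3) using e(1) by simp
    then show False using max[of "t + e / 2"] by simp
  qed
qed

section \<open>Normal angle of the boundary curve and Cauchy's perimeter formula\<close>

lemma C1_velocity:
  assumes "\<gamma> C1_differentiable_on UNIV"
  shows "(\<gamma> has_vector_derivative velocity \<gamma> s) (at s)" "continuous_on UNIV (velocity \<gamma>)"
proof -
  have "\<gamma> differentiable (at s)" "continuous_on UNIV (\<lambda>x. vector_derivative \<gamma> (at x))"
    using assms unfolding C1_differentiable_on_eq by blast+
  then show "(\<gamma> has_vector_derivative velocity \<gamma> s) (at s)" "continuous_on UNIV (velocity \<gamma>)"
    unfolding velocity_def[abs_def] by (simp_all only: vector_derivative_works[symmetric])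
qed

lemma C2_positively_curved_boundaryD:
  assumes "C2_positively_curved_boundary \<Omega> \<gamma>"
  shows "\<gamma> (t + 1) = \<gamma> t" "\<gamma> C1_differentiable_on UNIV" "velocity \<gamma> C1_differentiable_on UNIV"
    "velocity \<gamma> t \<noteq> 0" "simple_path \<gamma>" "path_image \<gamma> = frontier \<Omega>" "signed_curvature \<gamma> t > 0"
  using assms unfolding C2_positively_curved_boundary_def by blast+

lemma range_boundary_curve:
  assumes C2: "C2_positively_curved_boundary \<Omega> \<gamma>"
  shows "range \<gamma> = frontier \<Omega>"
proof
  have per: "\<gamma> (t + 1) = \<gamma> t" for t by (rule C2_positively_curved_boundaryD(1)[OF C2])
  have pern: "\<gamma> (t + of_int n) = \<gamma> t" for t n
    using shift_int_multiple[of \<gamma> 1 0 t n] per by simp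
  have fr: "\<gamma> ` {0..1} = frontier \<Omega>"
    using C2_positively_curved_boundaryD(6)[OF C2] unfolding path_image_def .
  then show "frontier \<Omega> \<subseteq> range \<gamma>" by blast
  show "range \<gamma> \<subseteq> frontier \<Omega>"
  proof
    fix x assume "x \<in> range \<gamma>"
    then obtain t where x: "x = \<gamma> t" by blast
    have "\<gamma> t = \<gamma> (frac t)" using pern[of "frac t" "\<lfloor>t\<rfloor>"] by (simp add: frac_def)
    moreover have "frac t \<in> {0..1}" using frac_lt_1[of t] by (simp add: less_imp_le)
    ultimately show "x \<in> frontier \<Omega>" using fr x by blast
  qed
qed

text \<open>Some line supports the domain at \<open>\<gamma> t\<close>. The curve stays on one side
  of it, so the first derivative test makes its normal orthogonal to the velocity, and the second
  derivative test with positive curvature decides which of the two normals points outwards.\<close>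

lemma boundary_curve_support:
  assumes open\<Omega>: "open \<Omega>" and conv: "convex \<Omega>" and C2: "C2_positively_curved_boundary \<Omega> \<gamma>"
    and p: "p \<in> closure \<Omega>"
  shows "inner p (- \<i> * sgn (velocity \<gamma> t)) \<le> inner (\<gamma> t) (- \<i> * sgn (velocity \<gamma> t))"
proof -
  have fr: "range \<gamma> \<subseteq> frontier \<Omega>" using range_boundary_curve[OF C2] by simp
  define v where "v = velocity \<gamma> t"
  define a where "a = velocity (velocity \<gamma>) t"
  have v0: "v \<noteq> 0" using C2_positively_curved_boundaryD(4)[OF C2] by (simp add: v_def)
  have d1: "(\<gamma> has_vector_derivative velocity \<gamma> s) (at s)" for s
    by (rule C1_velocity(1)[OF C2_positively_curved_boundaryD(2)[OF C2]])
  have d2: "(velocity \<gamma> has_vector_derivative velocity (velocity \<gamma>) s) (at s)" for s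
    by (rule C1_velocity(1)[OF C2_positively_curved_boundaryD(3)[OF C2]])
  have curv: "Im (cnj v * a) > 0"
  proof -
    have "Im (cnj v * a) / norm v ^ 3 > 0"
      using C2_positively_curved_boundaryD(7)[OF C2, of t] unfolding signed_curvature_def v_def a_def .
    moreover have "norm v ^ 3 > 0" using v0 by simp
    ultimately show ?thesis using zero_less_divide_iff[of "Im (cnj v * a)" "norm v ^ 3"] by linarith
  qed
  have x: "\<gamma> t \<in> frontier \<Omega>" using fr by auto
  have rel: "rel_interior \<Omega> = \<Omega>" using open\<Omega> by (rule rel_interior_open)
  have "\<gamma> t \<in> closure \<Omega>" "\<gamma> t \<notin> rel_interior \<Omega>"
    using x interior_open[OF open\<Omega>] unfolding frontier_def rel by simp_all
  from supporting_hyperplane_relative_frontier[OF conv this]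
  obtain b where b: "b \<noteq> 0" "\<And>y. y \<in> closure \<Omega> \<Longrightarrow> inner b (\<gamma> t) \<le> inner b y"
    by metis
  have max: "inner (\<gamma> s) (- b) \<le> inner (\<gamma> t) (- b)" for s
    using b(2)[of "\<gamma> s"] fr by (auto simp: frontier_def inner_commute)
  have f1: "((\<lambda>s. inner (\<gamma> s) (- b)) has_real_derivative inner (velocity \<gamma> s) (- b)) (at s)" for s
    using inner_has_real_derivative[OF d1 has_vector_derivative_const[of "- b"]] by simp
  have f2: "((\<lambda>s. inner (velocity \<gamma> s) (- b)) has_real_derivative inner a (- b)) (at t)"
    using inner_has_real_derivative[OF d2 has_vector_derivative_const[of "- b"]] by (simp add: a_def)
  have 1: "inner v b = 0" and 2: "inner a b \<ge> 0"
    using second_derivative_nonpos_at_max[OF f1 f2 max] by (simp_all add: v_def)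
  \<comment> \<open>b = (m / |v|^2) i v, because b is orthogonal to v. The curvature determines the
    sign of m.\<close>
  define m where "m = Im (cnj v * b)"
  have Re0: "Re (cnj v * b) = 0" using 1 by (simp add: inner_complex_Re)
  have "cnj v * b = \<i> * of_real m" using Re0 by (simp add: complex_eq_iff m_def)
  then have "v * cnj v * b = \<i> * of_real m * v" by (simp add: mult_ac)
  then have beq: "of_real ((norm v)\<^sup>2) * b = of_real m * (\<i> * v)"
    unfolding complex_norm_square[of v] by (simp add: mult_ac)
  then have beq: "(norm v)\<^sup>2 *\<^sub>R b = m *\<^sub>R (\<i> * v)" by (simp add: scaleR_conv_of_real)
  have iv: "inner a (\<i> * v) = Im (cnj v * a)" by (simp add: inner_complex_def)
  have "(norm v)\<^sup>2 * inner a b = m * inner a (\<i> * v)"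
    using arg_cong[OF beq, of "inner a"] by simp
  moreover have "(norm v)\<^sup>2 * inner a b \<ge> 0" using 2 by simp
  ultimately have "m * Im (cnj v * a) \<ge> 0" unfolding iv by simp
  then have m: "m \<ge> 0" using curv by (simp add: zero_le_mult_iff)
  have "m \<noteq> 0" using beq v0 b(1) by auto
  then have mpos: "m > 0" using m by simp
  have "m * inner (p - \<gamma> t) (\<i> * v) = (norm v)\<^sup>2 * inner (p - \<gamma> t) b"
    using arg_cong[OF beq, of "inner (p - \<gamma> t)"] by simp
  also have "inner (p - \<gamma> t) b \<ge> 0" using b(2)[OF p] by (simp add: inner_diff_right inner_commute[of _ b])
  then have "(norm v)\<^sup>2 * inner (p - \<gamma> t) b \<ge> 0" by simp
  finally have "inner (p - \<gamma> t) (\<i> * v) \<ge> 0" using mpos by (simp add: zero_le_mult_iff)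
  then have "inner (p - \<gamma> t) (\<i> * sgn v) \<ge> 0"
    by (simp add: sgn_div_norm)
  then show ?thesis by (simp add: v_def inner_diff_left)
qed

text \<open>A global logarithm of the velocity v: for an antiderivative L of v'/v the product v
  exp(-L) is constant. Its imaginary part is a differentiable tangent angle without branch
  cuts.\<close>

lemma tangent_exponential:
  assumes C2: "C2_positively_curved_boundary \<Omega> \<gamma>"
  obtains E where "\<And>t. velocity \<gamma> t = exp (E t)"
    "\<And>t. (E has_vector_derivative velocity (velocity \<gamma>) t / velocity \<gamma> t) (at t)"
proof -
  let ?v = "velocity \<gamma>" and ?l = "\<lambda>t. velocity (velocity \<gamma>) t / velocity \<gamma> t"
  have v0: "?v t \<noteq> 0" for t by (rule C2_positively_curved_boundaryD(4)[OF C2])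
  note cv = C1_velocity[OF C2_positively_curved_boundaryD(2)[OF C2]]
  note cvv = C1_velocity[OF C2_positively_curved_boundaryD(3)[OF C2]]
  have "continuous_on UNIV ?l"
    using v0 by (intro continuous_on_divide cv cvv) simp
  then obtain L where L: "\<And>t. (L has_vector_derivative ?l t) (at t)"
    using exists_antiderivative by blast
  define q where "q t = ?v t * exp (- L t)" for t
  have "(q has_vector_derivative 0) (at t)" for t
  proof -
    have "((\<lambda>t. exp (- L t)) has_vector_derivative - ?l t * exp (- L t)) (at t)"
      using field_vector_diff_chain_at[OF has_vector_derivative_minus[OF L] DERIV_exp, of t] by (simp add: o_def)
    from has_vector_derivative_mult[OF cvv(1) this]
    have "(q has_vector_derivative ?v t * (- ?l t * exp (- L t)) + velocity ?v t * exp (- L t)) (at t)"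
      by (simp add: q_def[abs_def])
    moreover have "?v t * (- ?l t * exp (- L t)) + velocity ?v t * exp (- L t) = 0"
      using v0[of t] by simp
    ultimately show ?thesis by simp
  qed
  then have q: "q t = q 0" for t by (rule constant_if_vector_derivative_0)
  have q0: "q 0 \<noteq> 0" using v0[of 0] by (simp add: q_def)
  have "?v t = exp (L t + Ln (q 0))" for t
  proof -
    have "?v t = exp (L t) * q t" by (simp add: q_def exp_minus)
    then show ?thesis using q[of t] q0 by (simp add: exp_add)
  qed
  moreover have "((\<lambda>t. L t + Ln (q 0)) has_vector_derivative ?l t) (at t)" for t
    using has_vector_derivative_add[OF L has_vector_derivative_const] by simp
  ultimately show ?thesis by (rule that)
qed

text \<open>The normal angle \<theta> has derivative speed times curvature, hence is invertible; z
  is \<gamma> reparametrised by \<theta>, and R is the radius of curvature. The delicate point is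
  that \<theta> gains exactly 2 pi per period.\<close>

lemma C2_boundary_support_param:
  assumes op: "open \<Omega>" and sc: "strictly_convex \<Omega>" and C2: "C2_positively_curved_boundary \<Omega> \<gamma>"
  obtains z R where
    "\<And>s. (z has_vector_derivative R s *\<^sub>R (\<i> * cis s)) (at s)" "\<And>s. R s > 0"
    "\<And>s. z (s + 2 * pi) = z s" "range z = frontier \<Omega>"
    "\<And>s p. p \<in> closure \<Omega> \<Longrightarrow> inner p (cis s) \<le> inner (z s) (cis s)"
    "closed_curve_length \<gamma> = integral {0..2 * pi} (\<lambda>s. inner (z s) (cis s))"
proof -
  let ?v = "velocity \<gamma>"
  have conv: "convex \<Omega>" using sc by (simp add: strictly_convex_def)
  have per: "\<gamma> (t + 1) = \<gamma> t" for t by (rule C2_positively_curved_boundaryD(1)[OF C2])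
  note cv = C1_velocity[OF C2_positively_curved_boundaryD(2)[OF C2]]
  obtain E where E: "\<And>t. ?v t = exp (E t)" "\<And>t. (E has_vector_derivative velocity ?v t / ?v t) (at t)"
    using tangent_exponential[OF C2] by blast
  define k where "k t = Im (velocity ?v t / ?v t)" for t
  define \<theta> where "\<theta> t = Im (E t) - pi / 2" for t
  have kpos: "k t > 0" for t
  proof -
    have "Im (cnj (?v t) * velocity ?v t) / norm (?v t) ^ 3 > 0"
      using C2_positively_curved_boundaryD(7)[OF C2, of t] unfolding signed_curvature_def .
    moreover have n: "norm (?v t) > 0" using C2_positively_curved_boundaryD(4)[OF C2, of t] by simp
    moreover have "k t = Im (cnj (?v t) * velocity ?v t) / (norm (?v t))\<^sup>2"
      unfolding k_def complex_div_cnj[of _ "?v t"] by (simp add: mult.commute flip: of_real_power)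
    ultimately show ?thesis by (auto simp: zero_less_divide_iff)
  qed
  have \<theta>': "(\<theta> has_real_derivative k t) (at t)" for t
  proof -
    have "((\<lambda>t. Im (E t)) has_real_derivative k t) (at t)"
      using E(2)[of t] unfolding has_vector_derivative_complex_iff k_def by blast
    from DERIV_diff[OF this DERIV_const[of "pi / 2"]] show ?thesis by (simp add: \<theta>_def[abs_def])
  qed
  have \<theta>cont: "continuous_on S \<theta>" for S
    using \<theta>' DERIV_continuous_on has_field_derivative_at_within by blast
  have N: "- \<i> * sgn (?v t) = cis (\<theta> t)" for t
  proof -
    have "sgn (?v t) = cis (Im (E t))" unfolding E(1) exp_eq_polar sgn_div_norm
      by (simp add: norm_mult scaleR_conv_of_real)
    also have "\<dots> = cis (\<theta> t) * \<i>" by (simp add: \<theta>_def cis_mult flip: cis_pi_half)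
    finally show ?thesis by (simp add: complex_eq_iff)
  qed
  have speed: "?v t = norm (?v t) *\<^sub>R (\<i> * cis (\<theta> t))" for t
  proof -
    have "sgn (?v t) = \<i> * cis (\<theta> t)" unfolding N[symmetric] by simp
    moreover have "?v t = norm (?v t) *\<^sub>R sgn (?v t)"
      using C2_positively_curved_boundaryD(4)[OF C2, of t] by (simp add: sgn_div_norm)
    ultimately show ?thesis by metis
  qed
  have sup: "inner p (cis (\<theta> t)) \<le> inner (\<gamma> t) (cis (\<theta> t))" if "p \<in> closure \<Omega>" for p t
    using boundary_curve_support[OF op conv C2 that, of t] unfolding N .
  have mono: "strict_mono \<theta>"
    by (rule strict_monoI) (meson DERIV_pos_imp_increasing \<theta>' kpos)
  have \<gamma>cl: "\<gamma> t \<in> closure \<Omega>" if "t \<in> {0..1}" for t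
    using C2_positively_curved_boundaryD(6)[OF C2] that unfolding path_image_def frontier_def by blast
  have uniq: "\<gamma> s = \<gamma> t" if "cis (\<theta> s) = cis (\<theta> t)" "s \<in> {0..1}" "t \<in> {0..1}" for s t
    by (rule strictly_convex_unique_maximizer[OF sc \<gamma>cl \<gamma>cl, of s t "cis (\<theta> t)"])
      (use sup[of _ s] sup[of _ t] that in auto)
  have vper: "?v (t + 1) = ?v t" for t
    using has_vector_derivative_shift[where x = t and d = 1, OF cv(1)] cv(1)[of t] vector_derivative_unique_at
    unfolding per by blast
  have \<theta>1: "\<theta> 1 = \<theta> 0 + 2 * pi"
  proof -
    have "cis (\<theta> 1) = cis (\<theta> 0)" using vper[of 0] by (simp flip: N)
    then have "cos (\<theta> 1 - \<theta> 0) = 1" using inner_cis_cis[of "\<theta> 0" "\<theta> 1"] inner_cis_cis[of "\<theta> 0" "\<theta> 0"] by simp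
    then obtain n :: int where n: "\<theta> 1 - \<theta> 0 = of_int n * 2 * pi" unfolding cos_one_2pi_int by blast
    have "\<theta> 0 < \<theta> 1" using mono by (simp add: strict_mono_def)
    then have "of_int n * 2 * pi > 0" using n by linarith
    then have n1: "n \<ge> 1" by (simp add: zero_less_mult_iff)
    \<comment> \<open>With a second turn, some t strictly inside the period would have the same
      normal as 0. Both points maximize the same functional, so strict convexity makes them equal,
      and the curve would not be simple.\<close>
    have "\<not> n \<ge> 2"
    proof
      assume "n \<ge> 2"
      then have "of_int n * (2 * pi) \<ge> 2 * (2 * pi)" by (intro mult_right_mono) auto
      then have ge: "\<theta> 0 + 2 * pi < \<theta> 1" using n pi_gt_zero by linarith
      then have "\<exists>t. 0 \<le> t \<and> t \<le> 1 \<and> \<theta> t = \<theta> 0 + 2 * pi"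
        by (intro IVT' \<theta>cont) auto
      then obtain t where t: "0 \<le> t" "t \<le> 1" "\<theta> t = \<theta> 0 + 2 * pi" by blast
      have "cis (\<theta> t) = cis (\<theta> 0)" unfolding t(3) by (simp flip: cis_mult)
      then have "\<gamma> t = \<gamma> 0" using uniq[of t 0] t by simp
      moreover have "t \<noteq> 0" "t \<noteq> 1" using t ge by auto
      ultimately show False
        using C2_positively_curved_boundaryD(5)[OF C2] t unfolding simple_path_def loop_free_def by force
    qed
    then have "n = 1" using n1 by simp
    then show ?thesis using n by simp
  qed
  have kper: "k (t + 1) = k t" for t
  proof -
    note cvv = C1_velocity(1)[OF C2_positively_curved_boundaryD(3)[OF C2]]
    have "velocity ?v (t + 1) = velocity ?v t"
      using has_vector_derivative_shift[where x = t and d = 1, OF cvv] cvv[of t] vector_derivative_unique_at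
      unfolding vper by blast
    then show ?thesis by (simp add: k_def vper)
  qed
  have \<theta>per: "\<theta> (t + 1) = \<theta> t + 2 * pi" for t
  proof -
    have "((\<lambda>t. \<theta> (t + 1) - \<theta> t) has_vector_derivative 0) (at t)" for t
    proof -
      have "((\<lambda>t. \<theta> (t + 1)) has_real_derivative k (t + 1)) (at t)"
        using \<theta>'[of "t + 1"] by (simp add: DERIV_shift)
      from DERIV_diff[OF this \<theta>'[of t]] show ?thesis
        unfolding has_real_derivative_iff_has_vector_derivative[symmetric] kper by simp
    qed
    from constant_if_vector_derivative_0[OF this, of t 0] show ?thesis using \<theta>1 by simp
  qed
  have \<theta>pern: "\<theta> (t + real n) = \<theta> t + 2 * pi * real n" for t n
    using shift_int_multiple[of \<theta> 1 "2 * pi" t "int n"] \<theta>per by (simp add: mult.commute)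
  have surj: "\<exists>t. \<theta> t = y" for y
  proof -
    obtain n :: nat where n: "real n > \<bar>y - \<theta> 0\<bar>" using reals_Archimedean2 by blast
    have "real n * 1 \<le> real n * (2 * pi)" using pi_gt3 by (intro mult_left_mono) auto
    then have n2: "2 * pi * real n \<ge> real n" by (simp add: mult.commute)
    have "\<theta> (0 + real n) \<ge> y" "\<theta> (- real n) \<le> y"
      using \<theta>pern[of 0 n] \<theta>pern[of "- real n" n] n n2 by auto
    then have "\<exists>t. - real n \<le> t \<and> t \<le> 0 + real n \<and> \<theta> t = y"
      by (intro IVT' \<theta>cont) auto
    then show ?thesis by blast
  qed
  define \<tau> where "\<tau> = inv \<theta>"
  have inj: "inj \<theta>" using mono strict_mono_imp_inj_on by blast
  have \<theta>\<tau>: "\<theta> (\<tau> y) = y" for y using surj unfolding \<tau>_def by (metis f_inv_into_f rangeI)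
  have \<tau>\<theta>: "\<tau> (\<theta> t) = t" for t unfolding \<tau>_def using inj by simp
  have \<tau>cont: "isCont \<tau> y" for y
    using isCont_inverse_function[of 1 "\<tau> y" \<tau> \<theta>] \<tau>\<theta> \<theta>\<tau> \<theta>cont[of UNIV]
    by (simp add: continuous_on_eq_continuous_at)
  have \<tau>': "(\<tau> has_real_derivative inverse (k (\<tau> y))) (at y)" for y
    by (rule DERIV_inverse_function[of \<theta> "k (\<tau> y)" \<tau> y "y - 1" "y + 1"])
      (use \<theta>' kpos[of "\<tau> y"] \<theta>\<tau> \<tau>cont in auto)
  define z where "z y = \<gamma> (\<tau> y)" for y
  define R where "R y = norm (?v (\<tau> y)) / k (\<tau> y)" for y
  have z': "(z has_vector_derivative R y *\<^sub>R (\<i> * cis y)) (at y)" for y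
  proof -
    have "(\<tau> has_vector_derivative inverse (k (\<tau> y))) (at y)"
      using \<tau>' unfolding has_real_derivative_iff_has_vector_derivative .
    from vector_diff_chain_at[OF this cv(1)]
    have "(z has_vector_derivative inverse (k (\<tau> y)) *\<^sub>R ?v (\<tau> y)) (at y)"
      by (simp add: o_def z_def[abs_def])
    also have "inverse (k (\<tau> y)) *\<^sub>R ?v (\<tau> y) = R y *\<^sub>R (\<i> * cis y)"
      by (subst speed) (simp add: R_def \<theta>\<tau> divide_inverse mult.commute)
    finally show ?thesis .
  qed
  have Rpos: "R y > 0" for y
    using kpos C2_positively_curved_boundaryD(4)[OF C2] by (simp add: R_def)
  have zper: "z (s + 2 * pi) = z s" for s
  proof -
    have "\<tau> (s + 2 * pi) = \<tau> s + 1" using \<theta>per[of "\<tau> s"] \<tau>\<theta> \<theta>\<tau> by metis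
    then show ?thesis by (simp add: z_def per)
  qed
  have zfr: "range z = frontier \<Omega>"
  proof -
    have "range z = range \<gamma>" unfolding z_def using \<tau>\<theta> by (metis image_image surj_def surjI)
    also have "range \<gamma> = frontier \<Omega>"
      by (rule range_boundary_curve[OF C2])
    finally show ?thesis .
  qed
  have zsup: "inner p (cis s) \<le> inner (z s) (cis s)" if "p \<in> closure \<Omega>" for p s
    using sup[OF that, of "\<tau> s"] by (simp add: z_def \<theta>\<tau>)
  have "closed_curve_length \<gamma> = integral {0..2 * pi} (\<lambda>s. inner (z s) (cis s))"
  proof -
    define h where "h s = inner (z s) (cis s)" for s
    have zc: "continuous_on UNIV z"
      by (intro continuous_at_imp_continuous_on ballI has_vector_derivative_continuous[OF z'])
    have hc: "continuous_on UNIV h" unfolding h_def by (intro continuous_intros zc)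
    obtain H where H: "\<And>x. (H has_vector_derivative h x) (at x)"
      using exists_antiderivative[OF hc] by blast
    \<comment> \<open>An antiderivative of the speed: the tangential component of \<gamma>
      differentiates to the speed minus k h(\<theta>), and H(\<theta>) supplies the missing term.
      The tangential component is periodic, so only H contributes to the perimeter.\<close>
    define A where "A t = inner (\<gamma> t) (\<i> * cis (\<theta> t)) + H (\<theta> t)" for t
    have "(A has_vector_derivative norm (?v t)) (at t)" for t
    proof -
      have c: "((\<lambda>t. \<i> * cis (\<theta> t)) has_vector_derivative - (k t *\<^sub>R cis (\<theta> t))) (at t)"
        using has_vector_derivative_mult_right[OF cis_has_vector_derivative[OF \<theta>'], of \<i> t] by simp
      have "((\<lambda>t. inner (\<gamma> t) (\<i> * cis (\<theta> t))) has_real_derivative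
          (inner (\<gamma> t) (- (k t *\<^sub>R cis (\<theta> t))) + inner (?v t) (\<i> * cis (\<theta> t)))) (at t)"
        by (rule inner_has_real_derivative[OF cv(1) c])
      moreover have "inner (?v t) (\<i> * cis (\<theta> t)) = norm (?v t)"
        by (subst speed) (simp add: dot_square_norm norm_mult)
      moreover have "((\<lambda>t. H (\<theta> t)) has_real_derivative k t * h (\<theta> t)) (at t)"
        using DERIV_chain2[of H "h (\<theta> t)" \<theta> t "k t"] H \<theta>'
        by (simp add: has_real_derivative_iff_has_vector_derivative mult.commute)
      ultimately have "(A has_real_derivative
          (inner (\<gamma> t) (- (k t *\<^sub>R cis (\<theta> t))) + norm (?v t) + k t * h (\<theta> t))) (at t)"
        unfolding A_def[abs_def] by (simp add: DERIV_add)
      moreover have "h (\<theta> t) = inner (\<gamma> t) (cis (\<theta> t))" by (simp add: h_def z_def \<tau>\<theta>)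
      ultimately show ?thesis by (simp add: has_real_derivative_iff_has_vector_derivative)
    qed
    then have "((\<lambda>t. norm (?v t)) has_integral A 1 - A 0) {0..1}"
      by (intro fundamental_theorem_of_calculus) (auto intro: has_vector_derivative_at_within)
    then have "closed_curve_length \<gamma> = A 1 - A 0"
      unfolding closed_curve_length_def by (rule integral_unique)
    also have "\<dots> = H (\<theta> 0 + 2 * pi) - H (\<theta> 0)"
      using per[of 0] \<theta>1 by (simp add: A_def flip: cis_mult)
    also have "\<dots> = integral {0..2 * pi} (\<lambda>x. h (x + \<theta> 0))"
    proof -
      have "((\<lambda>x. h (x + \<theta> 0)) has_integral H (2 * pi + \<theta> 0) - H (0 + \<theta> 0)) {0..2 * pi}"
        by (intro fundamental_theorem_of_calculus) (auto intro: has_vector_derivative_at_within has_vector_derivative_shift[OF H])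
      then show ?thesis by (simp add: integral_unique add.commute)
    qed
    also have "\<dots> = integral {0..2 * pi} h"
      by (rule periodic_integral_shift[OF hc]) (simp add: h_def zper flip: cis_mult)
    finally show ?thesis by (simp add: h_def[abs_def])
  qed
  then show ?thesis using that z' Rpos zper zfr zsup by blast
qed

section \<open>The generating function and periodic minimizers\<close>

text \<open>z s is the boundary point with outer normal \<open>cis s\<close>, and R is the radius of
  curvature. The axioms mention no boundary curve, so the unit disk with \<open>z = cis\<close> is
  an instance alongside the table.\<close>

locale support_param =
  fixes \<Omega> :: "complex set" and z :: "real \<Rightarrow> complex" and R :: "real \<Rightarrow> real" and B :: real
  assumes z_deriv: "\<And>s. (z has_vector_derivative R s *\<^sub>R (\<i> * cis s)) (at s)"
    and R_nonneg: "\<And>s. 0 \<le> R s"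
    and z_periodic: "\<And>s. z (s + 2 * pi) = z s"
    and z_bound: "\<And>s. norm (z s) \<le> B"
    and support_eq: "\<And>s. support_function \<Omega> s = inner (z s) (cis s)"
begin

abbreviation S where "S \<equiv> billiard_gen \<Omega>"

section \<open>The generating function: derivatives and submodularity\<close>

lemma z_continuous: "continuous_on A z"
  by (intro continuous_at_imp_continuous_on ballI has_vector_derivative_continuous[OF z_deriv])

lemma S_eq: "S x y = - 2 * inner (z ((x + y) / 2)) (cis ((x + y) / 2)) * sin ((y - x) / 2)"
  unfolding billiard_gen_def support_eq ..

lemma support_has_derivative:
  "((\<lambda>s. inner (z s) (cis s)) has_real_derivative inner (z s) (\<i> * cis s)) (at s)"
proof -
  have "((\<lambda>s. inner (z s) (cis s)) has_real_derivative
      (inner (z s) (1 *\<^sub>R (\<i> * cis s)) + inner (R s *\<^sub>R (\<i> * cis s)) (cis s))) (at s)"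
    by (intro inner_has_real_derivative z_deriv cis_has_vector_derivative DERIV_ident)
  then show ?thesis by (simp add: inner_icis_cis)
qed

lemma S_has_derivative:
  assumes f: "(f has_real_derivative f') (at t within A)" and g: "(g has_real_derivative g') (at t within A)"
  shows "((\<lambda>t. S (f t) (g t)) has_real_derivative
    inner (z ((f t + g t) / 2)) (cis (f t)) * f' - inner (z ((f t + g t) / 2)) (cis (g t)) * g') (at t within A)"
proof -
  define m where "m = (f t + g t) / 2"
  define d where "d = (g t - f t) / 2"
  define h where "h s = inner (z s) (cis s)" for s
  have "((\<lambda>t. (f t + g t) / 2) has_real_derivative (f' + g') / 2) (at t within A)"
    using f g by (auto intro!: derivative_eq_intros)
  from DERIV_chain2[OF support_has_derivative[of "(f t + g t) / 2"] this]
  have 1: "((\<lambda>t. h ((f t + g t) / 2)) has_real_derivative inner (z m) (\<i> * cis m) * ((f' + g') / 2)) (at t within A)"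
    by (simp add: h_def m_def)
  have 2: "((\<lambda>t. sin ((g t - f t) / 2)) has_real_derivative cos d * ((g' - f') / 2)) (at t within A)"
    unfolding d_def using f g by (auto intro!: derivative_eq_intros)
  have "((\<lambda>t. - 2 * (h ((f t + g t) / 2) * sin ((g t - f t) / 2))) has_real_derivative
    - 2 * (inner (z m) (\<i> * cis m) * ((f' + g') / 2) * sin d + cos d * ((g' - f') / 2) * h m)) (at t within A)"
    using DERIV_cmult[OF DERIV_mult[OF 1 2], of "-2"] by (simp add: m_def d_def)
  moreover have "(\<lambda>t. - 2 * (h ((f t + g t) / 2) * sin ((g t - f t) / 2))) = (\<lambda>t. S (f t) (g t))"
    by (simp add: S_eq h_def mult.assoc)
  moreover have "- 2 * (inner (z m) (\<i> * cis m) * ((f' + g') / 2) * sin d + cos d * ((g' - f') / 2) * h m)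
      = inner (z m) (cis (f t)) * f' - inner (z m) (cis (g t)) * g'"
  proof -
    \<comment> \<open>The frame at the midpoint angle m turned by -d and by d. The coordinates of z
      in the frame at m are h and h', so the product rule collapses to inner products with these two
      vectors.\<close>
    have e1: "cis (f t) = cos d *\<^sub>R cis m - sin d *\<^sub>R (\<i> * cis m)"
      and e2: "cis (g t) = cos d *\<^sub>R cis m + sin d *\<^sub>R (\<i> * cis m)"
    proof -
      have "f t = m - d" "g t = m + d" by (simp_all add: m_def d_def field_simps)
      then show "cis (f t) = cos d *\<^sub>R cis m - sin d *\<^sub>R (\<i> * cis m)"
        "cis (g t) = cos d *\<^sub>R cis m + sin d *\<^sub>R (\<i> * cis m)"
        by (simp_all add: complex_eq_iff cos_diff sin_diff cos_add sin_add mult.commute)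
    qed
    show ?thesis
      unfolding e1 e2 h_def inner_diff_right inner_add_right inner_scaleR_right
      by (simp add: field_simps)
  qed
  ultimately show ?thesis by (simp add: m_def)
qed

lemma S_continuous:
  fixes f g :: "'b::topological_space \<Rightarrow> real"
  assumes "continuous_on A f" "continuous_on A g"
  shows "continuous_on A (\<lambda>t. S (f t) (g t))"
proof -
  have "continuous_on A (\<lambda>t. z ((f t + g t) / 2))"
    by (rule continuous_on_compose2[OF z_continuous[of UNIV]]) (use assms in \<open>auto intro!: continuous_intros\<close>)
  moreover have "continuous_on A (\<lambda>t. sin ((g t - f t) / 2))"
    by (rule continuous_on_compose2[of UNIV sin]) (use assms in \<open>auto intro!: continuous_intros\<close>)
  ultimately show ?thesis unfolding S_eq using assms by (auto intro!: continuous_intros)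
qed

lemma S_bound: "\<bar>S x y\<bar> \<le> 2 * B"
proof -
  have "\<bar>inner (z ((x + y) / 2)) (cis ((x + y) / 2))\<bar> \<le> norm (z ((x + y) / 2)) * norm (cis ((x + y) / 2))"
    by (rule Cauchy_Schwarz_ineq2)
  also have "\<dots> \<le> B" using z_bound by simp
  finally have 1: "\<bar>inner (z ((x + y) / 2)) (cis ((x + y) / 2))\<bar> \<le> B" .
  have "\<bar>S x y\<bar> = 2 * (\<bar>inner (z ((x + y) / 2)) (cis ((x + y) / 2))\<bar> * \<bar>sin ((y - x) / 2)\<bar>)"
    by (simp add: S_eq abs_mult)
  also have "\<dots> \<le> 2 * (B * 1)"
    using 1 z_bound[of 0] by (intro mult_left_mono mult_mono abs_sin_le_one) (auto intro: order_trans[OF norm_ge_zero])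
  finally show ?thesis by simp
qed

lemma B_nonneg: "B \<ge> 0"
  using z_bound[of 0] norm_ge_zero order_trans by blast

lemma S_shift: "S (x + 2 * pi * of_int k) (y + 2 * pi * of_int k) = S x y"
proof -
  have m: "(x + 2 * pi * of_int k + (y + 2 * pi * of_int k)) / 2 = (x + y) / 2 + 2 * pi * of_int k"
    by (simp add: field_simps)
  have d: "(y + 2 * pi * of_int k - (x + 2 * pi * of_int k)) / 2 = (y - x) / 2" by simp
  have c: "cis (a + 2 * pi * of_int k) = cis a" for a
    by (simp add: cis_multiple_2pi flip: cis_mult)
  show ?thesis unfolding billiard_gen_def m d support_function_def c ..
qed

text \<open>An integrated twist condition: z'(x) = R i cis x has component R sin(t - x) along
  \<open>cis t\<close>, which is nonpositive during the half turn after t.\<close>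

lemma boundary_recedes:
  assumes "t \<le> s" "s \<le> s'" "s' \<le> t + pi"
  shows "inner (z s') (cis t) \<le> inner (z s) (cis t)"
proof (rule DERIV_nonpos_imp_nonincreasing[OF assms(2)])
  fix x assume x: "s \<le> x" "x \<le> s'"
  have "((\<lambda>x. inner (z x) (cis t)) has_real_derivative R x * sin (t - x)) (at x)"
    using inner_has_real_derivative[OF z_deriv has_vector_derivative_const[of "cis t"], of x]
    by (simp add: inner_icis_cis)
  moreover have "R x * sin (t - x) \<le> 0"
  proof -
    have "sin (x - t) \<ge> 0" using x assms by (intro sin_ge_zero) auto
    then have "sin (t - x) \<le> 0" using sin_minus[of "x - t"] by simp
    then show ?thesis using R_nonneg by (intro mult_nonneg_nonpos)
  qed
  ultimately show "\<exists>y. ((\<lambda>x. inner (z x) (cis t)) has_real_derivative y) (at x) \<and> y \<le> 0" by blast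
qed

text \<open>S(t, y) - S(t, y') is nonincreasing in t: its derivative compares z at the angles (t +
  y)/2 and (t + y')/2 in direction \<open>cis t\<close>, and the bound y - x <= 2 pi keeps both in
  the half turn after t.\<close>

lemma S_submodular:
  assumes "x \<le> x'" "y' \<le> y" "x' \<le> y'" "y - x \<le> 2 * pi"
  shows "S x y' + S x' y \<le> S x y + S x' y'"
proof -
  have "S x' y - S x' y' \<le> S x y - S x y'"
  proof (rule DERIV_nonpos_imp_nonincreasing[OF assms(1)])
    fix t assume t: "x \<le> t" "t \<le> x'"
    have "((\<lambda>t. S t y) has_real_derivative inner (z ((t + y) / 2)) (cis t)) (at t)" for y
      using S_has_derivative[OF DERIV_ident DERIV_const[of y], of t UNIV] by simp
    then have "((\<lambda>t. S t y - S t y') has_real_derivative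
        inner (z ((t + y) / 2)) (cis t) - inner (z ((t + y') / 2)) (cis t)) (at t)"
      by (intro DERIV_diff)
    moreover have "inner (z ((t + y) / 2)) (cis t) \<le> inner (z ((t + y') / 2)) (cis t)"
      using t assms by (intro boundary_recedes) auto
    ultimately show "\<exists>y'a. ((\<lambda>t. S t y - S t y') has_real_derivative y'a) (at t) \<and> y'a \<le> 0"
      by (intro exI conjI) auto
  qed
  then show ?thesis by simp
qed

text \<open>Pairs in the same order give equality; only crossing pairs use submodularity.\<close>

lemma S_min_max:
  assumes "0 \<le> a1 - a0" "a1 - a0 \<le> 2 * pi" "0 \<le> b1 - b0" "b1 - b0 \<le> 2 * pi"
  shows "S (min a0 b0) (min a1 b1) + S (max a0 b0) (max a1 b1) \<le> S a0 a1 + S b0 b1"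
proof -
  consider "a0 \<le> b0 \<and> a1 \<le> b1 \<or> b0 \<le> a0 \<and> b1 \<le> a1" | "a0 \<le> b0" "b1 \<le> a1" | "b0 \<le> a0" "a1 \<le> b1"
    by linarith
  then show ?thesis
  proof cases
    case 1
    then show ?thesis by (auto simp: min_def max_def)
  next
    case 2
    then show ?thesis using S_submodular[of a0 b0 b1 a1] assms by (auto simp: min_def max_def)
  next
    case 3
    then show ?thesis using S_submodular[of b0 a0 a1 b1] assms by (auto simp: min_def max_def)
  qed
qed

section \<open>Actions of segments and periodic configurations\<close>

abbreviation act where "act \<equiv> action \<Omega>"

lemma act_split: "m \<le> k \<Longrightarrow> k \<le> n \<Longrightarrow> act m n \<phi> = act m k \<phi> + act k n \<phi>"
  unfolding action_def
  by (subst ivl_disj_un_two(3)[symmetric, of m k n]) (auto intro!: sum.union_disjoint)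

lemma act_Suc: "act m (m + 1) \<phi> = S (\<phi> m) (\<phi> (m + 1))"
proof -
  have "{m..<m + 1} = {m}" by auto
  then show ?thesis by (simp add: action_def)
qed

lemma act_cong: "(\<And>i. m \<le> i \<Longrightarrow> i \<le> n \<Longrightarrow> \<phi> i = \<psi> i) \<Longrightarrow> act m n \<phi> = act m n \<psi>"
  unfolding action_def by (intro sum.cong) auto

lemma act_shift: "act m n (\<lambda>i. \<phi> (i + k) + 2 * pi * of_int l) = act (m + k) (n + k) \<phi>"
proof -
  have "act m n (\<lambda>i. \<phi> (i + k) + 2 * pi * of_int l) = (\<Sum>i\<in>{m..<n}. S (\<phi> (i + k)) (\<phi> (i + k + 1)))"
    unfolding action_def S_shift by (simp add: add_ac)
  also have "\<dots> = act (m + k) (n + k) \<phi>"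
    unfolding action_def
    by (rule sum.reindex_bij_witness[of _ "\<lambda>i. i - k" "\<lambda>i. i + k"]) auto
  finally show ?thesis .
qed

lemma act_bound: "m \<le> n \<Longrightarrow> \<bar>act m n \<phi>\<bar> \<le> 2 * B * of_int (n - m)"
proof -
  assume "m \<le> n"
  have "\<bar>act m n \<phi>\<bar> \<le> (\<Sum>i\<in>{m..<n}. \<bar>S (\<phi> i) (\<phi> (i + 1))\<bar>)"
    unfolding action_def by (rule sum_abs)
  also have "\<dots> \<le> (\<Sum>i\<in>{m..<n}. 2 * B)" by (intro sum_mono S_bound)
  also have "\<dots> = 2 * B * of_int (n - m)" using \<open>m \<le> n\<close> by simp
  finally show ?thesis .
qed

lemma admissible_on_shift:
  "admissible_on UNIV \<phi> \<Longrightarrow> admissible_on UNIV (\<lambda>i. \<phi> (i + k) + c)"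
  unfolding admissible_on_def
proof
  assume adm: "\<forall>i\<in>UNIV. 0 \<le> \<phi> (i + 1) - \<phi> i \<and> \<phi> (i + 1) - \<phi> i \<le> 2 * pi"
  fix i
  have e: "i + 1 + k = i + k + 1" by simp
  show "0 \<le> \<phi> (i + 1 + k) + c - (\<phi> (i + k) + c) \<and> \<phi> (i + 1 + k) + c - (\<phi> (i + k) + c) \<le> 2 * pi"
    unfolding e using bspec[OF adm UNIV_I, of "i + k"] by simp
qed

definition periodic_configs :: "int \<Rightarrow> int \<Rightarrow> (int \<Rightarrow> real) set" where
  "periodic_configs p n = {\<phi>. admissible_on UNIV \<phi> \<and> (\<forall>i. \<phi> (i + n) = \<phi> i + 2 * pi * of_int p)}"

definition periodic_minimizers :: "int \<Rightarrow> int \<Rightarrow> (int \<Rightarrow> real) set" where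
  "periodic_minimizers p n = {\<phi> \<in> periodic_configs p n. \<forall>\<psi>\<in>periodic_configs p n. act 0 n \<phi> \<le> act 0 n \<psi>}"

lemma periodic_configs_shift:
  "\<phi> \<in> periodic_configs p n \<Longrightarrow> (\<lambda>i. \<phi> (i + k) + c) \<in> periodic_configs p n"
proof -
  assume \<phi>: "\<phi> \<in> periodic_configs p n"
  then have per: "\<And>i. \<phi> (i + n) = \<phi> i + 2 * pi * of_int p" by (simp add: periodic_configs_def)
  have "\<phi> (i + n + k) + c = \<phi> (i + k) + c + 2 * pi * of_int p" for i
    using per[of "i + k"] by (simp add: add_ac)
  then show ?thesis using \<phi> admissible_on_shift unfolding periodic_configs_def by blast
qed

lemma periodic_configs_multiple:
  assumes \<phi>: "\<phi> \<in> periodic_configs p n"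
  shows "\<phi> (i + n * k) = \<phi> i + 2 * pi * of_int (p * k)"
  using shift_int_multiple[of \<phi> n "2 * pi * of_int p" i k] \<phi> by (simp add: periodic_configs_def mult_ac)

text \<open>Moving the block by one step drops a term and adds its translate by 2 pi p, which has
  the same value.\<close>

lemma periodic_act:
  assumes \<phi>: "\<phi> \<in> periodic_configs p n" and n: "n > 0"
  shows "act m (m + n) \<phi> = act 0 n \<phi>"
proof -
  have per: "\<phi> (i + n) = \<phi> i + 2 * pi * of_int p" for i using \<phi> by (simp add: periodic_configs_def)
  have step: "act (m + 1) (m + 1 + n) \<phi> = act m (m + n) \<phi>" for m
  proof -
    have "act m (m + n + 1) \<phi> = act m (m + 1) \<phi> + act (m + 1) (m + n + 1) \<phi>"
      using n by (intro act_split) auto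
    moreover have "act m (m + n + 1) \<phi> = act m (m + n) \<phi> + act (m + n) (m + n + 1) \<phi>"
      using n by (intro act_split) auto
    moreover have "act (m + n) (m + n + 1) \<phi> = act m (m + 1) \<phi>"
    proof -
      have "\<phi> (m + n + 1) = \<phi> (m + 1) + 2 * pi * of_int p" using per[of "m + 1"] by (simp add: add_ac)
      then show ?thesis unfolding act_Suc using per[of m] S_shift by simp
    qed
    moreover have e: "m + 1 + n = m + n + 1" by simp
    ultimately show ?thesis unfolding e by simp
  qed
  show ?thesis
  proof (induction m rule: int_induct[where k = 0])
    case base
    show ?case by simp
  next
    case (step1 i)
    then show ?case using step[of i] by simp
  next
    case (step2 i)
    then show ?case using step[of "i - 1"] by simp
  qed
qed

lemma periodic_minimizers_shift:
  assumes \<phi>: "\<phi> \<in> periodic_minimizers p n" and n: "n > 0"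
  shows "(\<lambda>i. \<phi> (i + k) + 2 * pi * of_int l) \<in> periodic_minimizers p n"
proof -
  have \<phi>': "\<phi> \<in> periodic_configs p n" "\<And>\<psi>. \<psi> \<in> periodic_configs p n \<Longrightarrow> act 0 n \<phi> \<le> act 0 n \<psi>"
    using \<phi> by (auto simp: periodic_minimizers_def)
  have "act 0 n (\<lambda>i. \<phi> (i + k) + 2 * pi * of_int l) = act (0 + k) (n + k) \<phi>" by (rule act_shift)
  also have "\<dots> = act 0 n \<phi>" using periodic_act[OF \<phi>'(1) n, of k] by (simp add: add.commute)
  finally show ?thesis using \<phi>' periodic_configs_shift[OF \<phi>'(1)] by (simp add: periodic_minimizers_def)
qed

text \<open>The pointwise maximum is a competitor too, so its action is at least the least value;
  \<open>S_min_max\<close> then leaves no more than the least value for the minimum.\<close>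

lemma periodic_minimizers_min:
  assumes \<phi>: "\<phi> \<in> periodic_minimizers p n" and \<psi>: "\<psi> \<in> periodic_minimizers p n"
  shows "(\<lambda>i. min (\<phi> i) (\<psi> i)) \<in> periodic_minimizers p n"
proof -
  have c: "\<phi> \<in> periodic_configs p n" "\<psi> \<in> periodic_configs p n"
    and le: "\<And>\<xi>. \<xi> \<in> periodic_configs p n \<Longrightarrow> act 0 n \<phi> \<le> act 0 n \<xi>"
    "\<And>\<xi>. \<xi> \<in> periodic_configs p n \<Longrightarrow> act 0 n \<psi> \<le> act 0 n \<xi>"
    using \<phi> \<psi> by (auto simp: periodic_minimizers_def)
  have a: "0 \<le> \<phi> (i + 1) - \<phi> i" "\<phi> (i + 1) - \<phi> i \<le> 2 * pi" "0 \<le> \<psi> (i + 1) - \<psi> i" "\<psi> (i + 1) - \<psi> i \<le> 2 * pi" for i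
    using c by (auto simp: periodic_configs_def admissible_on_def)
  have per: "\<phi> (i + n) = \<phi> i + 2 * pi * of_int p" "\<psi> (i + n) = \<psi> i + 2 * pi * of_int p" for i
    using c by (auto simp: periodic_configs_def)
  have mn: "(\<lambda>i. min (\<phi> i) (\<psi> i)) \<in> periodic_configs p n"
    unfolding periodic_configs_def admissible_on_def
  proof (intro CollectI conjI ballI allI)
    fix i
    show "0 \<le> min (\<phi> (i + 1)) (\<psi> (i + 1)) - min (\<phi> i) (\<psi> i)"
      "min (\<phi> (i + 1)) (\<psi> (i + 1)) - min (\<phi> i) (\<psi> i) \<le> 2 * pi"
      using a[of i] by linarith+
    show "min (\<phi> (i + n)) (\<psi> (i + n)) = min (\<phi> i) (\<psi> i) + 2 * pi * of_int p"
      using per[of i] by linarith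
  qed
  have mx: "(\<lambda>i. max (\<phi> i) (\<psi> i)) \<in> periodic_configs p n"
    unfolding periodic_configs_def admissible_on_def
  proof (intro CollectI conjI ballI allI)
    fix i
    show "0 \<le> max (\<phi> (i + 1)) (\<psi> (i + 1)) - max (\<phi> i) (\<psi> i)"
      "max (\<phi> (i + 1)) (\<psi> (i + 1)) - max (\<phi> i) (\<psi> i) \<le> 2 * pi"
      using a[of i] by linarith+
    show "max (\<phi> (i + n)) (\<psi> (i + n)) = max (\<phi> i) (\<psi> i) + 2 * pi * of_int p"
      using per[of i] by linarith
  qed
  have "act 0 n (\<lambda>i. min (\<phi> i) (\<psi> i)) + act 0 n (\<lambda>i. max (\<phi> i) (\<psi> i)) \<le> act 0 n \<phi> + act 0 n \<psi>"
    unfolding action_def sum.distrib[symmetric] using a by (intro sum_mono S_min_max)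
  then have "act 0 n (\<lambda>i. min (\<phi> i) (\<psi> i)) \<le> act 0 n \<phi>" using le(2)[OF mx] by linarith
  then show ?thesis using mn le(1) unfolding periodic_minimizers_def by (auto intro: order_trans)
qed

lemma periodic_minimizers_Min:
  assumes "finite A" "A \<noteq> {}" "\<And>j. j \<in> A \<Longrightarrow> F j \<in> periodic_minimizers p n"
  shows "(\<lambda>i. Min ((\<lambda>j. F j i) ` A)) \<in> periodic_minimizers p n"
  using assms
proof (induction A rule: finite_ne_induct)
  case (singleton x)
  then show ?case by simp
next
  case (insert x A)
  have "(\<lambda>i. min (F x i) (Min ((\<lambda>j. F j i) ` A))) \<in> periodic_minimizers p n"
    using insert by (intro periodic_minimizers_min) auto
  moreover have "(\<lambda>i. min (F x i) (Min ((\<lambda>j. F j i) ` A))) = (\<lambda>i. Min ((\<lambda>j. F j i) ` insert x A))"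
    using insert(1,2) by simp
  ultimately show ?case by simp
qed

section \<open>Existence of periodic minimizers by compactness\<close>

lemma compact_box:
  fixes a b :: "int \<Rightarrow> real"
  shows "compact {\<phi>. \<forall>i. a i \<le> \<phi> i \<and> \<phi> i \<le> b i}"
proof -
  have "compactin (product_topology (\<lambda>i. euclidean) UNIV) (PiE UNIV (\<lambda>i. {a i..b i}))"
    unfolding compactin_PiE by simp
  moreover have "PiE UNIV (\<lambda>i. {a i..b i}) = {\<phi>. \<forall>i. a i \<le> \<phi> i \<and> \<phi> i \<le> b i}" by auto
  ultimately show ?thesis by (simp add: euclidean_product_topology)
qed

lemma admissible_on_growth:
  assumes "admissible_on {m..<n} \<phi>" "m \<le> i" "i \<le> j" "j \<le> n"
  shows "\<phi> i \<le> \<phi> j" "\<phi> j \<le> \<phi> i + 2 * pi * of_int (j - i)"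
proof -
  have "\<phi> i \<le> \<phi> j \<and> \<phi> j \<le> \<phi> i + 2 * pi * of_int (j - i)" using assms(3,4)
  proof (induction j rule: int_ge_induct)
    case base
    then show ?case by simp
  next
    case (step j)
    then have "0 \<le> \<phi> (j + 1) - \<phi> j" "\<phi> (j + 1) - \<phi> j \<le> 2 * pi"
      using assms(1,2) by (auto simp: admissible_on_def)
    with step show ?case by (simp add: algebra_simps)
  qed
  then show "\<phi> i \<le> \<phi> j" "\<phi> j \<le> \<phi> i + 2 * pi * of_int (j - i)" by auto
qed

lemma admissible_on_subset: "admissible_on I \<phi> \<Longrightarrow> J \<subseteq> I \<Longrightarrow> admissible_on J \<phi>"
  unfolding admissible_on_def by blast

lemma admissible_on_box:
  assumes "admissible_on UNIV \<phi>" "0 \<le> \<phi> 0" "\<phi> 0 \<le> 2 * pi"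
  shows "- 2 * pi * \<bar>of_int i\<bar> \<le> \<phi> i \<and> \<phi> i \<le> 2 * pi + 2 * pi * \<bar>of_int i\<bar>"
proof -
  have adm: "admissible_on {k..<l} \<phi>" for k l using assms(1) admissible_on_subset by blast
  show ?thesis
  proof (cases "i \<ge> 0")
    case True
    then show ?thesis using admissible_on_growth[OF adm, of 0 0 i i] assms pi_gt_zero by auto
  next
    case False
    then show ?thesis using admissible_on_growth[OF adm, of i i 0 0] assms pi_gt_zero by auto
  qed
qed

text \<open>Translations by multiples of 2 pi destroy compactness. Normalising the value at 0 into
  one period confines the configurations to a product of intervals, compact by Tychonoff; the
  configuration of constant step 2 pi p/n shows that some exist.\<close>

lemma periodic_minimizers_nonempty:
  assumes p: "0 \<le> p" "p \<le> n" and n: "n > 0"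
  shows "periodic_minimizers p n \<noteq> {}"
proof -
  define K where "K = {\<phi>. \<forall>i. - 2 * pi * \<bar>of_int i\<bar> \<le> \<phi> i \<and> \<phi> i \<le> 2 * pi + 2 * pi * \<bar>of_int i\<bar>} \<inter>
     {\<phi>. \<forall>i. 0 \<le> \<phi> (i + 1) - \<phi> i \<and> \<phi> (i + 1) - \<phi> i \<le> 2 * pi \<and> \<phi> (i + n) = \<phi> i + 2 * pi * of_int p}"
  note coord = continuous_on_product_coordinates
  have "closed {\<phi> :: int \<Rightarrow> real. \<forall>i. 0 \<le> \<phi> (i + 1) - \<phi> i \<and> \<phi> (i + 1) - \<phi> i \<le> 2 * pi \<and> \<phi> (i + n) = \<phi> i + 2 * pi * of_int p}"
    by (intro closed_Collect_all closed_Collect_conj closed_Collect_le closed_Collect_eq continuous_intros coord)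
  then have "compact K" unfolding K_def by (intro compact_Int_closed compact_box)
  have KX: "K \<subseteq> periodic_configs p n" by (auto simp: K_def periodic_configs_def admissible_on_def)
  have XK: "\<phi> \<in> K" if "\<phi> \<in> periodic_configs p n" "0 \<le> \<phi> 0" "\<phi> 0 \<le> 2 * pi" for \<phi>
    using that admissible_on_box[of \<phi>] by (auto simp: K_def periodic_configs_def admissible_on_def)
  have lin: "(\<lambda>i. 2 * pi * of_int p / of_int n * of_int i) \<in> periodic_configs p n"
  proof -
    have "0 \<le> 2 * pi * real_of_int p / of_int n" "2 * pi * real_of_int p / of_int n \<le> 2 * pi"
      using p n by (auto simp: divide_le_eq)
    then show ?thesis using n
      by (auto simp: periodic_configs_def admissible_on_def field_simps)
  qed
  have "(\<lambda>i. 2 * pi * of_int p / of_int n * of_int i) \<in> K" by (rule XK[OF lin]) auto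
  then have "K \<noteq> {}" by blast
  have cont: "continuous_on K (act 0 n)"
    unfolding action_def
    by (intro continuous_intros S_continuous continuous_on_subset[OF coord]) auto
  obtain \<phi> where \<phi>: "\<phi> \<in> K" "\<And>\<psi>. \<psi> \<in> K \<Longrightarrow> act 0 n \<phi> \<le> act 0 n \<psi>"
    using continuous_attains_inf[OF \<open>compact K\<close> \<open>K \<noteq> {}\<close> cont] by blast
  have "act 0 n \<phi> \<le> act 0 n \<psi>" if \<psi>: "\<psi> \<in> periodic_configs p n" for \<psi>
  proof -
    define l where "l = - \<lfloor>\<psi> 0 / (2 * pi)\<rfloor>"
    define \<psi>' where "\<psi>' = (\<lambda>i. \<psi> (i + 0) + 2 * pi * of_int l)"
    have "\<psi>' \<in> periodic_configs p n" unfolding \<psi>'_def by (rule periodic_configs_shift[OF \<psi>])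
    moreover have "0 \<le> \<psi>' 0" "\<psi>' 0 \<le> 2 * pi"
      using floor_two_pi[of "\<psi> 0"] by (simp_all add: \<psi>'_def l_def)
    ultimately have "act 0 n \<phi> \<le> act 0 n \<psi>'" by (intro \<phi>(2) XK)
    also have "\<dots> = act 0 n \<psi>" unfolding \<psi>'_def by (subst act_shift) simp
    finally show ?thesis .
  qed
  then show ?thesis using \<phi>(1) KX unfolding periodic_minimizers_def by blast
qed

text \<open>The pointwise minimum of the translates of a minimizer that move it upwards is again a
  minimizer, and it is ordered with respect to all its own translates.\<close>

lemma ordered_periodic_minimizer:
  assumes p: "0 \<le> p" "p \<le> n" and n: "n > 0"
  obtains \<xi> where "\<xi> \<in> periodic_minimizers p n"
    "\<And>i k l. l * n \<le> k * p \<Longrightarrow> \<xi> i + 2 * pi * of_int l \<le> \<xi> (i + k)"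
proof -
  obtain \<phi> where \<phi>: "\<phi> \<in> periodic_minimizers p n" using periodic_minimizers_nonempty[OF assms] by blast
  then have X: "\<phi> \<in> periodic_configs p n" by (simp add: periodic_minimizers_def)
  \<comment> \<open>Translation by j indices and by -2 pi l counts as upward when l n <= j p. For
    given j the lowest such translate has l = floor(j p/n), and by periodicity the j below n
    suffice.\<close>
  define F where "F j = (\<lambda>i. \<phi> (i + j) + 2 * pi * of_int (- (j * p div n)))" for j
  define \<xi> where "\<xi> = (\<lambda>i. Min ((\<lambda>j. F j i) ` {0..<n}))"
  have "\<xi> \<in> periodic_minimizers p n" unfolding \<xi>_def
  proof (rule periodic_minimizers_Min)
    show "F j \<in> periodic_minimizers p n" for j
      unfolding F_def by (rule periodic_minimizers_shift[OF \<phi> n])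
  qed (use n in auto)
  moreover have "\<xi> i + 2 * pi * of_int l \<le> \<xi> (i + k)" if lk: "l * n \<le> k * p" for i k l
  proof -
    have "\<xi> (i + k) \<in> (\<lambda>j. F j (i + k)) ` {0..<n}" unfolding \<xi>_def using n by (intro Min_in) auto
    then obtain j where j: "j \<in> {0..<n}" "\<xi> (i + k) = F j (i + k)" by blast
    define c where "c = (k + j) div n"
    define r where "r = (k + j) mod n"
    have kj: "k + j = r + n * c" by (simp add: c_def r_def)
    have r: "r \<in> {0..<n}" using n by (simp add: r_def)
    have "\<xi> i \<le> F r i" unfolding \<xi>_def using r by (intro Min_le) auto
    moreover have "\<phi> (i + k + j) = \<phi> (i + r) + 2 * pi * of_int (p * c)"
      using periodic_configs_multiple[OF X, of "i + r" c] kj by (simp add: algebra_simps)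
    \<comment> \<open>The composite of two upward translations is upward: l + floor(j p/n) <=
      floor((k + j) p/n).\<close>
    moreover have "l + j * p div n \<le> r * p div n + p * c"
    proof -
      have "l + j * p div n = (j * p + l * n) div n" using n by simp
      also have "\<dots> \<le> (j * p + k * p) div n" using lk n by (intro zdiv_mono1) auto
      also have "j * p + k * p = (k + j) * p" by (simp add: algebra_simps)
      also have "\<dots> = r * p + p * c * n" unfolding kj by (simp add: algebra_simps)
      also have "\<dots> div n = r * p div n + p * c" using n by simp
      finally show ?thesis .
    qed
    then have "real_of_int (l + j * p div n) \<le> of_int (r * p div n + p * c)" by (simp only: of_int_le_iff)
    then have "2 * pi * real_of_int (l + j * p div n) \<le> 2 * pi * of_int (r * p div n + p * c)"
      by (intro mult_left_mono) auto
    ultimately show ?thesis using j(2) by (simp add: F_def algebra_simps)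
  qed
  ultimately show ?thesis using that by blast
qed

lemma periodic_extension:
  assumes g: "admissible_on {m..<m + n} g" "g (m + n) = g m + 2 * pi * of_int p" and n: "n > 0"
  obtains \<psi> where "\<psi> \<in> periodic_configs p n" "\<And>i. m \<le> i \<Longrightarrow> i \<le> m + n \<Longrightarrow> \<psi> i = g i"
proof -
  define \<psi> where "\<psi> i = g (m + (i - m) mod n) + 2 * pi * of_int (p * ((i - m) div n))" for i
  have nxt: "\<psi> (i + 1) = g (m + (i - m) mod n + 1) + 2 * pi * of_int (p * ((i - m) div n))" for i
  proof -
    define c where "c = (i - m) div n"
    define r where "r = (i - m) mod n"
    have e: "i + 1 - m = (r + 1) + n * c" by (simp add: c_def r_def)
    have r: "0 \<le> r" "r < n" using n by (auto simp: r_def)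
    show ?thesis
    proof (cases "r + 1 = n")
      case True
      then have "i + 1 - m = 0 + n * (c + 1)" using e by (simp add: algebra_simps)
      then have "(i + 1 - m) mod n = 0" "(i + 1 - m) div n = c + 1" using n by simp_all
      moreover have e: "m + (i - m) mod n + 1 = m + n" using True by (simp add: r_def)
      ultimately show ?thesis unfolding \<psi>_def e using g(2)
        by (simp add: c_def[symmetric] algebra_simps)
    next
      case False
      then have "(i + 1 - m) mod n = r + 1" "(i + 1 - m) div n = c"
        unfolding e using r n by (simp_all add: div_pos_pos_trivial)
      then show ?thesis unfolding \<psi>_def by (simp add: c_def[symmetric] r_def[symmetric] algebra_simps)
    qed
  qed
  have "admissible_on UNIV \<psi>"
    unfolding admissible_on_def
  proof
    fix i
    have "m + (i - m) mod n \<in> {m..<m + n}" using n by simp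
    then have "0 \<le> g (m + (i - m) mod n + 1) - g (m + (i - m) mod n) \<and> g (m + (i - m) mod n + 1) - g (m + (i - m) mod n) \<le> 2 * pi"
      using g(1) unfolding admissible_on_def by blast
    then show "0 \<le> \<psi> (i + 1) - \<psi> i \<and> \<psi> (i + 1) - \<psi> i \<le> 2 * pi" unfolding nxt unfolding \<psi>_def by simp
  qed
  moreover have "\<psi> (i + n) = \<psi> i + 2 * pi * of_int p" for i
  proof -
    have "i + n - m = (i - m) + n * 1" by simp
    then have "(i + n - m) mod n = (i - m) mod n" "(i + n - m) div n = (i - m) div n + 1"
      using n by (simp_all only: mod_mult_self2 div_mult_self2 less_imp_neq[symmetric] not_False_eq_True add.commute[of 1])
    then show ?thesis by (simp add: \<psi>_def algebra_simps)
  qed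
  moreover have "\<psi> i = g i" if "m \<le> i" "i \<le> m + n" for i
  proof (cases "i = m + n")
    case True
    then show ?thesis using g(2) n by (simp add: \<psi>_def)
  next
    case False
    then have "(i - m) mod n = i - m" "(i - m) div n = 0" using that by (simp_all add: div_pos_pos_trivial)
    then show ?thesis by (simp add: \<psi>_def)
  qed
  ultimately show ?thesis using that unfolding periodic_configs_def by blast
qed

text \<open>The competitor is substituted inside one period and then extended periodically, whence
  the bound on the length. Longer segments are reached by letting the period grow.\<close>

lemma periodic_minimizer_segment:
  assumes \<xi>: "\<xi> \<in> periodic_minimizers p n" and n: "n > 0" and m: "m < m'" "m' - m \<le> n"
    and \<psi>: "admissible_on {m..<m'} \<psi>" "\<psi> m = \<xi> m" "\<psi> m' = \<xi> m'"
  shows "act m m' \<xi> \<le> act m m' \<psi>"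
proof -
  have X: "\<xi> \<in> periodic_configs p n" using \<xi> by (simp add: periodic_minimizers_def)
  define g where "g i = (if i \<le> m' then \<psi> i else \<xi> i)" for i
  have g2: "g i = \<xi> i" if "i \<ge> m'" for i using that \<psi>(3) by (auto simp: g_def)
  have g1: "g i = \<psi> i" if "i \<le> m'" for i using that by (auto simp: g_def)
  have adm: "admissible_on {m..<m + n} g"
    unfolding admissible_on_def
  proof
    fix i assume i: "i \<in> {m..<m + n}"
    show "0 \<le> g (i + 1) - g i \<and> g (i + 1) - g i \<le> 2 * pi"
    proof (cases "i < m'")
      case True
      then show ?thesis using \<psi>(1) i by (auto simp: g1 admissible_on_def)
    next
      case False
      then show ?thesis using X by (auto simp: g2 periodic_configs_def admissible_on_def)
    qed
  qed
  have per: "g (m + n) = g m + 2 * pi * of_int p"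
    using X m \<psi> by (simp add: g1 g2 periodic_configs_def)
  obtain \<psi>' where \<psi>': "\<psi>' \<in> periodic_configs p n" "\<And>i. m \<le> i \<Longrightarrow> i \<le> m + n \<Longrightarrow> \<psi>' i = g i"
    using periodic_extension[OF adm per n] by blast
  have "act m m' \<xi> + act m' (m + n) \<xi> = act m (m + n) \<xi>"
    using m n by (intro act_split[symmetric]) auto
  also have "\<dots> = act 0 n \<xi>" by (rule periodic_act[OF X n])
  also have "\<dots> \<le> act 0 n \<psi>'" using \<xi> \<psi>'(1) by (simp add: periodic_minimizers_def)
  also have "\<dots> = act m (m + n) \<psi>'" by (rule periodic_act[OF \<psi>'(1) n, symmetric])
  also have "\<dots> = act m m' \<psi>' + act m' (m + n) \<psi>'"
    using m n by (intro act_split) auto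
  also have "act m m' \<psi>' = act m m' \<psi>" using m by (intro act_cong) (simp add: \<psi>' g1)
  also have "act m' (m + n) \<psi>' = act m' (m + n) \<xi>" using m by (intro act_cong) (simp add: \<psi>' g2)
  finally show ?thesis by simp
qed

end

section \<open>Existence of ordered minimizers\<close>

context support_param
begin

lemma S_tendsto:
  assumes "(f \<longlongrightarrow> a) F" "(g \<longlongrightarrow> b) F"
  shows "((\<lambda>n. S (f n) (g n)) \<longlongrightarrow> S a b) F"
proof -
  have "continuous_on UNIV (\<lambda>p. S (fst p) (snd p))"
    by (intro S_continuous continuous_intros)
  then have "isCont (\<lambda>p. S (fst p) (snd p)) (a, b)"
    by (simp add: continuous_on_eq_continuous_at)
  from isCont_tendsto_compose[OF this tendsto_Pair[OF assms]] show ?thesis by simp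
qed

lemma act_tendsto:
  assumes "\<And>i. ((\<lambda>n. \<phi> n i) \<longlongrightarrow> \<psi> i) F"
  shows "((\<lambda>n. act m k (\<phi> n)) \<longlongrightarrow> act m k \<psi>) F"
  unfolding action_def by (intro tendsto_sum S_tendsto assms)

text \<open>With l = floor(k p/n) the order traps \<xi>(i + k) - \<xi>(i) between 2 pi l and 2 pi (l
  + 1), an interval that also contains 2 pi k p/n. The bound is independent of the period and
  survives limits.\<close>

lemma ordered_periodic_minimizer_rotation:
  assumes p: "0 \<le> p" "p \<le> n" and n: "n > 0"
  obtains \<xi> where "\<xi> \<in> periodic_minimizers p n" "0 \<le> \<xi> 0" "\<xi> 0 \<le> 2 * pi"
    "\<And>i k. \<bar>\<xi> (i + k) - \<xi> i - 2 * pi * (of_int p / of_int n) * of_int k\<bar> \<le> 2 * pi"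
proof -
  obtain \<phi> where \<phi>: "\<phi> \<in> periodic_minimizers p n"
    and ord: "\<And>i k l. l * n \<le> k * p \<Longrightarrow> \<phi> i + 2 * pi * of_int l \<le> \<phi> (i + k)"
    using ordered_periodic_minimizer[OF assms] by blast
  define c where "c = - \<lfloor>\<phi> 0 / (2 * pi)\<rfloor>"
  define \<xi> where "\<xi> = (\<lambda>i. \<phi> (i + 0) + 2 * pi * of_int c)"
  have "\<xi> \<in> periodic_minimizers p n" unfolding \<xi>_def by (rule periodic_minimizers_shift[OF \<phi> n])
  moreover have "0 \<le> \<xi> 0" "\<xi> 0 \<le> 2 * pi"
    using floor_two_pi[of "\<phi> 0"] by (simp_all add: \<xi>_def c_def)
  moreover have "\<bar>\<xi> (i + k) - \<xi> i - 2 * pi * (of_int p / of_int n) * of_int k\<bar> \<le> 2 * pi" for i k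
  proof -
    define l where "l = k * p div n"
    have l: "l * n \<le> k * p" "k * p \<le> (l + 1) * n"
    proof -
      have "k * p = l * n + (k * p) mod n" by (simp add: l_def)
      moreover have "0 \<le> (k * p) mod n" "(k * p) mod n < n" using n by auto
      ultimately show "l * n \<le> k * p" "k * p \<le> (l + 1) * n" by (auto simp: distrib_right)
    qed
    have 1: "\<phi> i + 2 * pi * of_int l \<le> \<phi> (i + k)" by (rule ord[OF l(1)])
    \<comment> \<open>The upper bound is the order relation for the translation by -k, read from the
      index i + k.\<close>
    have "(- (l + 1)) * n \<le> (- k) * p" using l(2) by (simp only: mult_minus_left neg_le_iff_le)
    from ord[OF this, of "i + k"] have 2: "\<phi> (i + k) + 2 * pi * of_int (- (l + 1)) \<le> \<phi> i" by simp
    have 3: "of_int l \<le> (of_int p / of_int n * of_int k :: real)" "(of_int p / of_int n * of_int k :: real) \<le> of_int l + 1"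
    proof -
      have "real_of_int (l * n) \<le> of_int (k * p)" "real_of_int (k * p) \<le> of_int ((l + 1) * n)"
        using l by (simp_all only: of_int_le_iff)
      then show "of_int l \<le> (of_int p / of_int n * of_int k :: real)" "(of_int p / of_int n * of_int k :: real) \<le> of_int l + 1"
        using n by (auto simp: field_simps)
    qed
    define q :: real where "q = of_int p / of_int n * of_int k"
    have "2 * pi * of_int l \<le> 2 * pi * q" "2 * pi * q \<le> 2 * pi * (of_int l + 1)"
      unfolding q_def by (rule mult_left_mono[OF 3(1)], simp, rule mult_left_mono[OF 3(2)], simp)
    moreover have "2 * pi * (of_int l + 1) = 2 * pi * of_int l + 2 * pi" by (simp add: distrib_left)
    moreover have "2 * pi * real_of_int (- (l + 1)) = - (2 * pi * of_int l) - 2 * pi" by (simp add: algebra_simps)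
    moreover have e: "2 * pi * (of_int p / of_int n) * of_int k = 2 * pi * q" by (simp add: q_def)
    ultimately show ?thesis using 1 2 unfolding \<xi>_def abs_le_iff e add_0_right by linarith
  qed
  ultimately show ?thesis by (rule that)
qed

text \<open>Truncating the competitor between the extreme admissible segments with the prescribed end
  points adapts it to slightly different end points.\<close>

lemma action_minimizing_limit:
  assumes min: "\<And>m m' \<psi>. m < m' \<Longrightarrow> eventually (\<lambda>n. \<forall>\<psi>. admissible_on {m..<m'} \<psi> \<and> \<psi> m = \<phi> n m \<and> \<psi> m' = \<phi> n m' \<longrightarrow>
      act m m' (\<phi> n) \<le> act m m' \<psi>) sequentially"
    and adm: "\<And>n. admissible_on UNIV (\<phi> n)"
    and lim: "\<And>i. (\<lambda>n. \<phi> n i) \<longlonglongrightarrow> \<xi> i"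
  shows "action_minimizing \<Omega> \<xi>"
  unfolding action_minimizing_def
proof (intro conjI allI impI)
  show "admissible_on UNIV \<xi>"
    unfolding admissible_on_def
  proof
    fix i
    have l: "(\<lambda>n. \<phi> n (i + 1) - \<phi> n i) \<longlonglongrightarrow> \<xi> (i + 1) - \<xi> i" by (intro tendsto_diff lim)
    have "0 \<le> \<phi> n (i + 1) - \<phi> n i" "\<phi> n (i + 1) - \<phi> n i \<le> 2 * pi" for n
      using adm[of n] by (auto simp: admissible_on_def)
    then show "0 \<le> \<xi> (i + 1) - \<xi> i \<and> \<xi> (i + 1) - \<xi> i \<le> 2 * pi"
      using LIMSEQ_le_const[OF l] LIMSEQ_le_const2[OF l] by blast
  qed
  fix m m' :: int and \<psi>
  assume "m < m' \<and> admissible_on {m..<m'} \<psi> \<and> \<psi> m = \<xi> m \<and> \<psi> m' = \<xi> m'"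
  then have mm: "m < m'" and \<psi>: "admissible_on {m..<m'} \<psi>" "\<psi> m = \<xi> m" "\<psi> m' = \<xi> m'" by auto
  define lo where "lo n i = max (\<phi> n m) (\<phi> n m' - 2 * pi * of_int (m' - i))" for n i
  define up where "up n i = min (\<phi> n m') (\<phi> n m + 2 * pi * of_int (i - m))" for n i
  define \<psi>' where "\<psi>' n i = (if i < m \<or> i > m' then \<psi> i else min (max (\<psi> i) (lo n i)) (up n i))" for n i
  have gr: "\<phi> n m \<le> \<phi> n m'" "\<phi> n m' \<le> \<phi> n m + 2 * pi * of_int (m' - m)" for n
    using admissible_on_growth[of m m' "\<phi> n" m m'] adm[of n] admissible_on_subset mm by auto
  have "admissible_on {m..<m'} (\<psi>' n)" for n
    unfolding admissible_on_def
  proof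
    fix i assume i: "i \<in> {m..<m'}"
    have a: "0 \<le> \<psi> (i + 1) - \<psi> i" "\<psi> (i + 1) - \<psi> i \<le> 2 * pi" using \<psi>(1) i by (auto simp: admissible_on_def)
    have b: "0 \<le> lo n (i + 1) - lo n i" "lo n (i + 1) - lo n i \<le> 2 * pi"
      "0 \<le> up n (i + 1) - up n i" "up n (i + 1) - up n i \<le> 2 * pi"
    proof -
      have e: "2 * pi * real_of_int (m' - (i + 1)) = 2 * pi * of_int (m' - i) - 2 * pi"
        "2 * pi * real_of_int (i + 1 - m) = 2 * pi * of_int (i - m) + 2 * pi" by (simp_all add: algebra_simps)
      show "0 \<le> lo n (i + 1) - lo n i" "lo n (i + 1) - lo n i \<le> 2 * pi"
        "0 \<le> up n (i + 1) - up n i" "up n (i + 1) - up n i \<le> 2 * pi"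
        unfolding lo_def up_def e using pi_gt_zero by linarith+
    qed
    have c: "\<psi>' n i = min (max (\<psi> i) (lo n i)) (up n i)" "\<psi>' n (i + 1) = min (max (\<psi> (i + 1)) (lo n (i + 1))) (up n (i + 1))"
      using i by (auto simp: \<psi>'_def)
    show "0 \<le> \<psi>' n (i + 1) - \<psi>' n i \<and> \<psi>' n (i + 1) - \<psi>' n i \<le> 2 * pi"
      unfolding c using a b by (auto simp: max_def min_def)
  qed
  moreover have "\<psi>' n m = \<phi> n m" "\<psi>' n m' = \<phi> n m'" for n
  proof -
    have "lo n m = \<phi> n m" "up n m = \<phi> n m" "lo n m' = \<phi> n m'" "up n m' = \<phi> n m'"
      using gr[of n] by (simp_all add: lo_def up_def)
    then show "\<psi>' n m = \<phi> n m" "\<psi>' n m' = \<phi> n m'" using mm by (simp_all add: \<psi>'_def)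
  qed
  ultimately have "\<forall>\<^sub>F n in sequentially. act m m' (\<phi> n) \<le> act m m' (\<psi>' n)"
    using min[OF mm] by (auto elim: eventually_mono)
  moreover have "(\<lambda>n. act m m' (\<phi> n)) \<longlonglongrightarrow> act m m' \<xi>" by (intro act_tendsto lim)
  moreover have "(\<lambda>n. act m m' (\<psi>' n)) \<longlonglongrightarrow> act m m' \<psi>"
  proof (rule act_tendsto)
    fix i
    show "(\<lambda>n. \<psi>' n i) \<longlonglongrightarrow> \<psi> i"
    proof (cases "i < m \<or> i > m'")
      case True
      then show ?thesis by (simp add: \<psi>'_def)
    next
      case False
      then have i: "m \<le> i" "i \<le> m'" by auto
      have "(\<lambda>n. min (max (\<psi> i) (lo n i)) (up n i)) \<longlonglongrightarrow>
        min (max (\<psi> i) (max (\<xi> m) (\<xi> m' - 2 * pi * of_int (m' - i)))) (min (\<xi> m') (\<xi> m + 2 * pi * of_int (i - m)))"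
        unfolding lo_def up_def by (intro tendsto_min tendsto_max tendsto_intros lim)
      \<comment> \<open>The truncation disappears in the limit, since \<psi> lies between the
        extreme admissible segments that belong to its own end points.\<close>
      also have "min (max (\<psi> i) (max (\<xi> m) (\<xi> m' - 2 * pi * of_int (m' - i)))) (min (\<xi> m') (\<xi> m + 2 * pi * of_int (i - m))) = \<psi> i"
        using admissible_on_growth[OF \<psi>(1), of m i] admissible_on_growth[OF \<psi>(1), of i m'] i
        by (simp add: \<psi> min_def max_def)
      finally show ?thesis using False by (simp add: \<psi>'_def)
    qed
  qed
  ultimately show "act m m' \<xi> \<le> act m m' \<psi>"
    by (intro tendsto_le[OF sequentially_bot])
qed

text \<open>The approximating periods N tend to infinity even for rational \<rho>, so that every
  fixed segment eventually fits into one period. All approximants lie in one compact box, which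
  yields a subsequence converging at every index.\<close>

lemma ordered_minimizer:
  assumes \<rho>: "0 \<le> \<rho>" "\<rho> \<le> 1"
  obtains \<xi> where "action_minimizing \<Omega> \<xi>" "\<bar>\<xi> 0\<bar> \<le> 2 * pi"
    "\<And>i k. \<bar>\<xi> (i + k) - \<xi> i - 2 * pi * \<rho> * of_int k\<bar> \<le> 2 * pi"
proof -
  define N where "N n = int (Suc n)" for n
  define p where "p n = \<lfloor>real_of_int (N n) * \<rho>\<rfloor>" for n
  have N: "N n > 0" for n by (simp add: N_def)
  have p: "0 \<le> p n" "p n \<le> N n" for n
  proof -
    show "0 \<le> p n" using \<rho> N[of n] by (simp add: p_def)
    have "real_of_int (N n) * \<rho> \<le> of_int (N n)" using \<rho> N[of n] by (simp add: mult_left_le)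
    then show "p n \<le> N n" unfolding p_def by linarith
  qed
  have "\<exists>\<xi>. \<xi> \<in> periodic_minimizers (p n) (N n) \<and> 0 \<le> \<xi> 0 \<and> \<xi> 0 \<le> 2 * pi \<and>
    (\<forall>i k. \<bar>\<xi> (i + k) - \<xi> i - 2 * pi * (of_int (p n) / of_int (N n)) * of_int k\<bar> \<le> 2 * pi)" for n
    by (rule ordered_periodic_minimizer_rotation[OF p N, of n]) blast
  then obtain X where X: "\<And>n. X n \<in> periodic_minimizers (p n) (N n)" "\<And>n. 0 \<le> X n 0" "\<And>n. X n 0 \<le> 2 * pi"
    "\<And>n i k. \<bar>X n (i + k) - X n i - 2 * pi * (of_int (p n) / of_int (N n)) * of_int k\<bar> \<le> 2 * pi"
    by metis
  have adm: "admissible_on UNIV (X n)" for n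
    using X(1)[of n] by (simp add: periodic_minimizers_def periodic_configs_def)
  define box where "box = {\<phi>. \<forall>i. - 2 * pi * \<bar>of_int i\<bar> \<le> \<phi> i \<and> \<phi> i \<le> 2 * pi + 2 * pi * \<bar>of_int i\<bar>}"
  have "X n \<in> box" for n
    unfolding box_def using admissible_on_box[OF adm X(2,3)] by blast
  moreover have "seq_compact box"
    unfolding box_def by (intro compact_imp_seq_compact compact_box)
  ultimately obtain \<xi> r where r: "strict_mono r" "(X \<circ> r) \<longlonglongrightarrow> \<xi>"
    using seq_compactE[of box X] by blast
  have lim: "(\<lambda>n. X (r n) i) \<longlonglongrightarrow> \<xi> i" for i
    using continuous_on_tendsto_compose[OF continuous_on_product_coordinates[of i] r(2)] by (simp add: o_def)
  have minim: "action_minimizing \<Omega> \<xi>"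
  proof (rule action_minimizing_limit[of "\<lambda>n. X (r n)"])
    fix m m' :: int assume mm: "m < m'"
    show "\<forall>\<^sub>F n in sequentially. \<forall>\<psi>. admissible_on {m..<m'} \<psi> \<and> \<psi> m = X (r n) m \<and> \<psi> m' = X (r n) m' \<longrightarrow>
      act m m' (X (r n)) \<le> act m m' \<psi>"
      using eventually_ge_at_top[of "nat (m' - m)"]
    proof eventually_elim
      case (elim n)
      have "n \<le> r n" using r(1) seq_suble by blast
      then have "m' - m \<le> N (r n)" using elim by (simp add: N_def)
      then show ?case using periodic_minimizer_segment[OF X(1) N mm, of "r n"] by blast
    qed
  qed (use adm lim in auto)
  have "(\<lambda>n. of_int (p n) / of_int (N n) :: real) \<longlonglongrightarrow> \<rho>"
  proof (rule Lim_null_comparison[THEN LIM_zero_cancel])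
    show "\<forall>\<^sub>F n in sequentially. norm (of_int (p n) / of_int (N n) - \<rho>) \<le> inverse (real (Suc n))"
    proof (intro always_eventually allI)
      fix n
      have "of_int (p n) \<le> real_of_int (N n) * \<rho>" "real_of_int (N n) * \<rho> < of_int (p n) + 1"
        unfolding p_def by linarith+
      then have "\<bar>of_int (p n) - real_of_int (N n) * \<rho>\<bar> \<le> 1" by linarith
      moreover have "of_int (p n) / of_int (N n) - \<rho> = (of_int (p n) - real_of_int (N n) * \<rho>) / of_int (N n)"
        using N[of n] by (simp add: field_simps)
      ultimately have "\<bar>of_int (p n) / of_int (N n) - \<rho>\<bar> \<le> 1 / of_int (N n)"
        using N[of n] by (simp add: divide_right_mono)
      then show "norm (of_int (p n) / of_int (N n) - \<rho>) \<le> inverse (real (Suc n))"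
        by (simp add: N_def inverse_eq_divide)
    qed
  qed (rule LIMSEQ_inverse_real_of_nat)
  from LIMSEQ_subseq_LIMSEQ[OF this r(1)]
  have lp: "(\<lambda>n. of_int (p (r n)) / of_int (N (r n)) :: real) \<longlonglongrightarrow> \<rho>"
    by (simp add: o_def)
  have "\<bar>\<xi> (i + k) - \<xi> i - 2 * pi * \<rho> * of_int k\<bar> \<le> 2 * pi" for i k
  proof -
    have "(\<lambda>n. \<bar>X (r n) (i + k) - X (r n) i - 2 * pi * (of_int (p (r n)) / of_int (N (r n))) * of_int k\<bar>)
       \<longlonglongrightarrow> \<bar>\<xi> (i + k) - \<xi> i - 2 * pi * \<rho> * of_int k\<bar>"
      by (intro tendsto_intros lim lp)
    then show ?thesis by (rule LIMSEQ_le_const2) (use X(4) in auto)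
  qed
  moreover have "\<bar>\<xi> 0\<bar> \<le> 2 * pi"
  proof -
    have "(\<lambda>n. \<bar>X (r n) 0\<bar>) \<longlonglongrightarrow> \<bar>\<xi> 0\<bar>" by (intro tendsto_intros lim)
    then show ?thesis by (rule LIMSEQ_le_const2) (use X(2,3) in auto)
  qed
  ultimately show ?thesis using minim that by blast
qed

text \<open>The competitor runs with constant step from \<phi>(m) to \<xi>(m1), follows \<xi>, and
  runs with constant step from \<xi>(n1) to \<phi>(n). \<open>left\<close> and \<open>right\<close>
  say that these constant steps are admissible, and each of them costs at most 2 B.\<close>

lemma splice:
  assumes min: "action_minimizing \<Omega> \<phi>" and ord: "m \<le> m1" "m1 \<le> n1" "n1 \<le> n" "m < n"
    and \<xi>: "admissible_on {m1..<n1} \<xi>"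
    and left: "0 \<le> \<xi> m1 - \<phi> m" "\<xi> m1 - \<phi> m \<le> 2 * pi * of_int (m1 - m)"
    and right: "0 \<le> \<phi> n - \<xi> n1" "\<phi> n - \<xi> n1 \<le> 2 * pi * of_int (n - n1)"
  shows "act m n \<phi> \<le> act m1 n1 \<xi> + 2 * B * of_int ((m1 - m) + (n - n1))"
proof -
  \<comment> \<open>If m1 = m, the quotient is 0 by the convention for division by 0, and
    \<open>left\<close> forces the two end points to agree. The same holds for
    \<open>b\<close>.\<close>
  define a where "a = (\<xi> m1 - \<phi> m) / of_int (m1 - m)"
  define b where "b = (\<phi> n - \<xi> n1) / of_int (n - n1)"
  have a: "0 \<le> a" "a \<le> 2 * pi" "a * of_int (m1 - m) = \<xi> m1 - \<phi> m"
  proof -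
    show "0 \<le> a" using left ord by (simp add: a_def)
    show "a \<le> 2 * pi" using left ord unfolding a_def by (cases "m1 = m") (auto simp: divide_le_eq)
    show "a * of_int (m1 - m) = \<xi> m1 - \<phi> m" using left unfolding a_def by (cases "m1 = m") auto
  qed
  have b: "0 \<le> b" "b \<le> 2 * pi" "b * of_int (n - n1) = \<phi> n - \<xi> n1"
  proof -
    show "0 \<le> b" using right ord by (simp add: b_def)
    show "b \<le> 2 * pi" using right ord unfolding b_def by (cases "n = n1") (auto simp: divide_le_eq)
    show "b * of_int (n - n1) = \<phi> n - \<xi> n1" using right unfolding b_def by (cases "n = n1") auto
  qed
  define \<psi> where "\<psi> i = (if i < m1 then \<phi> m + a * of_int (i - m) else if i \<le> n1 then \<xi> i
     else \<xi> n1 + b * of_int (i - n1))" for i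
  have \<psi>1: "\<psi> i = \<phi> m + a * of_int (i - m)" if "i \<le> m1" for i
    using that a(3) ord by (cases "i = m1") (auto simp: \<psi>_def)
  have \<psi>2: "\<psi> i = \<xi> i" if "m1 \<le> i" "i \<le> n1" for i using that by (auto simp: \<psi>_def)
  have \<psi>3: "\<psi> i = \<xi> n1 + b * of_int (i - n1)" if "n1 \<le> i" for i
    using that ord by (cases "i = n1") (auto simp: \<psi>_def)
  have "admissible_on {m..<n} \<psi>"
    unfolding admissible_on_def
  proof
    fix i assume i: "i \<in> {m..<n}"
    consider "i < m1" | "m1 \<le> i" "i < n1" | "n1 \<le> i" by linarith
    then show "0 \<le> \<psi> (i + 1) - \<psi> i \<and> \<psi> (i + 1) - \<psi> i \<le> 2 * pi"
    proof cases
      case 1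
      then show ?thesis using \<psi>1[of i] \<psi>1[of "i + 1"] a by (simp add: algebra_simps)
    next
      case 2
      then show ?thesis using \<psi>2[of i] \<psi>2[of "i + 1"] \<xi> by (simp add: admissible_on_def)
    next
      case 3
      then show ?thesis using \<psi>3[of i] \<psi>3[of "i + 1"] b by (simp add: algebra_simps)
    qed
  qed
  moreover have "\<psi> m = \<phi> m" "\<psi> n = \<phi> n" using \<psi>1[of m] \<psi>3[of n] b(3) ord by auto
  ultimately have "act m n \<phi> \<le> act m n \<psi>" using min ord(4) unfolding action_minimizing_def by blast
  also have "\<dots> = act m m1 \<psi> + (act m1 n1 \<psi> + act n1 n \<psi>)"
    using ord act_split[of m m1 n \<psi>] act_split[of m1 n1 n \<psi>] by simp
  also have "act m1 n1 \<psi> = act m1 n1 \<xi>" by (intro act_cong) (simp add: \<psi>2)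
  also have "act m m1 \<psi> \<le> 2 * B * of_int (m1 - m)" using act_bound[OF ord(1), of \<psi>] by simp
  also have "act n1 n \<psi> \<le> 2 * B * of_int (n - n1)" using act_bound[OF ord(3), of \<psi>] by simp
  finally show ?thesis by (simp add: algebra_simps)
qed

end

section \<open>Asymptotics of minimal actions\<close>

text \<open>Both m a(n) and n a(m) differ from a(m n) by a controlled multiple of C, so a(n)/n and
  a(m)/m differ by at most 2 C/n + 2 C/m.\<close>

lemma quasi_additive_converges:
  fixes a :: "nat \<Rightarrow> real"
  assumes qa: "\<And>m n. \<bar>a (m + n) - a m - a n\<bar> \<le> C"
  shows "convergent (\<lambda>n. a n / real n)"
proof -
  have C: "C \<ge> 0" using qa[of 0 0] by linarith
  have mult: "\<bar>a (k * n) - real k * a n\<bar> \<le> real k * C + C" for k n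
  proof (induction k)
    case 0
    then show ?case using qa[of 0 0] by simp
  next
    case (Suc k)
    have "\<bar>a (n + k * n) - a n - a (k * n)\<bar> \<le> C" by (rule qa)
    then have "\<bar>a (Suc k * n) - a n - a (k * n)\<bar> \<le> C" by simp
    moreover have "real (Suc k) * a n = real k * a n + a n" "real (Suc k) * C = real k * C + C"
      by (simp_all add: distrib_right)
    ultimately show ?case using Suc.IH by linarith
  qed
  have diff: "\<bar>a n / real n - a m / real m\<bar> \<le> 2 * C / real n + 2 * C / real m" if "m > 0" "n > 0" for m n
  proof -
    have "\<bar>real m * a n - real n * a m\<bar> \<le> real m * C + C + (real n * C + C)"
      using mult[of m n] mult[of n m] by (simp add: mult.commute[of n m])
    also have "\<dots> \<le> real m * C + real m * C + (real n * C + real n * C)"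
    proof -
      have "C \<le> real m * C" "C \<le> real n * C" using that C by (simp_all add: mult_le_cancel_right1)
      then show ?thesis by linarith
    qed
    finally have 1: "\<bar>real m * a n - real n * a m\<bar> \<le> 2 * real m * C + 2 * real n * C" by (simp add: mult_ac)
    have "a n / real n - a m / real m = (real m * a n - real n * a m) / (real m * real n)"
      using that by (simp add: field_simps)
    then have "\<bar>a n / real n - a m / real m\<bar> = \<bar>real m * a n - real n * a m\<bar> / (real m * real n)"
      by simp
    also have "\<dots> \<le> (2 * real m * C + 2 * real n * C) / (real m * real n)"
      using 1 by (intro divide_right_mono) auto
    also have "\<dots> = 2 * C / real n + 2 * C / real m" using that by (simp add: field_simps)
    finally show ?thesis .
  qed
  show ?thesis
  proof (rule Cauchy_convergent, rule CauchyI)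
    fix e :: real assume e: "e > 0"
    obtain M :: nat where M: "real M > 4 * C / e" using reals_Archimedean2 by blast
    have small: "2 * C / real n < e / 2" if "n \<ge> Suc M" for n
    proof -
      have "4 * C / e < real n" using M that by linarith
      then have "4 * C < e * real n" using e by (simp add: pos_divide_less_eq mult.commute)
      then show ?thesis using that by (simp add: pos_divide_less_eq)
    qed
    show "\<exists>M. \<forall>m\<ge>M. \<forall>n\<ge>M. norm (a m / real m - a n / real n) < e"
    proof (intro exI allI impI)
      fix m n assume mn: "m \<ge> Suc M" "n \<ge> Suc M"
      have "\<bar>a m / real m - a n / real n\<bar> \<le> 2 * C / real m + 2 * C / real n"
        using mn by (intro diff) auto
      then show "norm (a m / real m - a n / real n) < e"
        using small[OF mn(1)] small[OF mn(2)] by simp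
    qed
  qed
qed

text \<open>The case \<eta> = 0 is the bounded deviation of ordered minimizers. A rotation number
  alone provides only some K for each \<eta> > 0.\<close>

definition near_rotation :: "real \<Rightarrow> real \<Rightarrow> real \<Rightarrow> (int \<Rightarrow> real) \<Rightarrow> bool" where
  "near_rotation \<alpha> K \<eta> \<phi> \<longleftrightarrow> (\<forall>i. \<bar>\<phi> i - \<alpha> * of_int i\<bar> \<le> K + \<eta> * \<bar>of_int i\<bar>)"

lemma near_rotation_mono: "near_rotation \<alpha> K \<eta> \<phi> \<Longrightarrow> K \<le> K' \<Longrightarrow> \<eta> \<le> \<eta>' \<Longrightarrow> near_rotation \<alpha> K' \<eta>' \<phi>"
  unfolding near_rotation_def
proof (intro allI)
  fix i assume *: "\<forall>i. \<bar>\<phi> i - \<alpha> * of_int i\<bar> \<le> K + \<eta> * \<bar>of_int i\<bar>" "K \<le> K'" "\<eta> \<le> \<eta>'"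
  have "\<eta> * \<bar>real_of_int i\<bar> \<le> \<eta>' * \<bar>of_int i\<bar>" using * by (intro mult_right_mono) auto
  then show "\<bar>\<phi> i - \<alpha> * of_int i\<bar> \<le> K' + \<eta>' * \<bar>of_int i\<bar>" using spec[OF *(1), of i] *(2) by linarith
qed

lemma near_rotation_imp_rotation_number:
  assumes "near_rotation (2 * pi * \<rho>) K 0 \<phi>"
  shows "has_rotation_number \<phi> \<rho>"
proof -
  have b: "norm (\<phi> i / (2 * pi * of_int i) - \<rho>) \<le> norm (K / real_of_int i)" if "i \<noteq> 0" for i
  proof -
    have "\<bar>\<phi> i - 2 * pi * \<rho> * of_int i\<bar> \<le> K" using assms by (simp add: near_rotation_def)
    moreover have "\<phi> i / (2 * pi * of_int i) - \<rho> = (\<phi> i - 2 * pi * \<rho> * of_int i) / (2 * pi * of_int i)"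
      using that by (simp add: field_simps)
    ultimately have "norm (\<phi> i / (2 * pi * of_int i) - \<rho>) \<le> K / (2 * pi * \<bar>of_int i\<bar>)"
      using that by (simp add: abs_mult divide_right_mono)
    also have "\<dots> \<le> K / (1 * \<bar>of_int i\<bar>)"
    proof (rule divide_left_mono)
      show "1 * \<bar>of_int i\<bar> \<le> 2 * pi * \<bar>real_of_int i\<bar>" using pi_gt3 by (intro mult_right_mono) auto
      show "0 \<le> K" using \<open>\<bar>\<phi> i - 2 * pi * \<rho> * of_int i\<bar> \<le> K\<close> by linarith
    qed (use that in auto)
    also have "\<dots> \<le> norm (K / real_of_int i)"
      by (simp add: abs_div divide_right_mono)
    finally show ?thesis .
  qed
  have top: "((\<lambda>i. K / real_of_int i) \<longlongrightarrow> 0) at_top"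
    by (intro tendsto_divide_0[OF tendsto_const] filterlim_at_top_imp_at_infinity filterlim_real_of_int_at_top)
  have bot: "((\<lambda>i. K / real_of_int i) \<longlongrightarrow> 0) at_bot"
  proof (intro tendsto_divide_0[OF tendsto_const] filterlim_at_bot_imp_at_infinity)
    show "filterlim real_of_int at_bot at_bot"
      unfolding filterlim_at_bot eventually_at_bot_linorder
    proof
      fix Z :: real
      show "\<exists>N. \<forall>n\<le>N. real_of_int n \<le> Z" by (rule exI[of _ "\<lfloor>Z\<rfloor>"]) (auto simp: le_floor_iff)
    qed
  qed
  have "((\<lambda>i. \<phi> i / (2 * pi * of_int i) - \<rho>) \<longlongrightarrow> 0) at_top"
    by (rule Lim_null_comparison[OF _ tendsto_norm_zero[OF top]])
      (rule eventually_mono[OF eventually_gt_at_top[of 0]], rule b, simp)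
  moreover have "((\<lambda>i. \<phi> i / (2 * pi * of_int i) - \<rho>) \<longlongrightarrow> 0) at_bot"
    by (rule Lim_null_comparison[OF _ tendsto_norm_zero[OF bot]])
      (rule eventually_mono[OF eventually_le_at_bot[of "- 1"]], rule b, simp)
  ultimately show ?thesis unfolding has_rotation_number_def by (auto intro: LIM_zero_cancel)
qed

lemma rotation_number_imp_near_rotation:
  assumes rot: "has_rotation_number \<phi> \<rho>" and \<eta>: "\<eta> > 0"
  obtains K where "near_rotation (2 * pi * \<rho>) K \<eta> \<phi>"
proof -
  have e: "\<eta> / (2 * pi) > 0" using \<eta> by simp
  have "\<forall>\<^sub>F i in at_top. dist (\<phi> i / (2 * pi * of_int i)) \<rho> < \<eta> / (2 * pi)"
    using rot e unfolding has_rotation_number_def tendsto_iff by blast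
  then obtain I where I: "\<And>i. i \<ge> I \<Longrightarrow> dist (\<phi> i / (2 * pi * of_int i)) \<rho> < \<eta> / (2 * pi)"
    unfolding eventually_at_top_linorder by blast
  have "\<forall>\<^sub>F i in at_bot. dist (\<phi> i / (2 * pi * of_int i)) \<rho> < \<eta> / (2 * pi)"
    using rot e unfolding has_rotation_number_def tendsto_iff by blast
  then obtain J where J: "\<And>i. i \<le> J \<Longrightarrow> dist (\<phi> i / (2 * pi * of_int i)) \<rho> < \<eta> / (2 * pi)"
    unfolding eventually_at_bot_linorder by blast
  have far: "\<bar>\<phi> i - 2 * pi * \<rho> * of_int i\<bar> \<le> \<eta> * \<bar>of_int i\<bar>"
    if "dist (\<phi> i / (2 * pi * of_int i)) \<rho> < \<eta> / (2 * pi)" "i \<noteq> 0" for i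
  proof -
    have "\<phi> i - 2 * pi * \<rho> * of_int i = (\<phi> i / (2 * pi * of_int i) - \<rho>) * (2 * pi * of_int i)"
      using that(2) by (simp add: field_simps)
    then have "\<bar>\<phi> i - 2 * pi * \<rho> * of_int i\<bar> = \<bar>\<phi> i / (2 * pi * of_int i) - \<rho>\<bar> * (2 * pi * \<bar>of_int i\<bar>)"
      by (simp add: abs_mult)
    also have "\<dots> \<le> (\<eta> / (2 * pi)) * (2 * pi * \<bar>of_int i\<bar>)"
      using that(1) by (intro mult_right_mono) (auto simp: dist_real_def)
    finally show ?thesis by simp
  qed
  \<comment> \<open>The sum absorbs the finitely many indices between the two thresholds, and the
    index 0, at which the quotient says nothing.\<close>
  define K where "K = (\<Sum>i\<in>insert 0 {J..I}. \<bar>\<phi> i - 2 * pi * \<rho> * of_int i\<bar>)"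
  have "\<bar>\<phi> i - 2 * pi * \<rho> * of_int i\<bar> \<le> K + \<eta> * \<bar>of_int i\<bar>" for i
  proof (cases "i \<in> insert 0 {J..I}")
    case True
    then have "\<bar>\<phi> i - 2 * pi * \<rho> * of_int i\<bar> \<le> K" unfolding K_def by (intro member_le_sum) auto
    moreover have "\<eta> * \<bar>real_of_int i\<bar> \<ge> 0" using \<eta> by simp
    ultimately show ?thesis by linarith
  next
    case False
    then have "\<bar>\<phi> i - 2 * pi * \<rho> * of_int i\<bar> \<le> \<eta> * \<bar>of_int i\<bar>"
      by (intro far) (use I[of i] J[of i] in auto)
    moreover have "K \<ge> 0" unfolding K_def by (intro sum_nonneg) auto
    ultimately show ?thesis by linarith
  qed
  then show ?thesis using that unfolding near_rotation_def by blast
qed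

context support_param
begin

lemma act_le_shrink:
  assumes "m \<le> m1" "m1 \<le> n1" "n1 \<le> n"
  shows "act m1 n1 \<phi> \<le> act m n \<phi> + 2 * B * of_int ((m1 - m) + (n - n1))"
proof -
  have "act m n \<phi> = act m m1 \<phi> + (act m1 n1 \<phi> + act n1 n \<phi>)"
    using assms act_split[of m m1 n \<phi>] act_split[of m1 n1 n \<phi>] by simp
  moreover have "- (2 * B * of_int (m1 - m)) \<le> act m m1 \<phi>" using act_bound[OF assms(1), of \<phi>] by linarith
  moreover have "- (2 * B * of_int (n - n1)) \<le> act n1 n \<phi>" using act_bound[OF assms(3), of \<phi>] by linarith
  moreover have "2 * B * of_int ((m1 - m) + (n - n1)) = 2 * B * of_int (m1 - m) + 2 * B * of_int (n - n1)"
    unfolding of_int_add by (rule distrib_left)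
  ultimately show ?thesis by linarith
qed

text \<open>\<phi> and \<xi> are quantified inside, so one threshold for N serves all of them; this
  uniformity permits integrating the inequality over a family of competitors.\<close>

abbreviation almost_least :: "real \<Rightarrow> real \<Rightarrow> real \<Rightarrow> real \<Rightarrow> nat \<Rightarrow> bool" where
  "almost_least \<alpha> K \<eta> \<epsilon> N \<equiv> \<forall>\<phi> \<xi>. action_minimizing \<Omega> \<phi> \<and> near_rotation \<alpha> K \<eta> \<phi> \<and>
    admissible_on UNIV \<xi> \<and> near_rotation \<alpha> K \<eta> \<xi> \<longrightarrow>
    act (- int N) (int N) \<phi> \<le> act (- int N) (int N) \<xi> + \<epsilon> * real N"

text \<open>A minimizer beats every admissible configuration of the same rotation number up to a sublinear
  error: follow the competitor on all but a small proportion of the steps and use the remaining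
  steps to connect its ends to the minimizer.\<close>

lemma minimizer_comparison:
  assumes \<alpha>: "0 < \<alpha>" "\<alpha> < 2 * pi" and \<epsilon>: "\<epsilon> > 0"
  obtains \<eta> where "\<eta> > 0" "\<And>K. \<forall>\<^sub>F N in sequentially. almost_least \<alpha> K \<eta> \<epsilon> N"
proof -
  \<comment> \<open>\<mu> is the distance of the mean step from the ends 0 and 2 pi of the
    admissible range, and l the ratio to N of the number of steps spent on each connection. The
    connections cost about 8 B l N in total, and the bound on l makes 8 B l at most \<epsilon>/2;
    the rounding of l N is paid from the other half.\<close>
  define \<mu> where "\<mu> = min \<alpha> (2 * pi - \<alpha>)"
  define l where "l = min (1 / 2) (\<epsilon> / (16 * (B + 1)))"
  define \<eta> where "\<eta> = \<mu> * l / 4"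
  have B: "B \<ge> 0" by (rule B_nonneg)
  have \<mu>: "\<mu> > 0" "\<mu> \<le> \<alpha>" "\<mu> \<le> 2 * pi - \<alpha>" using \<alpha> by (auto simp: \<mu>_def)
  have l: "l > 0" "l \<le> 1 / 2" "l \<le> \<epsilon> / (16 * (B + 1))"
  proof -
    show "l > 0" using \<epsilon> B by (simp add: l_def)
    show "l \<le> 1 / 2" "l \<le> \<epsilon> / (16 * (B + 1))"
      unfolding l_def by (rule min.cobounded1, rule min.cobounded2)
  qed
  have l2: "16 * B * l \<le> \<epsilon>"
  proof -
    have "l * (16 * (B + 1)) \<le> \<epsilon>" using l(3) B by (simp add: pos_le_divide_eq)
    then show ?thesis using l(1) by (simp add: algebra_simps)
  qed
  have \<eta>: "\<eta> > 0" using \<mu> l by (simp add: \<eta>_def)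
  have "\<forall>\<^sub>F N in sequentially. almost_least \<alpha> K \<eta> \<epsilon> N" for K
  proof -
    obtain N0 :: nat where N0: "real N0 > 2 + 4 * \<bar>K\<bar> / (\<mu> * l) + 16 * B / \<epsilon>" using reals_Archimedean2 by blast
    show ?thesis
      unfolding eventually_sequentially
    proof (intro exI allI impI)
      fix N \<phi> \<xi>
      assume N: "N \<ge> N0" and as: "action_minimizing \<Omega> \<phi> \<and> near_rotation \<alpha> K \<eta> \<phi> \<and>
        admissible_on UNIV \<xi> \<and> near_rotation \<alpha> K \<eta> \<xi>"
      have "4 * \<bar>K\<bar> / (\<mu> * l) \<ge> 0" "16 * B / \<epsilon> \<ge> 0" using \<mu> l B \<epsilon> by auto
      then have N1: "real N \<ge> 2" "4 * \<bar>K\<bar> / (\<mu> * l) \<le> real N" "16 * B / \<epsilon> \<le> real N"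
        using N N0 by linarith+
      then have NK: "4 * \<bar>K\<bar> \<le> \<mu> * l * real N" and NB: "16 * B \<le> \<epsilon> * real N"
        using \<mu> l \<epsilon> by (simp_all add: pos_divide_le_eq mult.commute mult.left_commute)
      define g where "g = \<lceil>l * real N\<rceil>"
      have g: "l * real N \<le> of_int g" "of_int g \<le> l * real N + 1" "0 \<le> g"
      proof -
        show 1: "l * real N \<le> of_int g" unfolding g_def by (rule le_of_int_ceiling)
        show "of_int g \<le> l * real N + 1" unfolding g_def by (rule of_int_ceiling_le_add_one)
        have "0 \<le> l * real N" using l by simp
        then have "0 \<le> real_of_int g" using 1 by linarith
        then show "0 \<le> g" by simp
      qed
      have "l * real N \<le> 1 / 2 * real N" using l by (intro mult_right_mono) auto
      then have "real_of_int g \<le> real N" using g(2) N1 by linarith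
      then have gN: "g \<le> int N" by linarith
      \<comment> \<open>K and \<eta> N contribute at most \<mu> l N/4 each. The two configurations
        at one end are then off by at most \<mu> l N together, which g >= l N connecting steps can
        make up.\<close>
      have dev: "\<bar>\<zeta> i - \<alpha> * of_int i\<bar> \<le> \<mu> * l * real N / 2" if "near_rotation \<alpha> K \<eta> \<zeta>" "\<bar>i\<bar> \<le> int N" for \<zeta> i
      proof -
        have "\<bar>\<zeta> i - \<alpha> * of_int i\<bar> \<le> K + \<eta> * \<bar>of_int i\<bar>" using that(1) by (simp add: near_rotation_def)
        moreover have "\<eta> * \<bar>of_int i\<bar> \<le> \<eta> * real N"
          using that(2) \<eta> by (intro mult_left_mono) linarith+
        moreover have "\<eta> * real N = \<mu> * l * real N / 4" by (simp add: \<eta>_def)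
        moreover have "K \<le> \<bar>K\<bar>" by simp
        ultimately show ?thesis using NK by linarith
      qed
      define m1 where "m1 = - int N + g"
      define n1 where "n1 = int N - g"
      have d: "\<bar>\<phi> (- int N) - \<alpha> * of_int (- int N)\<bar> \<le> \<mu> * l * real N / 2"
        "\<bar>\<phi> (int N) - \<alpha> * of_int (int N)\<bar> \<le> \<mu> * l * real N / 2"
        "\<bar>\<xi> m1 - \<alpha> * of_int m1\<bar> \<le> \<mu> * l * real N / 2" "\<bar>\<xi> n1 - \<alpha> * of_int n1\<bar> \<le> \<mu> * l * real N / 2"
      proof -
        have nr: "near_rotation \<alpha> K \<eta> \<phi>" "near_rotation \<alpha> K \<eta> \<xi>" using as by blast+
        have "\<bar>- int N\<bar> \<le> int N" "\<bar>int N\<bar> \<le> int N" "\<bar>m1\<bar> \<le> int N" "\<bar>n1\<bar> \<le> int N"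
          using g(3) gN by (simp_all add: m1_def n1_def)
        then show "\<bar>\<phi> (- int N) - \<alpha> * of_int (- int N)\<bar> \<le> \<mu> * l * real N / 2"
          "\<bar>\<phi> (int N) - \<alpha> * of_int (int N)\<bar> \<le> \<mu> * l * real N / 2"
          "\<bar>\<xi> m1 - \<alpha> * of_int m1\<bar> \<le> \<mu> * l * real N / 2" "\<bar>\<xi> n1 - \<alpha> * of_int n1\<bar> \<le> \<mu> * l * real N / 2"
          using dev[OF nr(1)] dev[OF nr(2)] by blast+
      qed
      have e: "\<alpha> * of_int m1 = \<alpha> * of_int (- int N) + \<alpha> * of_int g" "\<alpha> * of_int n1 = \<alpha> * of_int (int N) - \<alpha> * of_int g"
        by (simp_all add: m1_def n1_def algebra_simps)
      have gm: "\<mu> * l * real N \<le> \<mu> * of_int g" using g(1) \<mu>(1) by (simp add: mult.assoc)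
      have ga: "\<mu> * of_int g \<le> \<alpha> * of_int g" using \<mu> g by (intro mult_right_mono) auto
      have gb: "\<mu> * of_int g \<le> (2 * pi - \<alpha>) * of_int g" using \<mu> g by (intro mult_right_mono) auto
      then have gb: "\<mu> * of_int g + \<alpha> * of_int g \<le> 2 * pi * of_int g" by (simp add: left_diff_distrib)
      have "act (- int N) (int N) \<phi> \<le> act m1 n1 \<xi> + 2 * B * of_int ((m1 - - int N) + (int N - n1))"
      proof (rule splice)
        show "admissible_on {m1..<n1} \<xi>" using as admissible_on_subset by blast
        show "- int N \<le> m1" "m1 \<le> n1" "n1 \<le> int N" "- int N < int N"
          using g gN N1 by (auto simp: m1_def n1_def)
        have 1: "m1 - - int N = g" "int N - n1 = g" by (simp_all add: m1_def n1_def)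
        show "0 \<le> \<xi> m1 - \<phi> (- int N)" using d(1,3) e gm ga by linarith
        show "\<xi> m1 - \<phi> (- int N) \<le> 2 * pi * of_int (m1 - - int N)" unfolding 1 using d(1,3) e gm gb by linarith
        show "0 \<le> \<phi> (int N) - \<xi> n1" using d(2,4) e gm ga by linarith
        show "\<phi> (int N) - \<xi> n1 \<le> 2 * pi * of_int (int N - n1)" unfolding 1 using d(2,4) e gm gb by linarith
      qed (use as in blast)
      also have "act m1 n1 \<xi> \<le> act (- int N) (int N) \<xi> + 2 * B * of_int ((m1 - - int N) + (int N - n1))"
        by (rule act_le_shrink) (use g gN in \<open>auto simp: m1_def n1_def\<close>)
      also have "(m1 - - int N) + (int N - n1) = 2 * g" by (simp add: m1_def n1_def)
      finally have 1: "act (- int N) (int N) \<phi> \<le> act (- int N) (int N) \<xi> + 8 * (B * of_int g)" by simp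
      have "B * of_int g \<le> B * (l * real N + 1)" using g B by (intro mult_left_mono) auto
      then have "8 * (B * of_int g) \<le> 8 * B * l * real N + 8 * B" by (simp add: algebra_simps)
      moreover have "16 * B * l * real N \<le> \<epsilon> * real N" using l2 by (intro mult_right_mono) auto
      moreover have "16 * B * l * real N = 2 * (8 * B * l * real N)" by simp
      ultimately show "act (- int N) (int N) \<phi> \<le> act (- int N) (int N) \<xi> + \<epsilon> * real N"
        using 1 NB by linarith
    qed
  qed
  then show ?thesis using that \<eta> by blast
qed

text \<open>Any two blocks of equal length have actions that differ by a constant: the translate of
  one is a competitor for the other after reconnecting at both ends. The number of connecting steps
  is uniform because the deviation is bounded from every base point. Hence the action is
  quasi-additive.\<close>

lemma ordered_minimizer_mean_action:
  assumes min: "action_minimizing \<Omega> \<xi>" and \<alpha>: "0 < \<alpha>" "\<alpha> < 2 * pi"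
    and ord: "\<And>i k. \<bar>\<xi> (i + k) - \<xi> i - \<alpha> * of_int k\<bar> \<le> 2 * pi"
  shows "convergent (\<lambda>N. act (- int N) (int N) \<xi> / (2 * real N))"
proof -
  have adm: "admissible_on UNIV \<xi>" using min by (simp add: action_minimizing_def)
  define \<mu> where "\<mu> = min \<alpha> (2 * pi - \<alpha>)"
  have \<mu>: "\<mu> > 0" "\<mu> \<le> \<alpha>" "\<mu> \<le> 2 * pi - \<alpha>" using \<alpha> by (auto simp: \<mu>_def)
  \<comment> \<open>6 pi is three errors of 2 pi, as they occur at the right end: the rounding of
    the translation to a multiple of 2 pi, and the deviation of each of the two blocks.\<close>
  obtain n0 :: nat where "real n0 > 6 * pi / \<mu>" using reals_Archimedean2 by blast
  then have n0: "6 * pi < \<mu> * real n0" using \<mu> by (simp add: pos_divide_less_eq mult.commute)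
  define g where "g = int n0"
  have g0: "g \<ge> 0" by (simp add: g_def)
  have B: "B \<ge> 0" by (rule B_nonneg)
  have ga: "6 * pi \<le> \<alpha> * of_int g" "\<alpha> * of_int g + 6 * pi \<le> 2 * pi * of_int g"
  proof -
    have "\<mu> * real n0 \<le> \<alpha> * real n0" "\<mu> * real n0 \<le> (2 * pi - \<alpha>) * real n0"
      using \<mu> by (intro mult_right_mono; simp)+
    then show "6 * pi \<le> \<alpha> * of_int g" "\<alpha> * of_int g + 6 * pi \<le> 2 * pi * of_int g"
      using n0 by (auto simp: g_def left_diff_distrib)
  qed
  \<comment> \<open>Reconnecting and then restoring the cut ends cost 2 B for each of 2 g steps,
    twice. The same constant covers blocks of length at most 2 g trivially.\<close>
  define C where "C = 8 * B * of_int g"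
  have block: "act i (i + k) \<xi> \<le> act j (j + k) \<xi> + C" if k: "k \<ge> 0" for i j k
  proof (cases "k \<ge> 2 * g \<and> k > 0")
    case False
    then have k2: "k \<le> 2 * g" using g0 by linarith
    have "\<bar>act i (i + k) \<xi>\<bar> \<le> 2 * B * of_int k" "\<bar>act j (j + k) \<xi>\<bar> \<le> 2 * B * of_int k"
      using act_bound[of i "i + k" \<xi>] act_bound[of j "j + k" \<xi>] k by simp_all
    moreover have "2 * B * of_int k \<le> 2 * B * of_int (2 * g)" using k2 B by (intro mult_left_mono) auto
    ultimately show ?thesis by (simp add: C_def)
  next
    case True
    then have kg: "k \<ge> 2 * g" "k > 0" by auto
    define l where "l = \<lfloor>(\<xi> i - \<xi> j) / (2 * pi)\<rfloor>"
    have l: "\<bar>\<xi> i - \<xi> j - 2 * pi * of_int l\<bar> \<le> 2 * pi"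
      using floor_two_pi[of "\<xi> i - \<xi> j"] unfolding l_def abs_le_iff by linarith
    define \<zeta> where "\<zeta> = (\<lambda>r. \<xi> (r + (j - i)) + 2 * pi * of_int l)"
    have "act i (i + k) \<xi> \<le> act (i + g) (i + k - g) \<zeta> + 2 * B * of_int ((i + g - i) + (i + k - (i + k - g)))"
    proof (rule splice[OF min])
      show "admissible_on {i + g..<i + k - g} \<zeta>"
        unfolding \<zeta>_def using admissible_on_shift[OF adm] admissible_on_subset by blast
      show "i \<le> i + g" "i + g \<le> i + k - g" "i + k - g \<le> i + k" "i < i + k" using kg g0 by auto
      have e1: "i + g - i = g" "i + k - (i + k - g) = g" by auto
      have z1: "\<zeta> (i + g) = \<xi> (j + g) + 2 * pi * of_int l"
        and z2: "\<zeta> (i + k - g) = \<xi> (j + (k - g)) + 2 * pi * of_int l"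
        by (simp_all add: \<zeta>_def algebra_simps)
      have e3: "\<alpha> * of_int (k - g) = \<alpha> * of_int k - \<alpha> * of_int g" by (simp add: right_diff_distrib)
      show "0 \<le> \<zeta> (i + g) - \<xi> i" "\<zeta> (i + g) - \<xi> i \<le> 2 * pi * of_int (i + g - i)"
        unfolding e1 z1 using l ord[of j g] ga unfolding abs_le_iff by linarith+
      show "0 \<le> \<xi> (i + k) - \<zeta> (i + k - g)" "\<xi> (i + k) - \<zeta> (i + k - g) \<le> 2 * pi * of_int (i + k - (i + k - g))"
        unfolding e1 z2 using l ord[of i k] ord[of j "k - g"] e3 ga unfolding abs_le_iff by linarith+
    qed
    also have "act (i + g) (i + k - g) \<zeta> = act (j + g) (j + k - g) \<xi>"
      unfolding \<zeta>_def by (subst act_shift) (simp add: algebra_simps)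
    also have "act (j + g) (j + k - g) \<xi> \<le> act j (j + k) \<xi> + 2 * B * of_int ((j + g - j) + (j + k - (j + k - g)))"
      by (rule act_le_shrink) (use kg g0 in auto)
    finally show ?thesis by (simp add: C_def)
  qed
  have block': "\<bar>act i (i + k) \<xi> - act j (j + k) \<xi>\<bar> \<le> C" if "k \<ge> 0" for i j k
    using block[OF that, of i j] block[OF that, of j i] by linarith
  define a where "a n = act 0 (int n) \<xi>" for n
  have "\<bar>a (m + n) - a m - a n\<bar> \<le> C" for m n
  proof -
    have "a (m + n) = a m + act (int m) (int m + int n) \<xi>"
      unfolding a_def using act_split[of 0 "int m" "int (m + n)" \<xi>] by simp
    then show ?thesis using block'[of "int n" "int m" 0] by (simp add: a_def)
  qed
  then have "convergent (\<lambda>n. a n / real n)" by (rule quasi_additive_converges)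
  then obtain L where L: "(\<lambda>n. a n / real n) \<longlonglongrightarrow> L" by (auto simp: convergent_def)
  have sub: "strict_mono (\<lambda>N::nat. 2 * N)" by (simp add: strict_mono_def)
  have L2: "(\<lambda>N. a (2 * N) / (2 * real N)) \<longlonglongrightarrow> L"
    using LIMSEQ_subseq_LIMSEQ[OF L sub] by (simp add: o_def)
  have "(\<lambda>N. act (- int N) (int N) \<xi> / (2 * real N) - a (2 * N) / (2 * real N)) \<longlonglongrightarrow> 0"
  proof (rule Lim_null_comparison)
    show "\<forall>\<^sub>F N in sequentially. norm (act (- int N) (int N) \<xi> / (2 * real N) - a (2 * N) / (2 * real N)) \<le> C / 2 * inverse (real N)"
    proof (intro always_eventually allI)
      fix N
      have "\<bar>act (- int N) (int N) \<xi> - a (2 * N)\<bar> \<le> C"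
        using block'[of "2 * int N" "- int N" 0] by (simp add: a_def)
      then have "\<bar>act (- int N) (int N) \<xi> - a (2 * N)\<bar> / (2 * real N) \<le> C / (2 * real N)"
        by (intro divide_right_mono) auto
      moreover have "norm (x / (2 * real N) - y / (2 * real N)) = \<bar>x - y\<bar> / (2 * real N)" for x y
        unfolding diff_divide_distrib[symmetric] real_norm_def abs_divide by simp
      moreover have "C / (2 * real N) = C / 2 * inverse (real N)" by (simp add: field_simps)
      ultimately show "norm (act (- int N) (int N) \<xi> / (2 * real N) - a (2 * N) / (2 * real N)) \<le> C / 2 * inverse (real N)"
        by metis
    qed
    show "(\<lambda>N. C / 2 * inverse (real N)) \<longlonglongrightarrow> 0"
      by (intro tendsto_mult_right_zero lim_inverse_n)
  qed
  from tendsto_add[OF this L2] show ?thesis by (auto simp: convergent_def)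
qed

text \<open>The limit exists first for an ordered minimizer. It passes to the minimizer picked by
  \<open>SOME\<close> through the comparison estimate used in both directions, each of the two being
  a competitor of the other.\<close>

lemma mather_beta_limit:
  assumes \<rho>: "0 < \<rho>" "\<rho> < 1"
  obtains \<phi> where "action_minimizing \<Omega> \<phi>" "has_rotation_number \<phi> \<rho>"
    "(\<lambda>N. act (- int N) (int N) \<phi> / (2 * real N)) \<longlonglongrightarrow> mather_beta \<Omega> \<rho>"
proof -
  define \<alpha> where "\<alpha> = 2 * pi * \<rho>"
  have \<alpha>: "0 < \<alpha>" "\<alpha> < 2 * pi" using \<rho> by (auto simp: \<alpha>_def)
  obtain \<xi> where \<xi>: "action_minimizing \<Omega> \<xi>" "\<bar>\<xi> 0\<bar> \<le> 2 * pi"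
    "\<And>i k. \<bar>\<xi> (i + k) - \<xi> i - \<alpha> * of_int k\<bar> \<le> 2 * pi"
    using ordered_minimizer[of \<rho>] \<rho> unfolding \<alpha>_def by (metis less_imp_le)
  have near\<xi>: "near_rotation \<alpha> (4 * pi) 0 \<xi>"
    unfolding near_rotation_def
  proof
    fix i
    show "\<bar>\<xi> i - \<alpha> * of_int i\<bar> \<le> 4 * pi + 0 * \<bar>of_int i\<bar>" using \<xi>(2) \<xi>(3)[of 0 i] by simp
  qed
  have rot\<xi>: "has_rotation_number \<xi> \<rho>"
    using near_rotation_imp_rotation_number near\<xi> unfolding \<alpha>_def by blast
  define \<phi> where "\<phi> = (SOME \<phi>. action_minimizing \<Omega> \<phi> \<and> has_rotation_number \<phi> \<rho>)"
  have \<phi>: "action_minimizing \<Omega> \<phi> \<and> has_rotation_number \<phi> \<rho>"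
    unfolding \<phi>_def by (rule someI[of _ \<xi>]) (use \<xi>(1) rot\<xi> in blast)
  obtain L where L: "(\<lambda>N. act (- int N) (int N) \<xi> / (2 * real N)) \<longlonglongrightarrow> L"
    using ordered_minimizer_mean_action[OF \<xi>(1) \<alpha> \<xi>(3)] by (auto simp: convergent_def)
  have "(\<lambda>N. act (- int N) (int N) \<phi> / (2 * real N) - act (- int N) (int N) \<xi> / (2 * real N)) \<longlonglongrightarrow> 0"
    unfolding tendsto_iff
  proof (intro allI impI)
    fix \<epsilon> :: real assume \<epsilon>: "\<epsilon> > 0"
    obtain \<eta> where \<eta>: "\<eta> > 0" "\<And>K. \<forall>\<^sub>F N in sequentially. almost_least \<alpha> K \<eta> \<epsilon> N"
      using minimizer_comparison[OF \<alpha> \<epsilon>] by blast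
    obtain K where K: "near_rotation \<alpha> K \<eta> \<phi>"
      using rotation_number_imp_near_rotation[of \<phi> \<rho> \<eta>] \<phi> \<eta>(1) unfolding \<alpha>_def by blast
    define K' where "K' = max K (4 * pi)"
    have near: "near_rotation \<alpha> K' \<eta> \<phi>" "near_rotation \<alpha> K' \<eta> \<xi>"
      using near_rotation_mono[OF K, of K' \<eta>] near_rotation_mono[OF near\<xi>, of K' \<eta>] \<eta>(1) by (auto simp: K'_def)
    have adm: "admissible_on UNIV \<phi>" "admissible_on UNIV \<xi>"
      using \<phi> \<xi>(1) by (auto simp: action_minimizing_def)
    show "\<forall>\<^sub>F N in sequentially. dist (act (- int N) (int N) \<phi> / (2 * real N) - act (- int N) (int N) \<xi> / (2 * real N)) 0 < \<epsilon>"
      using \<eta>(2)[of K'] eventually_gt_at_top[of 0]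
    proof eventually_elim
      case (elim N)
      have "act (- int N) (int N) \<phi> \<le> act (- int N) (int N) \<xi> + \<epsilon> * real N"
        "act (- int N) (int N) \<xi> \<le> act (- int N) (int N) \<phi> + \<epsilon> * real N"
        using elim(1) near adm \<phi> \<xi>(1) by blast+
      then have "\<bar>act (- int N) (int N) \<phi> - act (- int N) (int N) \<xi>\<bar> \<le> \<epsilon> * real N" by linarith
      also have "\<dots> < \<epsilon> * (2 * real N)" using \<epsilon> elim(2) by simp
      finally have "\<bar>act (- int N) (int N) \<phi> - act (- int N) (int N) \<xi>\<bar> / (2 * real N) < \<epsilon>"
        using elim(2) by (simp add: pos_divide_less_eq)
      then show ?case by (simp add: dist_real_def diff_divide_distrib[symmetric])
    qed
  qed
  from tendsto_add[OF this L]
  have lim: "(\<lambda>N. act (- int N) (int N) \<phi> / (2 * real N)) \<longlonglongrightarrow> L" by simp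
  have "mather_beta \<Omega> \<rho> = L"
    unfolding mather_beta_def using \<rho> limI[OF lim] by (simp add: \<phi>_def Let_def)
  then show ?thesis using that \<phi> lim by blast
qed

end

section \<open>Upper bound for the beta function by averaging\<close>

context support_param
begin

text \<open>For each x the sequence b(x + 2 pi \<rho> i) is a competitor. Integrated over x, every
  term of its action contributes the same integral by periodicity, whatever the arithmetic of
  \<rho>. Only the increments of b over 2 pi \<rho> are constrained, so small continuous periodic
  perturbations of the identity qualify.\<close>

lemma mather_beta_le_average:
  assumes \<rho>: "0 < \<rho>" "\<rho> < 1"
    and b: "continuous_on UNIV b" "\<And>x. b (x + 2 * pi) = b x + 2 * pi"
      "\<And>x. 0 \<le> b (x + 2 * pi * \<rho>) - b x" "\<And>x. b (x + 2 * pi * \<rho>) - b x \<le> 2 * pi"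
      "\<And>x. \<bar>b x - x\<bar> \<le> K"
  shows "mather_beta \<Omega> \<rho> \<le> integral {0..2 * pi} (\<lambda>x. S (b x) (b (x + 2 * pi * \<rho>))) / (2 * pi)"
proof -
  define \<alpha> where "\<alpha> = 2 * pi * \<rho>"
  have \<alpha>: "0 < \<alpha>" "\<alpha> < 2 * pi" using \<rho> by (auto simp: \<alpha>_def)
  define I where "I = integral {0..2 * pi} (\<lambda>x. S (b x) (b (x + \<alpha>)))"
  obtain \<phi> where \<phi>: "action_minimizing \<Omega> \<phi>" "has_rotation_number \<phi> \<rho>"
    "(\<lambda>N. act (- int N) (int N) \<phi> / (2 * real N)) \<longlonglongrightarrow> mather_beta \<Omega> \<rho>"
    using mather_beta_limit[OF \<rho>] by blast
  define F where "F x = S (b x) (b (x + \<alpha>))" for x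
  have bc: "continuous_on A (\<lambda>x. b (x + c))" for A c
    by (rule continuous_on_compose2[OF b(1)]) (auto intro!: continuous_intros)
  have Fc: "continuous_on UNIV F" unfolding F_def using bc[of UNIV 0] bc by (intro S_continuous) auto
  have If: "I = integral {0..2 * pi} F" unfolding I_def F_def[abs_def] ..
  have Fper: "F (x + 2 * pi) = F x" for x
  proof -
    have e: "x + 2 * pi + \<alpha> = x + \<alpha> + 2 * pi" by simp
    show ?thesis unfolding F_def e b(2) using S_shift[of "b x" 1 "b (x + \<alpha>)"] by simp
  qed
  have "mather_beta \<Omega> \<rho> \<le> I / (2 * pi) + \<epsilon>" if \<epsilon>: "\<epsilon> > 0" for \<epsilon>
  proof -
    obtain \<eta> where \<eta>: "\<eta> > 0" "\<And>K. \<forall>\<^sub>F N in sequentially. almost_least \<alpha> K \<eta> \<epsilon> N"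
      using minimizer_comparison[OF \<alpha> \<epsilon>] by blast
    obtain K1 where K1: "near_rotation \<alpha> K1 \<eta> \<phi>"
      using rotation_number_imp_near_rotation[of \<phi> \<rho> \<eta>] \<phi> \<eta>(1) unfolding \<alpha>_def by blast
    define K' where "K' = max K1 (K + 2 * pi)"
    have near\<phi>: "near_rotation \<alpha> K' \<eta> \<phi>" by (rule near_rotation_mono[OF K1]) (auto simp: K'_def)
    have "\<forall>\<^sub>F N in sequentially. act (- int N) (int N) \<phi> / (2 * real N) \<le> I / (2 * pi) + \<epsilon>"
      using \<eta>(2)[of K'] eventually_gt_at_top[of 0]
    proof eventually_elim
      case (elim N)
      define \<xi> where "\<xi> x i = b (x + \<alpha> * of_int i)" for x and i :: int
      have step: "\<xi> x (i + 1) = b (x + \<alpha> * of_int i + \<alpha>)" for x i by (simp add: \<xi>_def algebra_simps)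
      have le: "act (- int N) (int N) \<phi> \<le> act (- int N) (int N) (\<xi> x) + \<epsilon> * real N" if x: "x \<in> {0..2 * pi}" for x
      proof -
        have "admissible_on UNIV (\<xi> x)"
          unfolding admissible_on_def step unfolding \<xi>_def \<alpha>_def using b(3,4) by blast
        moreover have "near_rotation \<alpha> K' \<eta> (\<xi> x)"
        proof (rule near_rotation_mono)
          show "near_rotation \<alpha> (K + 2 * pi) 0 (\<xi> x)"
            unfolding near_rotation_def
          proof
            fix i
            show "\<bar>\<xi> x i - \<alpha> * of_int i\<bar> \<le> K + 2 * pi + 0 * \<bar>of_int i\<bar>"
              using b(5)[of "x + \<alpha> * of_int i"] x unfolding \<xi>_def abs_le_iff mult_zero_left atLeastAtMost_iff
              by linarith
          qed
        qed (use \<eta>(1) in \<open>auto simp: K'_def\<close>)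
        ultimately show ?thesis using elim(1) near\<phi> \<phi>(1) by blast
      qed
      have actF: "act (- int N) (int N) (\<xi> x) = (\<Sum>i\<in>{- int N..<int N}. F (x + \<alpha> * of_int i))" for x
        unfolding action_def step unfolding \<xi>_def F_def ..
      have shiftc: "continuous_on {0..2 * pi} (\<lambda>x. F (x + \<alpha> * of_int i))" for i
        by (rule continuous_on_compose2[OF Fc]) (auto intro!: continuous_intros)
      have "((\<lambda>x. F (x + \<alpha> * of_int i)) has_integral I) {0..2 * pi}" for i
      proof -
        have e: "integral {0..2 * pi} (\<lambda>x. F (x + \<alpha> * of_int i)) = I"
          using periodic_integral_shift[OF Fc Fper] If by (rule trans[OF _ sym])
        show ?thesis
          by (rule has_integral_eq_rhs[OF integrable_integral[OF integrable_continuous_real[OF shiftc[of i]]] e[symmetric]])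
      qed
      then have "((\<lambda>x. \<Sum>i\<in>{- int N..<int N}. F (x + \<alpha> * of_int i)) has_integral (\<Sum>i\<in>{- int N..<int N}. I)) {0..2 * pi}"
        by (intro has_integral_sum) simp_all
      moreover have "((\<lambda>x::real. \<epsilon> * real N) has_integral (2 * pi - 0) *\<^sub>R (\<epsilon> * real N)) {0..2 * pi}"
        using has_integral_const_real[of "\<epsilon> * real N" 0 "2 * pi"] by simp
      ultimately have 1: "((\<lambda>x. act (- int N) (int N) (\<xi> x) + \<epsilon> * real N) has_integral
          (\<Sum>i\<in>{- int N..<int N}. I) + (2 * pi - 0) *\<^sub>R (\<epsilon> * real N)) {0..2 * pi}"
        unfolding actF by (rule has_integral_add)
      have 2: "((\<lambda>x::real. act (- int N) (int N) \<phi>) has_integral (2 * pi - 0) *\<^sub>R act (- int N) (int N) \<phi>) {0..2 * pi}"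
        using has_integral_const_real[of "act (- int N) (int N) \<phi>" 0 "2 * pi"] by simp
      have "(2 * pi - 0) *\<^sub>R act (- int N) (int N) \<phi> \<le> (\<Sum>i\<in>{- int N..<int N}. I) + (2 * pi - 0) *\<^sub>R (\<epsilon> * real N)"
        using has_integral_le[OF 2 1] le by blast
      then have "2 * pi * act (- int N) (int N) \<phi> \<le> 2 * real N * I + 2 * pi * (\<epsilon> * real N)" by simp
      then have "act (- int N) (int N) \<phi> \<le> (2 * real N * I + 2 * pi * (\<epsilon> * real N)) / (2 * pi)"
        by (simp add: pos_le_divide_eq mult.commute)
      also have "\<dots> = 2 * real N * (I / (2 * pi)) + \<epsilon> * real N" by (simp add: field_simps)
      also have "\<dots> \<le> (I / (2 * pi) + \<epsilon>) * (2 * real N)" using \<epsilon> by (simp add: algebra_simps)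
      finally show ?case using elim(2) by (simp add: pos_divide_le_eq)
    qed
    then show ?thesis using \<phi>(3) by (intro tendsto_upperbound[OF \<phi>(3)]) auto
  qed
  then have "mather_beta \<Omega> \<rho> \<le> I / (2 * pi)" by (rule field_le_epsilon)
  then show ?thesis by (simp add: I_def \<alpha>_def)
qed

end

section \<open>First variation and the unit disk\<close>

lemma periodic_reduce:
  fixes f :: "real \<Rightarrow> real"
  assumes "\<And>x. f (x + 2 * pi) = f x"
  obtains y where "y \<in> {0..2 * pi}" "f x = f y"
proof
  define k where "k = \<lfloor>x / (2 * pi)\<rfloor>"
  show "x - 2 * pi * of_int k \<in> {0..2 * pi}" using floor_two_pi[of x] by (simp add: k_def)
  show "f x = f (x - 2 * pi * of_int k)"
    using shift_int_multiple[of f "2 * pi" 0 "x - 2 * pi * of_int k" k] assms by (simp add: mult.commute)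
qed

lemma periodic_square_integral_0:
  fixes f :: "real \<Rightarrow> real"
  assumes cont: "continuous_on UNIV f" and per: "\<And>x. f (x + 2 * pi) = f x"
    and int: "((\<lambda>x. f x * f x) has_integral 0) {0..2 * pi}"
  shows "f x = 0"
proof -
  obtain y where y: "y \<in> {0..2 * pi}" "f x = f y" using periodic_reduce[of f x] per by blast
  have c: "continuous_on {0..2 * pi} (\<lambda>x. f x * f x)"
    by (intro continuous_on_mult continuous_on_subset[OF cont]) auto
  have "f y * f y = 0"
  proof (rule has_integral_0_cbox_imp_0[of 0 "2 * pi" "\<lambda>x. f x * f x"])
    show "box 0 (2 * pi) \<noteq> {}" unfolding box_ne_empty by simp
    show "continuous_on (cbox 0 (2 * pi)) (\<lambda>x. f x * f x)" using c by (simp add: cbox_interval)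
    show "((\<lambda>x. f x * f x) has_integral 0) (cbox 0 (2 * pi))" using int by (simp add: cbox_interval)
    show "y \<in> cbox 0 (2 * pi)" using y(1) by (simp add: cbox_interval)
  qed simp
  then show ?thesis using y by simp
qed

text \<open>Concavity of the sine on [0, pi], in the tangent form whose sum along a configuration
  telescopes.\<close>

lemma sin_le_tangent:
  assumes "0 \<le> a" "a \<le> pi" "0 \<le> u" "u \<le> pi"
  shows "sin u \<le> sin a + cos a * (u - a)"
proof -
  define f where "f u = sin a + cos a * (u - a) - sin u" for u
  have d: "(f has_real_derivative cos a - cos u) (at u)" for u
    unfolding f_def[abs_def] by (auto intro!: derivative_eq_intros)
  have "f u \<ge> f a"
  proof (cases "a \<le> u")
    case True
    show ?thesis
    proof (rule DERIV_nonneg_imp_nondecreasing[OF True])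
      fix x assume "a \<le> x" "x \<le> u"
      then have "cos x \<le> cos a" using assms by (intro cos_monotone_0_pi_le) auto
      then show "\<exists>y. (f has_real_derivative y) (at x) \<and> 0 \<le> y" using d[of x] by auto
    qed
  next
    case False
    then have ua: "u \<le> a" by simp
    show ?thesis
    proof (rule DERIV_nonpos_imp_nonincreasing[OF ua])
      fix x assume "u \<le> x" "x \<le> a"
      then have "cos a \<le> cos x" using assms by (intro cos_monotone_0_pi_le) auto
      then show "\<exists>y. (f has_real_derivative y) (at x) \<and> y \<le> 0" using d[of x] by auto
    qed
  qed
  then show ?thesis by (simp add: f_def)
qed

context support_param
begin

text \<open>For the table this is the perimeter over 2 pi, by Cauchy's formula.\<close>

abbreviation mean_support where
  "mean_support \<equiv> integral {0..2 * pi} (\<lambda>s. inner (z s) (cis s)) / (2 * pi)"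

lemma support_continuous: "continuous_on A (\<lambda>s. inner (z s) (cis s))"
  by (intro continuous_on_inner z_continuous continuous_on_cis continuous_on_id)

lemma average_rigid_rotation:
  "integral {0..2 * pi} (\<lambda>x. S x (x + 2 * pi * \<rho>)) / (2 * pi) = - 2 * sin (pi * \<rho>) * mean_support"
proof -
  have e: "S x (x + 2 * pi * \<rho>) = - 2 * sin (pi * \<rho>) * inner (z (x + pi * \<rho>)) (cis (x + pi * \<rho>))" for x
  proof -
    have e: "(x + (x + 2 * pi * \<rho>)) / 2 = x + pi * \<rho>" "(x + 2 * pi * \<rho> - x) / 2 = pi * \<rho>" by (simp_all add: field_simps)
    show ?thesis unfolding S_eq e by simp
  qed
  have per: "inner (z (x + 2 * pi)) (cis (x + 2 * pi)) = inner (z x) (cis x)" for x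
    by (simp add: z_periodic flip: cis_mult)
  show ?thesis
    unfolding e integral_mult_right
    using periodic_integral_shift[OF support_continuous per, of "pi * \<rho>"] by simp
qed

lemma mather_beta_le_mean_support:
  assumes \<rho>: "0 < \<rho>" "\<rho> < 1"
  shows "mather_beta \<Omega> \<rho> \<le> - 2 * sin (pi * \<rho>) * mean_support"
proof -
  have "mather_beta \<Omega> \<rho> \<le> integral {0..2 * pi} (\<lambda>x. S x (x + 2 * pi * \<rho>)) / (2 * pi)"
    by (rule mather_beta_le_average[OF \<rho>, of "\<lambda>x. x" 0]) (use \<rho> in auto)
  then show ?thesis unfolding average_rigid_rotation .
qed

text \<open>Perturb the rigid rotations by the Euler--Lagrange expression \<open>e\<close> itself: the first variation of
  the average action is then the integral of \<open>e\<^sup>2\<close>.\<close>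

lemma euler_lagrange_of_equality:
  assumes \<rho>: "0 < \<rho>" "\<rho> < 1"
    and eq: "mather_beta \<Omega> \<rho> = - 2 * sin (pi * \<rho>) * mean_support"
  shows "inner (z (u + pi * \<rho>) - z (u - pi * \<rho>)) (cis u) = 0"
proof -
  define a where "a = pi * \<rho>"
  define \<alpha> where "\<alpha> = 2 * pi * \<rho>"
  have \<alpha>a: "\<alpha> = 2 * a" by (simp add: a_def \<alpha>_def)
  have \<alpha>: "0 < \<alpha>" "\<alpha> < 2 * pi" using \<rho> by (auto simp: \<alpha>_def)
  define e where "e x = inner (z (x + a) - z (x - a)) (cis x)" for x
  have zc: "continuous_on A (\<lambda>x. z (x + c))" for A c
    by (rule continuous_on_compose2[OF z_continuous[of UNIV]]) (auto intro!: continuous_intros)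
  have zcm: "continuous_on A (\<lambda>x. z (x - c))" for A c
    by (rule continuous_on_compose2[OF z_continuous[of UNIV]]) (auto intro!: continuous_intros)
  have ec: "continuous_on UNIV e" unfolding e_def
    by (intro continuous_on_inner continuous_on_diff zc zcm continuous_on_cis continuous_on_id)
  have zper: "z (x + 2 * pi + c) = z (x + c)" "z (x + 2 * pi - c) = z (x - c)" for x c
    using z_periodic[of "x + c"] z_periodic[of "x - c"] by (simp_all add: algebra_simps)
  have eper: "e (x + 2 * pi) = e x" for x unfolding e_def zper by (simp flip: cis_mult)
  have ebd: "\<bar>e x\<bar> \<le> 2 * B" for x
  proof -
    have "\<bar>e x\<bar> \<le> norm (z (x + a) - z (x - a)) * norm (cis x)" unfolding e_def by (rule Cauchy_Schwarz_ineq2)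
    also have "\<dots> \<le> norm (z (x + a)) + norm (z (x - a))" using norm_triangle_ineq4[of "z (x + a)" "z (x - a)"] by simp
    finally show ?thesis using z_bound[of "x + a"] z_bound[of "x - a"] by linarith
  qed
  define b where "b t x = x + t * e x" for t x
  define E where "E t = integral {0..2 * pi} (\<lambda>x. S (b t x) (b t (x + \<alpha>)))" for t
  define \<mu> where "\<mu> = min \<alpha> (2 * pi - \<alpha>)"
  have \<mu>: "\<mu> > 0" "\<mu> \<le> \<alpha>" "\<mu> \<le> 2 * pi - \<alpha>" using \<alpha> by (auto simp: \<mu>_def)
  have B: "B \<ge> 0" by (rule B_nonneg)
  \<comment> \<open>Chosen so that |t e| <= \<mu>/2, which keeps the increments \<alpha> + t (e(x +
    \<alpha>) - e(x)) within [0, 2 pi]. The summand 1 covers B = 0.\<close>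
  define \<delta> where "\<delta> = \<mu> / (4 * B + 1)"
  have \<delta>: "\<delta> > 0" using \<mu> B by (simp add: \<delta>_def)
  have min0: "E 0 \<le> E t" if t: "\<bar>t\<bar> < \<delta>" for t
  proof -
    have small: "\<bar>t * e x\<bar> \<le> \<mu> / 2" for x
    proof -
      have "\<bar>t * e x\<bar> \<le> \<delta> * (2 * B)" unfolding abs_mult using t ebd[of x] by (intro mult_mono) auto
      also have "\<dots> \<le> \<mu> / 2" using \<mu> B by (simp add: \<delta>_def field_simps)
      finally show ?thesis .
    qed
    have bper: "b t (x + 2 * pi) = b t x + 2 * pi" for x by (simp add: b_def eper)
    have "mather_beta \<Omega> \<rho> \<le> integral {0..2 * pi} (\<lambda>x. S (b t x) (b t (x + 2 * pi * \<rho>))) / (2 * pi)"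
    proof (rule mather_beta_le_average[OF \<rho>, of _ "\<mu> / 2"])
      show "continuous_on UNIV (b t)" unfolding b_def[abs_def] by (intro continuous_intros ec)
      show "0 \<le> b t (x + 2 * pi * \<rho>) - b t x" "b t (x + 2 * pi * \<rho>) - b t x \<le> 2 * pi" for x
        unfolding \<alpha>_def[symmetric] b_def using small[of x] small[of "x + \<alpha>"] \<mu> unfolding abs_le_iff by linarith+
      show "\<bar>b t x - x\<bar> \<le> \<mu> / 2" for x using small[of x] by (simp add: b_def)
    qed (rule bper)
    moreover have "mather_beta \<Omega> \<rho> = E 0 / (2 * pi)"
      unfolding eq average_rigid_rotation[symmetric] E_def b_def \<alpha>_def by simp
    ultimately have "E 0 / (2 * pi) \<le> E t / (2 * pi)" unfolding E_def \<alpha>_def by simp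
    then show ?thesis by (simp add: divide_le_cancel)
  qed
  define m where "m t x = (b t x + b t (x + \<alpha>)) / 2" for t x
  define D where "D t x = inner (z (m t x)) (cis (b t x)) * e x - inner (z (m t x)) (cis (b t (x + \<alpha>))) * e (x + \<alpha>)" for t x
  have ec2: "continuous_on A (\<lambda>p. e (f p))" if "continuous_on A f" for A and f :: "real \<times> real \<Rightarrow> real"
    by (rule continuous_on_compose2[OF ec that]) simp
  have "(E has_real_derivative integral (cbox 0 (2 * pi)) (D 0)) (at 0 within UNIV)"
    unfolding E_def interval_cbox
  proof (rule leibniz_rule_field_derivative)
    show "((\<lambda>t. S (b t x) (b t (x + \<alpha>))) has_real_derivative D t x) (at t within UNIV)" for t x
      unfolding D_def m_def
      by (rule S_has_derivative) (auto simp: b_def intro!: derivative_eq_intros)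
    show "(\<lambda>x. S (b t x) (b t (x + \<alpha>))) integrable_on cbox 0 (2 * pi)" for t
    proof (intro integrable_continuous S_continuous)
      show "continuous_on (cbox 0 (2 * pi)) (b t)" unfolding b_def[abs_def]
        by (intro continuous_intros continuous_on_subset[OF ec]) auto
      show "continuous_on (cbox 0 (2 * pi)) (\<lambda>x. b t (x + \<alpha>))" unfolding b_def[abs_def]
        by (intro continuous_intros continuous_on_compose2[OF ec]) auto
    qed
    have bc: "continuous_on A (\<lambda>p. b (fst p) (snd p))" "continuous_on A (\<lambda>p. b (fst p) (snd p + \<alpha>))" for A :: "(real \<times> real) set"
      unfolding b_def by (intro continuous_intros ec2)+
    have "continuous_on A (\<lambda>p. D (fst p) (snd p))" for A :: "(real \<times> real) set"
      unfolding D_def m_def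
      by (intro continuous_on_diff continuous_on_mult continuous_on_inner continuous_on_cis bc ec2 continuous_intros
          continuous_on_compose2[OF z_continuous[of UNIV]]) auto
    then show "continuous_on (UNIV \<times> cbox 0 (2 * pi)) (\<lambda>(t, x). D t x)" by (simp add: case_prod_beta)
  qed auto
  then have "(E has_real_derivative integral {0..2 * pi} (D 0)) (at 0)" by (simp only: interval_cbox)
  then have D0: "integral {0..2 * pi} (D 0) = 0"
    using DERIV_local_min[of E _ 0 \<delta>] \<delta> min0 by (auto simp: abs_minus_commute)
  \<comment> \<open>Summation by parts: e(x + \<alpha>) occurs only in f2(x + \<alpha>), and
    shifting that integral by \<alpha> pairs both terms with the same e(x), leaving the integral of
    its square.\<close>
  define f1 where "f1 x = inner (z (x + a)) (cis x) * e x" for x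
  define f2 where "f2 x = inner (z (x - a)) (cis x) * e x" for x
  have Deq: "D 0 x = f1 x - f2 (x + \<alpha>)" for x
  proof -
    have "m 0 x = x + a" "x + \<alpha> - a = x + a" "b 0 y = y" for y by (simp_all add: m_def b_def \<alpha>a)
    then show ?thesis unfolding D_def f1_def f2_def by (simp only:)
  qed
  have f1c: "continuous_on A f1" for A unfolding f1_def
    by (intro continuous_on_mult continuous_on_inner zc continuous_on_cis continuous_on_id continuous_on_subset[OF ec]) auto
  have f2c: "continuous_on A f2" for A unfolding f2_def
    by (intro continuous_on_mult continuous_on_inner zcm continuous_on_cis continuous_on_id continuous_on_subset[OF ec]) auto
  have f2per: "f2 (x + 2 * pi) = f2 x" for x unfolding f2_def zper eper by (simp flip: cis_mult)
  have f2s: "continuous_on {0..2 * pi} (\<lambda>x. f2 (x + \<alpha>))"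
    by (rule continuous_on_compose2[OF f2c[of UNIV]]) (auto intro!: continuous_intros)
  have "integral {0..2 * pi} (D 0) = integral {0..2 * pi} f1 - integral {0..2 * pi} (\<lambda>x. f2 (x + \<alpha>))"
    unfolding Deq by (rule integral_diff[OF integrable_continuous_real[OF f1c] integrable_continuous_real[OF f2s]])
  also have "\<dots> = integral {0..2 * pi} f1 - integral {0..2 * pi} f2"
    unfolding periodic_integral_shift[OF f2c f2per] ..
  also have "\<dots> = integral {0..2 * pi} (\<lambda>x. f1 x - f2 x)"
    by (rule integral_diff[OF integrable_continuous_real[OF f1c] integrable_continuous_real[OF f2c], symmetric])
  also have "(\<lambda>x. f1 x - f2 x) = (\<lambda>x. e x * e x)"
    by (simp add: f1_def f2_def e_def inner_diff_left left_diff_distrib)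
  finally have "integral {0..2 * pi} (\<lambda>x. e x * e x) = 0" using D0 by simp
  moreover have "(\<lambda>x. e x * e x) integrable_on {0..2 * pi}"
    by (intro integrable_continuous_real continuous_on_mult continuous_on_subset[OF ec]) auto
  ultimately have "((\<lambda>x. e x * e x) has_integral 0) {0..2 * pi}" by (metis integrable_integral)
  then have "e u = 0" by (rule periodic_square_integral_0[OF ec eper])
  then show ?thesis by (simp add: e_def a_def)
qed

end

section \<open>The beta function of the unit disk\<close>

lemma support_function_unit_ball: "support_function (ball 0 1) s = 1"
proof -
  have "support_function (ball 0 1) s = inner (cis s) (cis s)"
  proof (rule support_function_eq)
    show "cis s \<in> closure (ball 0 1)" by simp
    fix p :: complex assume "p \<in> closure (ball 0 1)"
    then have "norm p \<le> 1" by simp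
    moreover have "inner p (cis s) \<le> norm p * norm (cis s)" by (rule norm_cauchy_schwarz)
    ultimately show "inner p (cis s) \<le> inner (cis s) (cis s)" by (simp add: inner_cis_cis)
  qed
  then show ?thesis by (simp add: inner_cis_cis)
qed

interpretation unit_disk: support_param "ball 0 1" cis "\<lambda>_. 1" 1
proof
  show "(cis has_vector_derivative 1 *\<^sub>R (\<i> * cis s)) (at s)" for s
    using cis_has_vector_derivative[OF DERIV_ident] by simp
qed (simp_all add: support_function_unit_ball inner_cis_cis flip: cis_mult)

lemma sum_telescope_int:
  fixes \<phi> :: "int \<Rightarrow> real"
  assumes "m \<le> n"
  shows "(\<Sum>i\<in>{m..<n}. \<phi> (i + 1) - \<phi> i) = \<phi> n - \<phi> m"
  using assms
proof (induction n rule: int_ge_induct)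
  case (step n)
  have "{m..<n + 1} = insert n {m..<n}" using step(1) by auto
  then show ?case using step by simp
qed simp

text \<open>The upper bound is the general one with mean support 1. For the lower bound the tangent
  to the sine at a = pi \<rho> bounds each term of the action by an affine function of the
  increment; the sum telescopes, and the rotation number fixes the total increment up to
  o(N).\<close>

lemma mather_beta_unit_disk:
  assumes \<rho>: "0 < \<rho>" "\<rho> < 1"
  shows "mather_beta (ball 0 1) \<rho> = - 2 * sin (pi * \<rho>)"
proof (rule antisym)
  have "integral {0..2 * pi} (\<lambda>s. inner (cis s) (cis s)) / (2 * pi) = 1" by (simp add: inner_cis_cis)
  then show "mather_beta (ball 0 1) \<rho> \<le> - 2 * sin (pi * \<rho>)"
    using unit_disk.mather_beta_le_mean_support[OF \<rho>] by simp
  define a where "a = pi * \<rho>"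
  have a: "0 \<le> a" "a \<le> pi" using \<rho> by (auto simp: a_def)
  obtain \<phi> where \<phi>: "action_minimizing (ball 0 1) \<phi>" "has_rotation_number \<phi> \<rho>"
    "(\<lambda>N. action (ball 0 1) (- int N) (int N) \<phi> / (2 * real N)) \<longlonglongrightarrow> mather_beta (ball 0 1) \<rho>"
    using unit_disk.mather_beta_limit[OF \<rho>] by blast
  have adm: "0 \<le> \<phi> (i + 1) - \<phi> i" "\<phi> (i + 1) - \<phi> i \<le> 2 * pi" for i
    using \<phi>(1) by (auto simp: action_minimizing_def admissible_on_def)
  have S: "billiard_gen (ball 0 1) (\<phi> i) (\<phi> (i + 1)) \<ge> - 2 * sin a - cos a * (\<phi> (i + 1) - \<phi> i - 2 * a)" for i
  proof -
    have "sin ((\<phi> (i + 1) - \<phi> i) / 2) \<le> sin a + cos a * ((\<phi> (i + 1) - \<phi> i) / 2 - a)"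
      using adm[of i] a by (intro sin_le_tangent) auto
    moreover have "2 * (cos a * ((\<phi> (i + 1) - \<phi> i) / 2 - a)) = cos a * (\<phi> (i + 1) - \<phi> i - 2 * a)"
      by (simp add: field_simps)
    ultimately show ?thesis unfolding billiard_gen_def support_function_unit_ball by linarith
  qed
  have act: "action (ball 0 1) (- int N) (int N) \<phi> \<ge> 2 * real N * (- 2 * sin a) - cos a * (\<phi> (int N) - \<phi> (- int N) - 2 * real N * (2 * a))" for N
  proof -
    define d where "d i = \<phi> (i + 1) - \<phi> i" for i
    have d: "(\<Sum>i\<in>{- int N..<int N}. d i) = \<phi> (int N) - \<phi> (- int N)"
      unfolding d_def by (rule sum_telescope_int) simp
    have "(\<Sum>i\<in>{- int N..<int N}. - 2 * sin a - cos a * (d i - 2 * a)) \<le> action (ball 0 1) (- int N) (int N) \<phi>"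
      unfolding action_def d_def by (intro sum_mono S)
    moreover have "(\<Sum>i\<in>{- int N..<int N}. - 2 * sin a - cos a * (d i - 2 * a)) =
       2 * real N * (- 2 * sin a) - cos a * (\<phi> (int N) - \<phi> (- int N) - 2 * real N * (2 * a))"
      unfolding sum_subtractf sum_distrib_left[symmetric] d by simp
    ultimately show ?thesis by simp
  qed
  have "- 2 * sin a \<le> mather_beta (ball 0 1) \<rho> + \<epsilon>" if \<epsilon>: "\<epsilon> > 0" for \<epsilon>
  proof -
    have e2: "\<epsilon> / 2 > 0" using \<epsilon> by simp
    obtain K where K: "near_rotation (2 * pi * \<rho>) K (\<epsilon> / 2) \<phi>"
      using rotation_number_imp_near_rotation[OF \<phi>(2) e2] by blast
    obtain N0 :: nat where N0: "real N0 > 2 * \<bar>K\<bar> / \<epsilon>" using reals_Archimedean2 by blast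
    have "\<forall>\<^sub>F N in sequentially. - 2 * sin a - \<epsilon> \<le> action (ball 0 1) (- int N) (int N) \<phi> / (2 * real N)"
      using eventually_gt_at_top[of N0]
    proof eventually_elim
      case (elim N)
      have N: "real N > 0" "2 * \<bar>K\<bar> / \<epsilon> \<le> real N" using elim N0 by auto
      then have NK: "2 * \<bar>K\<bar> \<le> \<epsilon> * real N" using \<epsilon> by (simp add: pos_divide_le_eq mult.commute)
      have k: "\<bar>\<phi> (int N) - 2 * a * real N\<bar> \<le> K + \<epsilon> / 2 * real N" "\<bar>\<phi> (- int N) + 2 * a * real N\<bar> \<le> K + \<epsilon> / 2 * real N"
        using spec[OF K[unfolded near_rotation_def], of "int N"] spec[OF K[unfolded near_rotation_def], of "- int N"]
        by (simp_all add: a_def mult.assoc)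
      define d where "d = \<phi> (int N) - \<phi> (- int N) - 2 * real N * (2 * a)"
      have "2 * real N * (2 * a) = 2 * a * real N + 2 * a * real N" by simp
      then have "\<bar>d\<bar> \<le> 2 * K + \<epsilon> * real N" using k unfolding d_def abs_le_iff by linarith
      moreover have "2 * K \<le> 2 * \<bar>K\<bar>" by simp
      ultimately have "\<bar>d\<bar> \<le> 2 * (\<epsilon> * real N)" using NK by linarith
      moreover have "cos a * d \<le> \<bar>d\<bar>"
      proof -
        have "cos a * d \<le> \<bar>cos a\<bar> * \<bar>d\<bar>" unfolding abs_mult[symmetric] by (rule abs_ge_self)
        also have "\<dots> \<le> 1 * \<bar>d\<bar>" by (intro mult_right_mono) auto
        finally show ?thesis by simp
      qed
      ultimately have "2 * real N * (- 2 * sin a) - 2 * (\<epsilon> * real N) \<le> action (ball 0 1) (- int N) (int N) \<phi>"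
        using act[of N] unfolding d_def by linarith
      then have "(- 2 * sin a - \<epsilon>) * (2 * real N) \<le> action (ball 0 1) (- int N) (int N) \<phi>"
        by (simp add: algebra_simps)
      then show ?case using N(1) by (simp add: pos_le_divide_eq)
    qed
    then have "- 2 * sin a - \<epsilon> \<le> mather_beta (ball 0 1) \<rho>" by (rule tendsto_lowerbound[OF \<phi>(3)]) simp
    then show ?thesis by simp
  qed
  then show "- 2 * sin (pi * \<rho>) \<le> mather_beta (ball 0 1) \<rho>" unfolding a_def[symmetric] by (rule field_le_epsilon)
qed

section \<open>Fourier coefficients\<close>

text \<open>On the circle a real polynomial is a Laurent polynomial in \<open>cis x\<close>; the
  power N clears the negative exponents.\<close>

lemma trig_polynomial_of_real_polynomial_function:
  assumes "real_polynomial_function (f :: complex \<Rightarrow> real)"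
  obtains N Q where "\<And>x. of_real (f (cis x)) * cis x ^ N = poly Q (cis x)"
proof -
  have "\<exists>N Q. \<forall>x. of_real (f (cis x)) * cis x ^ N = poly Q (cis x)"
    using assms
  proof (induction f rule: real_polynomial_function.induct)
    case (linear f)
    then interpret bounded_linear f .
    \<comment> \<open>A real linear form is f(cis x) = Re (2 w cis x), that is w cis x plus its
      conjugate.\<close>
    define w where "w = (of_real (f 1) - \<i> * of_real (f \<i>)) / 2"
    have "of_real (f (cis x)) * cis x ^ 1 = poly [:cnj w, 0, w:] (cis x)" for x
    proof -
      have "cis x = cos x *\<^sub>R 1 + sin x *\<^sub>R \<i>" by (simp add: complex_eq_iff)
      then have "f (cis x) = f (cos x *\<^sub>R 1 + sin x *\<^sub>R \<i>)" by simp
      then have e: "f (cis x) = cos x * f 1 + sin x * f \<i>" by (simp only: add scaleR real_scaleR_def)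
      have "complex_of_real (f (cis x)) = w * cis x + cnj w * cnj (cis x)"
        unfolding e by (simp add: complex_eq_iff w_def field_simps)
      moreover have "cnj (cis x) * cis x = 1" by (simp add: cis_cnj flip: cis_inverse)
      ultimately show ?thesis by (simp add: algebra_simps)
    qed
    then show ?case by blast
  next
    case (const c)
    have "of_real c * cis x ^ 0 = poly [:of_real c:] (cis x)" for x by simp
    then show ?case by blast
  next
    case (add f g)
    then obtain N P M Q where
      "\<And>x. of_real (f (cis x)) * cis x ^ N = poly P (cis x)"
      "\<And>x. of_real (g (cis x)) * cis x ^ M = poly Q (cis x)" by blast
    then have "of_real (f (cis x) + g (cis x)) * cis x ^ (N + M) = poly (P * monom 1 M + Q * monom 1 N) (cis x)" for x
      by (simp add: poly_monom power_add algebra_simps flip: \<open>\<And>x. of_real (f (cis x)) * cis x ^ N = poly P (cis x)\<close>)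
    then show ?case by blast
  next
    case (mult f g)
    then obtain N P M Q where
      1: "\<And>x. of_real (f (cis x)) * cis x ^ N = poly P (cis x)"
      "\<And>x. of_real (g (cis x)) * cis x ^ M = poly Q (cis x)" by blast
    have "of_real (f (cis x) * g (cis x)) * cis x ^ (N + M) = poly (P * Q) (cis x)" for x
      by (simp add: power_add flip: 1)
    then show ?case by blast
  qed
  then show ?thesis using that by blast
qed

lemma cis_times_cis_power: "cis (- (real N * x)) * cis x ^ N = 1"
proof -
  have "cis x ^ N = cis (real N * x)" by (rule Complex.DeMoivre)
  then show ?thesis by (simp add: cis_mult)
qed

text \<open>Vanishing coefficients make g orthogonal to all polynomials restricted to the circle.
  Stone-Weierstrass gives one within e of g, so the integral of g^2 is at most e times that of |g|.
  Taking G on the circle provides the compact domain.\<close>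

lemma fourier_uniqueness:
  fixes G :: "complex \<Rightarrow> real"
  assumes cont: "continuous_on (sphere 0 1) G"
    and coef: "\<And>k::int. ((\<lambda>x. of_real (G (cis x)) * cis (of_int k * x)) has_integral 0) {0..2 * pi}"
  shows "G (cis x) = 0"
proof -
  define g where "g x = G (cis x)" for x
  have gc: "continuous_on A g" for A
    unfolding g_def by (rule continuous_on_compose2[OF cont]) (auto intro!: continuous_on_cis continuous_on_id)
  have gper: "g (x + 2 * pi) = g x" for x by (simp add: g_def flip: cis_mult)
  have orth: "((\<lambda>x. g x * f (cis x)) has_integral 0) {0..2 * pi}" if f: "real_polynomial_function f" for f :: "complex \<Rightarrow> real"
  proof -
    obtain N Q where Q: "\<And>x. of_real (f (cis x)) * cis x ^ N = poly Q (cis x)"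
      using trig_polynomial_of_real_polynomial_function[OF f] by blast
    have summand: "((\<lambda>x. coeff Q i * (of_real (g x) * cis (of_int (int i - int N) * x))) has_integral coeff Q i * 0) {0..2 * pi}" for i
      by (rule has_integral_mult_right) (use coef[of "int i - int N"] in \<open>simp add: g_def\<close>)
    have "((\<lambda>x. \<Sum>i\<le>degree Q. coeff Q i * (of_real (g x) * cis (of_int (int i - int N) * x))) has_integral (\<Sum>i\<le>degree Q. coeff Q i * 0)) {0..2 * pi}"
      by (rule has_integral_sum) (simp, rule summand)
    moreover have "(\<Sum>i\<le>degree Q. coeff Q i * (of_real (g x) * cis (of_int (int i - int N) * x))) = of_real (g x * f (cis x))" for x
    proof -
      have c: "cis (of_int (int i - int N) * x) = cis (- (real N * x)) * cis x ^ i" for i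
      proof -
        have "of_int (int i - int N) * x = - (real N * x) + real i * x" by (simp add: algebra_simps)
        then show ?thesis by (simp only: cis_mult[symmetric] Complex.DeMoivre)
      qed
      have "(\<Sum>i\<le>degree Q. coeff Q i * (of_real (g x) * cis (of_int (int i - int N) * x)))
          = of_real (g x) * cis (- (real N * x)) * poly Q (cis x)"
        unfolding c poly_altdef sum_distrib_left by (intro sum.cong) (simp_all add: mult_ac)
      also have "\<dots> = of_real (g x) * of_real (f (cis x)) * (cis (- (real N * x)) * cis x ^ N)"
        by (simp add: mult_ac flip: Q)
      also have "\<dots> = of_real (g x * f (cis x))" unfolding cis_times_cis_power by simp
      finally show ?thesis .
    qed
    ultimately have "((\<lambda>x. complex_of_real (g x * f (cis x))) has_integral 0) {0..2 * pi}" by simp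
    from has_integral_Re[OF this] show ?thesis by simp
  qed
  have gg: "(\<lambda>x. g x * g x) integrable_on {0..2 * pi}"
    by (intro integrable_continuous_real continuous_on_mult gc)
  have absg: "(\<lambda>x. \<bar>g x\<bar>) integrable_on {0..2 * pi}"
    by (intro integrable_continuous_real continuous_on_rabs gc)
  define M where "M = integral {0..2 * pi} (\<lambda>x. \<bar>g x\<bar>)"
  have le: "integral {0..2 * pi} (\<lambda>x. g x * g x) \<le> e * M" if e: "e > 0" for e
  proof -
    obtain f where f: "real_polynomial_function f" "\<And>w. w \<in> sphere 0 1 \<Longrightarrow> \<bar>G w - f w\<bar> < e"
      using Stone_Weierstrass_real_polynomial_function[OF compact_sphere cont e] by blast
    have 1: "((\<lambda>x. g x * g x - g x * f (cis x)) has_integral integral {0..2 * pi} (\<lambda>x. g x * g x) - 0) {0..2 * pi}"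
      by (rule has_integral_diff[OF integrable_integral[OF gg] orth[OF f(1)]])
    have 2: "((\<lambda>x. e * \<bar>g x\<bar>) has_integral e * M) {0..2 * pi}"
      unfolding M_def by (rule has_integral_mult_right[OF integrable_integral[OF absg]])
    have "g x * g x - g x * f (cis x) \<le> e * \<bar>g x\<bar>" for x
    proof -
      have "g x * g x - g x * f (cis x) = g x * (g x - f (cis x))" by (simp add: right_diff_distrib)
      also have "\<dots> \<le> \<bar>g x\<bar> * \<bar>g x - f (cis x)\<bar>" unfolding abs_mult[symmetric] by (rule abs_ge_self)
      also have "\<dots> \<le> \<bar>g x\<bar> * e" using f(2)[of "cis x"] by (intro mult_left_mono) (auto simp: g_def less_imp_le)
      finally show ?thesis by (simp add: mult.commute)
    qed
    then have "integral {0..2 * pi} (\<lambda>x. g x * g x) - 0 \<le> e * M" using has_integral_le[OF 1 2] by blast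
    then show ?thesis by simp
  qed
  have M: "M \<ge> 0" unfolding M_def by (rule integral_nonneg[OF absg]) simp
  have "integral {0..2 * pi} (\<lambda>x. g x * g x) \<le> 0 + e" if e: "e > 0" for e
  proof -
    \<comment> \<open>The summand 1 avoids division by 0 when M = 0.\<close>
    have "e / (M + 1) > 0" using e M by simp
    from le[OF this] have "integral {0..2 * pi} (\<lambda>x. g x * g x) \<le> e / (M + 1) * M" .
    also have "\<dots> \<le> e" using e M by (simp add: field_simps)
    finally show ?thesis by simp
  qed
  then have "integral {0..2 * pi} (\<lambda>x. g x * g x) \<le> 0" by (rule field_le_epsilon)
  moreover have "integral {0..2 * pi} (\<lambda>x. g x * g x) \<ge> 0" by (rule integral_nonneg[OF gg]) simp
  ultimately have "integral {0..2 * pi} (\<lambda>x. g x * g x) = 0" by simp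
  then have "((\<lambda>x. g x * g x) has_integral 0) {0..2 * pi}" using integrable_integral[OF gg] by simp
  then have "g x = 0" by (rule periodic_square_integral_0[OF gc gper])
  then show ?thesis by (simp add: g_def)
qed

text \<open>Unnormalised and with exponent +i k x, which fixes the signs in the rules for shifts and
  derivatives.\<close>

definition fourier :: "(real \<Rightarrow> real) \<Rightarrow> int \<Rightarrow> complex" where
  "fourier f k = integral {0..2 * pi} (\<lambda>x. of_real (f x) * cis (of_int k * x))"

lemma fourier_integrable:
  assumes "continuous_on UNIV f"
  shows "(\<lambda>x. of_real (f x) * cis (of_int k * x)) integrable_on {0..2 * pi}"
  by (intro integrable_continuous_real continuous_on_mult continuous_on_of_real continuous_on_cis
      continuous_on_const continuous_on_id continuous_on_subset[OF assms]) auto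

lemma fourier_has_integral:
  assumes "continuous_on UNIV f"
  shows "((\<lambda>x. of_real (f x) * cis (of_int k * x)) has_integral fourier f k) {0..2 * pi}"
  unfolding fourier_def by (rule integrable_integral[OF fourier_integrable[OF assms]])

lemma fourier_linear:
  assumes "continuous_on UNIV f" "continuous_on UNIV g"
  shows "fourier (\<lambda>x. a * f x + b * g x) k = of_real a * fourier f k + of_real b * fourier g k"
proof -
  have "((\<lambda>x. of_real a * (of_real (f x) * cis (of_int k * x)) + of_real b * (of_real (g x) * cis (of_int k * x))) has_integral
      of_real a * fourier f k + of_real b * fourier g k) {0..2 * pi}"
    by (intro has_integral_add has_integral_mult_right fourier_has_integral assms)
  moreover have "(\<lambda>x. of_real a * (of_real (f x) * cis (of_int k * x)) + of_real b * (of_real (g x) * cis (of_int k * x)))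
     = (\<lambda>x. of_real (a * f x + b * g x) * cis (of_int k * x))" by (simp add: fun_eq_iff algebra_simps)
  ultimately show ?thesis unfolding fourier_def[of "\<lambda>x. a * f x + b * g x"] by (simp add: integral_unique)
qed

lemma cis_int_periodic: "cis (of_int k * (x + 2 * pi)) = cis (of_int k * x)"
proof -
  have "of_int k * (x + 2 * pi) = of_int k * x + 2 * pi * of_int k" by (simp add: algebra_simps)
  then show ?thesis by (simp add: cis_multiple_2pi flip: cis_mult)
qed

lemma fourier_shift:
  assumes cont: "continuous_on UNIV f" and per: "\<And>x. f (x + 2 * pi) = f x"
  shows "fourier (\<lambda>x. f (x + d)) k = cis (- of_int k * d) * fourier f k"
proof -
  define F where "F x = of_real (f x) * cis (of_int k * x)" for x
  have Fc: "continuous_on UNIV F" unfolding F_def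
    by (intro continuous_on_mult continuous_on_of_real continuous_on_cis continuous_on_const continuous_on_id cont)
  have Fper: "F (x + 2 * pi) = F x" for x unfolding F_def per cis_int_periodic ..
  have "of_real (f (x + d)) * cis (of_int k * x) = cis (- of_int k * d) * F (x + d)" for x
  proof -
    have "of_int k * x = - of_int k * d + of_int k * (x + d)" by (simp add: algebra_simps)
    then have "cis (of_int k * x) = cis (- of_int k * d) * cis (of_int k * (x + d))" by (simp only: cis_mult)
    then show ?thesis by (simp add: F_def mult_ac)
  qed
  then have "fourier (\<lambda>x. f (x + d)) k = integral {0..2 * pi} (\<lambda>x. cis (- of_int k * d) * F (x + d))"
    unfolding fourier_def by simp
  also have "\<dots> = cis (- of_int k * d) * integral {0..2 * pi} (\<lambda>x. F (x + d))" by (rule integral_mult_right)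
  also have "integral {0..2 * pi} (\<lambda>x. F (x + d)) = fourier f k"
    unfolding periodic_integral_shift[OF Fc Fper] unfolding fourier_def F_def ..
  finally show ?thesis .
qed

lemma fourier_derivative:
  assumes f: "\<And>x. (f has_real_derivative f' x) (at x)" and f'c: "continuous_on UNIV f'"
    and per: "\<And>x. f (x + 2 * pi) = f x"
  shows "fourier f' k = - \<i> * of_int k * fourier f k"
proof -
  have fc: "continuous_on UNIV f" using f by (meson DERIV_continuous_on has_field_derivative_at_within)
  define F where "F x = of_real (f x) * cis (of_int k * x)" for x
  have F': "(F has_vector_derivative (of_real (f' x) * cis (of_int k * x) + \<i> * of_int k * (of_real (f x) * cis (of_int k * x)))) (at x)" for x
  proof -
    have "((\<lambda>x. of_int k * x) has_real_derivative of_int k) (at x)" by (auto intro!: derivative_eq_intros)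
    from has_vector_derivative_mult[OF has_vector_derivative_of_real[OF f] cis_has_vector_derivative[OF this]]
    show ?thesis unfolding F_def[abs_def] by (rule has_vector_derivative_eq_rhs) (simp add: scaleR_conv_of_real algebra_simps)
  qed
  have 1: "((\<lambda>x. of_real (f' x) * cis (of_int k * x) + \<i> * of_int k * (of_real (f x) * cis (of_int k * x))) has_integral F (2 * pi) - F 0) {0..2 * pi}"
    by (rule fundamental_theorem_of_calculus) (auto intro: has_vector_derivative_at_within F')
  have 2: "((\<lambda>x. of_real (f' x) * cis (of_int k * x) + \<i> * of_int k * (of_real (f x) * cis (of_int k * x))) has_integral
      fourier f' k + \<i> * of_int k * fourier f k) {0..2 * pi}"
    by (intro has_integral_add has_integral_mult_right fourier_has_integral fc f'c)
  have "F (2 * pi) = F 0" using per[of 0] cis_int_periodic[of k 0] by (simp add: F_def)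
  then have "fourier f' k + \<i> * of_int k * fourier f k = 0" using has_integral_unique[OF 2 1] by simp
  then show ?thesis by (simp add: add_eq_0_iff)
qed

lemma integral_cis_int:
  "((\<lambda>x. cis (of_int k * x)) has_integral (if k = 0 then of_real (2 * pi) else 0)) {0..2 * pi}"
proof (cases "k = 0")
  case True
  then show ?thesis using has_integral_const_real[of "1 :: complex" 0 "2 * pi"]
    by (simp add: scaleR_conv_of_real)
next
  case False
  define F where "F x = cis (of_int k * x) / (\<i> * of_int k)" for x
  have "(F has_vector_derivative cis (of_int k * x)) (at x)" for x
  proof -
    have "((\<lambda>x. of_int k * x) has_real_derivative of_int k) (at x)" by (auto intro!: derivative_eq_intros)
    from has_vector_derivative_divide[OF cis_has_vector_derivative[OF this], of "\<i> * of_int k"]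
    show ?thesis unfolding F_def[abs_def] by (rule has_vector_derivative_eq_rhs) (use False in \<open>simp add: scaleR_conv_of_real\<close>)
  qed
  then have "((\<lambda>x. cis (of_int k * x)) has_integral F (2 * pi) - F 0) {0..2 * pi}"
    by (intro fundamental_theorem_of_calculus) (auto intro: has_vector_derivative_at_within)
  moreover have "F (2 * pi) = F 0" using cis_int_periodic[of k 0] by (simp add: F_def)
  ultimately show ?thesis using False by simp
qed

lemma fourier_cnj:
  assumes "continuous_on UNIV f"
  shows "fourier f (- k) = cnj (fourier f k)"
proof -
  have "((\<lambda>x. cnj (of_real (f x) * cis (of_int k * x))) has_integral cnj (fourier f k)) {0..2 * pi}"
    using has_integral_linear[OF fourier_has_integral[OF assms] bounded_linear_cnj] by (simp add: o_def)
  moreover have "(\<lambda>x. cnj (of_real (f x) * cis (of_int k * x))) = (\<lambda>x. of_real (f x) * cis (of_int (- k) * x))"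
    by (simp add: fun_eq_iff cis_cnj)
  ultimately show ?thesis unfolding fourier_def[of f "- k"] by (simp add: integral_unique)
qed

text \<open>Subtracting the mean and the first harmonic leaves a function on the circle all of whose
  coefficients vanish. For real H the coefficients at 1 and -1 are conjugate, so one vector c
  accounts for both.\<close>

lemma first_harmonics:
  fixes H :: "complex \<Rightarrow> real"
  assumes cont: "continuous_on (sphere 0 1) H"
    and zero: "\<And>k. \<bar>k\<bar> \<ge> 2 \<Longrightarrow> fourier (\<lambda>x. H (cis x)) k = 0"
  obtains r c where "\<And>x. H (cis x) = r + inner c (cis x)"
proof -
  define f where "f x = H (cis x)" for x
  have fc: "continuous_on UNIV f"
    unfolding f_def by (rule continuous_on_compose2[OF cont]) (auto intro!: continuous_on_cis continuous_on_id)
  define r where "r = Re (fourier f 0) / (2 * pi)"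
  define c where "c = fourier f 1 / of_real pi"
  define G where "G w = H w - r - inner c w" for w
  have inn: "of_real (inner c (cis x)) = (cnj c * cis x + c * cis (- x)) / 2" for x
    by (simp add: complex_eq_iff inner_complex_def)
  have c0: "complex_of_real r * of_real (2 * pi) = fourier f 0"
  proof -
    have "fourier f 0 = cnj (fourier f 0)" using fourier_cnj[OF fc, of 0] by simp
    then have "Im (fourier f 0) = 0" by (simp add: complex_eq_iff)
    then show ?thesis by (simp add: r_def complex_eq_iff)
  qed
  have c1: "c * of_real pi = fourier f 1" "cnj c * of_real pi = fourier f (- 1)"
    using fourier_cnj[OF fc, of 1] by (simp_all add: c_def)
  have "G (cis x) = 0" for x
  proof (rule fourier_uniqueness)
    show "continuous_on (sphere 0 1) G" unfolding G_def
      by (intro continuous_on_diff cont continuous_on_const continuous_on_inner continuous_on_id)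
    fix k :: int
    define d where "d j = (if k + j = 0 then complex_of_real (2 * pi) else 0)" for j
    have int: "((\<lambda>x. cis (of_int (k + j) * x)) has_integral d j) {0..2 * pi}" for j
      unfolding d_def by (rule integral_cis_int)
    have "((\<lambda>x. of_real (f x) * cis (of_int k * x) - of_real r * cis (of_int (k + 0) * x)
        - (cnj c / 2 * cis (of_int (k + 1) * x) + c / 2 * cis (of_int (k + (- 1)) * x))) has_integral
        fourier f k - of_real r * d 0 - (cnj c / 2 * d 1 + c / 2 * d (- 1))) {0..2 * pi}"
      by (intro has_integral_diff has_integral_add has_integral_mult_right fourier_has_integral fc int)
    moreover have "of_real (G (cis x)) * cis (of_int k * x) = of_real (f x) * cis (of_int k * x) - of_real r * cis (of_int (k + 0) * x)
        - (cnj c / 2 * cis (of_int (k + 1) * x) + c / 2 * cis (of_int (k + (- 1)) * x))" for x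
    proof -
      have "of_int (k + 1) * x = x + of_int k * x" "of_int (k + - 1) * x = - x + of_int k * x"
        by (simp_all add: algebra_simps)
      then have e: "cis (of_int (k + 1) * x) = cis x * cis (of_int k * x)" "cis (of_int (k + - 1) * x) = cis (- x) * cis (of_int k * x)"
        by (simp_all only: cis_mult)
      show ?thesis unfolding e G_def of_real_diff inn f_def by (simp add: field_simps)
    qed
    moreover have "fourier f k - of_real r * d 0 - (cnj c / 2 * d 1 + c / 2 * d (- 1)) = 0"
    proof -
      consider "k = 0" | "k = 1" | "k = - 1" | "\<bar>k\<bar> \<ge> 2" by linarith
      then show ?thesis
      proof cases
        case 1
        then show ?thesis using c0 by (simp add: d_def)
      next
        case 2
        then show ?thesis using c1 by (simp add: d_def)
      next
        case 3
        then show ?thesis using c1 by (simp add: d_def)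
      next
        case 4
        then show ?thesis using zero[OF 4] by (auto simp: d_def f_def[abs_def])
      qed
    qed
    ultimately show "((\<lambda>x. of_real (G (cis x)) * cis (of_int k * x)) has_integral 0) {0..2 * pi}" by simp
  qed
  then have "H (cis x) = r + inner c (cis x)" for x unfolding G_def by (metis add.commute diff_diff_eq2 diff_eq_eq diff_zero add_0 diff_add_eq)
  then show ?thesis using that by blast
qed

section \<open>Chords of constant angle and rigidity\<close>

lemma cis_frame:
  "w = inner w (cis s) *\<^sub>R cis s + inner w (\<i> * cis s) *\<^sub>R (\<i> * cis s)"
proof -
  have "inner w (cis s) *\<^sub>R cis s + inner w (\<i> * cis s) *\<^sub>R (\<i> * cis s) =
      Complex (inner w (cis s)) (inner w (\<i> * cis s)) * cis s"
    by (simp add: complex_eq_iff)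
  also have "Complex (inner w (cis s)) (inner w (\<i> * cis s)) = w * cis (- s)"
    by (simp add: complex_eq_iff inner_complex_def algebra_simps)
  also have "w * cis (- s) * cis s = w" by (simp add: mult.assoc cis_mult)
  finally show ?thesis ..
qed

text \<open>A bound for the norms in \<Omega> is a Lipschitz constant. This presents the support
  function as a continuous function on the circle, as the Fourier argument requires.\<close>

lemma continuous_on_support:
  fixes \<Omega> :: "complex set"
  assumes bd: "bounded \<Omega>" and ne: "\<Omega> \<noteq> {}"
  shows "continuous_on A (\<lambda>w. SUP x\<in>\<Omega>. inner x w)"
proof -
  obtain M where M: "\<And>x. x \<in> \<Omega> \<Longrightarrow> norm x \<le> M" using bd unfolding bounded_iff by blast
  have bdd: "bdd_above ((\<lambda>x. inner x w) ` \<Omega>)" for w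
  proof (rule bdd_aboveI2)
    fix x assume "x \<in> \<Omega>"
    have "inner x w \<le> norm x * norm w" by (rule norm_cauchy_schwarz)
    also have "\<dots> \<le> M * norm w" using M[OF \<open>x \<in> \<Omega>\<close>] by (intro mult_right_mono) auto
    finally show "inner x w \<le> M * norm w" .
  qed
  have le: "(SUP x\<in>\<Omega>. inner x w) \<le> (SUP x\<in>\<Omega>. inner x w') + M * norm (w - w')" for w w'
  proof (rule cSUP_least[OF ne])
    fix x assume x: "x \<in> \<Omega>"
    have "inner x w = inner x w' + inner x (w - w')" by (simp add: inner_diff_right)
    moreover have "inner x w' \<le> (SUP x\<in>\<Omega>. inner x w')" by (rule cSUP_upper[OF x bdd])
    moreover have "inner x (w - w') \<le> norm x * norm (w - w')" by (rule norm_cauchy_schwarz)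
    moreover have "norm x * norm (w - w') \<le> M * norm (w - w')" using M[OF x] by (intro mult_right_mono) auto
    ultimately show "inner x w \<le> (SUP x\<in>\<Omega>. inner x w') + M * norm (w - w')" by linarith
  qed
  have "M-lipschitz_on A (\<lambda>w. SUP x\<in>\<Omega>. inner x w)"
  proof (rule lipschitz_onI)
    obtain x where "x \<in> \<Omega>" using ne by blast
    then show "0 \<le> M" using M[of x] norm_ge_zero[of x] by linarith
    show "dist (SUP x\<in>\<Omega>. inner x w) (SUP x\<in>\<Omega>. inner x w') \<le> M * dist w w'" for w w'
      using le[of w w'] le[of w' w] unfolding dist_norm real_norm_def abs_le_iff norm_minus_commute[of w'] by linarith
  qed
  then show ?thesis by (rule lipschitz_on_continuous_on)
qed

section \<open>The billiard map in terms of the normal angle\<close>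

locale smooth_table = support_param +
  assumes table_open: "open \<Omega>" and table_bounded: "bounded \<Omega>" and table_sc: "strictly_convex \<Omega>" and table_nonempty: "\<Omega> \<noteq> {}"
    and R_pos: "\<And>s. 0 < R s"
    and frontier_eq: "range z = frontier \<Omega>"
    and supporting: "\<And>s p. p \<in> closure \<Omega> \<Longrightarrow> inner p (cis s) \<le> inner (z s) (cis s)"
begin

lemma z_closure: "z s \<in> closure \<Omega>"
  using frontier_eq unfolding frontier_def by blast

text \<open>A competing unit normal u is orthogonal to the tangent, because z has nonzero derivative
  and maximizes the functional given by u at s. So u is \<open>cis s\<close> or its negative, and
  the negative would squeeze the open set \<Omega> into a line.\<close>

lemma outer_normal_z: "outer_normal \<Omega> (z s) = cis s"
  unfolding outer_normal_def
proof (rule the_equality)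
  show "norm (cis s) = 1 \<and> (\<forall>p\<in>\<Omega>. inner (p - z s) (cis s) \<le> 0)"
    using supporting closure_subset by (fastforce simp: inner_diff_left)
  fix u assume u: "norm u = 1 \<and> (\<forall>p\<in>\<Omega>. inner (p - z s) u \<le> 0)"
  have "closure \<Omega> \<subseteq> {p. inner (p - z s) u \<le> 0}"
    by (rule closure_minimal) (use u in \<open>auto intro!: closed_Collect_le continuous_intros\<close>)
  then have max: "inner (z t) u \<le> inner (z s) u" for t using z_closure[of t] by (auto simp: inner_diff_left)
  have d: "((\<lambda>t. inner (z t) u) has_real_derivative inner (R s *\<^sub>R (\<i> * cis s)) u) (at s)"
    using inner_has_real_derivative[OF z_deriv has_vector_derivative_const[of u]] by simp
  have "inner (R s *\<^sub>R (\<i> * cis s)) u = 0"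
    by (rule DERIV_local_max[OF d, of 1]) (use max in auto)
  then have 0: "inner u (\<i> * cis s) = 0" using R_pos[of s] by (simp add: inner_commute)
  define l where "l = inner u (cis s)"
  have ul: "u = l *\<^sub>R cis s" using cis_frame[of u s] unfolding 0 l_def by simp
  have "\<bar>l\<bar> = 1" using u unfolding ul by simp
  moreover have "l \<noteq> - 1"
  proof
    assume l: "l = - 1"
    have flat: "inner (p - z s) (cis s) = 0" if "p \<in> \<Omega>" for p
    proof -
      have "inner (p - z s) u \<le> 0" using u that by blast
      then have "inner (p - z s) (cis s) \<ge> 0" unfolding ul l by simp
      moreover have "inner (p - z s) (cis s) \<le> 0"
        using supporting[of p s] closure_subset that by (auto simp: inner_diff_left)
      ultimately show ?thesis by simp
    qed
    obtain p where p: "p \<in> \<Omega>" using table_nonempty by blast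
    then obtain e where e: "e > 0" "ball p e \<subseteq> \<Omega>" using table_open unfolding open_contains_ball by blast
    have "p + (e / 2) *\<^sub>R cis s \<in> ball p e" using e by (simp add: dist_norm)
    then have "inner (p + (e / 2) *\<^sub>R cis s - z s) (cis s) = 0" using flat e(2) by blast
    then have "inner (p - z s) (cis s) + e / 2 = 0"
      by (simp add: inner_diff_left inner_add_left inner_cis_cis)
    then show False using flat[OF p] e(1) by simp
  qed
  ultimately have "l = 1" by linarith
  then show "u = cis s" using ul by simp
qed

lemma z_inj: "z s = z t \<Longrightarrow> cis s = cis t"
  using outer_normal_z[of s] outer_normal_z[of t] by simp

lemma positive_tangent_z: "positive_tangent \<Omega> (z s) = \<i> * cis s"
  by (simp add: positive_tangent_def outer_normal_z)

lemma constant_angle_chords_eq: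
  "constant_angle_chords \<Omega> a = range (\<lambda>s. (z s, \<i> * cis (s + a)))"
  unfolding constant_angle_chords_def frontier_eq[symmetric] image_image positive_tangent_z
  by (simp add: mult_ac cis_mult)

text \<open>Seen from t = s + 2 a, the chord arrives in direction i cis (t - a), at angle -a to the
  tangent there; reflection changes the sign of that angle.\<close>

lemma reflected_chord:
  assumes exit: "exit_point \<Omega> (z s) (\<i> * cis (s + a)) = z (s + 2 * a)"
  shows "billiard_map \<Omega> (z s, \<i> * cis (s + a)) = (z (s + 2 * a), \<i> * cis (s + 2 * a + a))"
proof -
  define t where "t = s + 2 * a"
  have sa: "s + a = t - a" by (simp add: t_def)
  have "inner (\<i> * cis (t - a)) (cis t) = sin a" unfolding inner_icis_cis by simp
  moreover have "\<i> * cis (t - a) - (2 * sin a) *\<^sub>R cis t = \<i> * cis (t + a)"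
    by (simp add: complex_eq_iff cos_add cos_diff sin_add sin_diff algebra_simps)
  ultimately show ?thesis
    unfolding billiard_map_def Let_def prod.case exit unfolding t_def[symmetric] outer_normal_z sa
    by simp
qed

lemma constant_angle_invariantI:
  assumes exit: "\<And>s. exit_point \<Omega> (z s) (\<i> * cis (s + a)) = z (s + 2 * a)"
  shows "constant_angle_invariant_curve \<Omega> a"
proof -
  have "billiard_map \<Omega> ` constant_angle_chords \<Omega> a = range (\<lambda>s. (z (s + 2 * a), \<i> * cis (s + 2 * a + a)))"
    unfolding constant_angle_chords_eq image_image reflected_chord[OF exit] ..
  also have "\<dots> = constant_angle_chords \<Omega> a"
    unfolding constant_angle_chords_eq
  proof
    show "range (\<lambda>s. (z (s + 2 * a), \<i> * cis (s + 2 * a + a))) \<subseteq> range (\<lambda>s. (z s, \<i> * cis (s + a)))" by blast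
    show "range (\<lambda>s. (z s, \<i> * cis (s + a))) \<subseteq> range (\<lambda>s. (z (s + 2 * a), \<i> * cis (s + 2 * a + a)))"
    proof
      fix p assume "p \<in> range (\<lambda>s. (z s, \<i> * cis (s + a)))"
      then obtain s where s: "p = (z s, \<i> * cis (s + a))" by blast
      show "p \<in> range (\<lambda>s. (z (s + 2 * a), \<i> * cis (s + 2 * a + a)))"
        by (rule range_eqI[of _ _ "s - 2 * a"]) (simp add: s)
    qed
  qed
  finally show ?thesis unfolding constant_angle_invariant_curve_def .
qed

text \<open>By strict convexity the tangent line at z s meets the closure in z s only, so the exit
  point is the starting point.\<close>

lemma invariant_curve_0: "constant_angle_invariant_curve \<Omega> 0"
proof (rule constant_angle_invariantI)
  fix s
  have "{t::real. 0 \<le> t \<and> z s + t *\<^sub>R (\<i> * cis (s + 0)) \<in> closure \<Omega>} = {0}"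
  proof (intro antisym subsetI)
    fix t assume "t \<in> {t::real. 0 \<le> t \<and> z s + t *\<^sub>R (\<i> * cis (s + 0)) \<in> closure \<Omega>}"
    then have t: "z s + t *\<^sub>R (\<i> * cis s) \<in> closure \<Omega>" by simp
    have "inner (z s + t *\<^sub>R (\<i> * cis s)) (cis s) = inner (z s) (cis s)"
      by (simp add: inner_add_left inner_icis_cis)
    then have "z s + t *\<^sub>R (\<i> * cis s) = z s"
      using strictly_convex_unique_maximizer[OF table_sc t z_closure[of s], of "cis s"] supporting[of _ s] by simp
    then show "t \<in> {0}" by simp
  qed (use z_closure in simp)
  then show "exit_point \<Omega> (z s) (\<i> * cis (s + 0)) = z (s + 2 * 0)"
    unfolding exit_point_def by simp
qed

text \<open>The equation makes the chord parallel to v = i cis u, the tangent at z(u - a) turned by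
  a. It points forwards because z has nonnegative velocity along v on [u - a, u + a], which is where
  a <= pi/2 enters.\<close>

lemma invariant_curve_of_euler_lagrange:
  assumes a: "0 < a" "a \<le> pi / 2"
    and EL: "\<And>u. inner (z (u + a) - z (u - a)) (cis u) = 0"
  shows "constant_angle_invariant_curve \<Omega> a"
proof (rule constant_angle_invariantI)
  fix s
  define u where "u = s + a"
  define v where "v = \<i> * cis u"
  have su: "s = u - a" "s + 2 * a = u + a" by (simp_all add: u_def)
  define L where "L = inner (z (u + a) - z (u - a)) v"
  define w where "w = z (u + a) - z (u - a)"
  have wL: "w = L *\<^sub>R v"
    using cis_frame[of w u] EL[of u] unfolding L_def v_def w_def[symmetric] by simp
  have "inner (z (u - a)) v \<le> inner (z (u + a)) v"
  proof (rule DERIV_nonneg_imp_nondecreasing[of "u - a" "u + a" "\<lambda>x. inner (z x) v"])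
    show "u - a \<le> u + a" using a by simp
    fix x assume x: "u - a \<le> x" "x \<le> u + a"
    have "((\<lambda>x. inner (z x) v) has_real_derivative R x * cos (u - x)) (at x)"
    proof -
      have "inner (\<i> * cis x) (\<i> * cis u) = cos (u - x)" by (simp add: inner_complex_def cos_diff)
      then show ?thesis
        using inner_has_real_derivative[OF z_deriv has_vector_derivative_const[of v], of x] by (simp add: v_def)
    qed
    moreover have "cos (u - x) \<ge> 0" using x a by (intro cos_ge_zero) auto
    ultimately show "\<exists>y. ((\<lambda>x. inner (z x) v) has_real_derivative y) (at x) \<and> 0 \<le> y"
      using R_nonneg[of x] by (meson mult_nonneg_nonneg)
  qed
  then have L0: "L \<ge> 0" by (simp add: L_def inner_diff_left)
  have "L \<noteq> 0"
  proof
    assume "L = 0"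
    then have "z (u + a) = z (u - a)" using wL by (simp add: w_def)
    then have "cis (u + a) = cis (u - a)" by (rule z_inj)
    then have "inner (cis (u - a)) (cis (u + a)) = 1" by (simp add: inner_cis_cis)
    then have "cos (2 * a) = 1" by (simp add: inner_cis_cis)
    moreover have "cos (2 * a) < cos 0" using a by (intro cos_monotone_0_pi) auto
    ultimately show False by simp
  qed
  then have Lpos: "L > 0" using L0 by simp
  have endp: "z s + L *\<^sub>R v = z (u + a)" using wL unfolding w_def diff_eq_eq su(1) by (simp add: add.commute)
  \<comment> \<open>If the ray met the closure beyond z(u + a), strict convexity would make this
    frontier point interior.\<close>
  have "Sup {t::real. 0 \<le> t \<and> z s + t *\<^sub>R v \<in> closure \<Omega>} = L"
  proof (rule cSup_eq_maximum)
    show "L \<in> {t. 0 \<le> t \<and> z s + t *\<^sub>R v \<in> closure \<Omega>}" using L0 endp z_closure by simp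
    fix t assume t: "t \<in> {t. 0 \<le> t \<and> z s + t *\<^sub>R v \<in> closure \<Omega>}"
    show "t \<le> L"
    proof (rule ccontr)
      assume "\<not> t \<le> L"
      then have tL: "L < t" by simp
      have "z s + L *\<^sub>R v \<in> open_segment (z s) (z s + t *\<^sub>R v)"
      proof -
        have "z s + L *\<^sub>R v = (1 - L / t) *\<^sub>R z s + (L / t) *\<^sub>R (z s + t *\<^sub>R v)"
          using Lpos tL by (simp add: algebra_simps)
        moreover have "0 < L / t" "L / t < 1" using Lpos tL by (auto simp: field_simps)
        moreover have "z s \<noteq> z s + t *\<^sub>R v" using Lpos tL by (simp add: v_def)
        ultimately show ?thesis unfolding in_segment by blast
      qed
      moreover have "z s \<noteq> z s + t *\<^sub>R v" using Lpos tL by (simp add: v_def)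
      moreover have "z s + t *\<^sub>R v \<in> closure \<Omega>" using t by simp
      ultimately have "z s + L *\<^sub>R v \<in> interior \<Omega>"
        using table_sc z_closure[of s] unfolding strictly_convex_def by blast
      moreover have "z (u + a) \<in> frontier \<Omega>" using frontier_eq by blast
      ultimately show False unfolding endp frontier_def by blast
    qed
  qed
  then show "exit_point \<Omega> (z s) (\<i> * cis (s + a)) = z (s + 2 * a)"
    unfolding exit_point_def u_def[symmetric] v_def[symmetric] su(2) by (simp add: endp)
qed

text \<open>The width h(s) + h(s + pi) has as derivative, up to sign, the left side of the equation
  at u = s + pi/2.\<close>

lemma constant_width_of_euler_lagrange:
  assumes EL: "\<And>u. inner (z (u + pi / 2) - z (u - pi / 2)) (cis u) = 0"
  shows "constant_width \<Omega>"
proof -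
  define w where "w s = inner (z s) (cis s) + inner (z (s + pi)) (cis (s + pi))" for s
  have "(w has_vector_derivative 0) (at s)" for s
  proof -
    have d: "((\<lambda>s. inner (z (s + pi)) (cis (s + pi))) has_real_derivative inner (z (s + pi)) (\<i> * cis (s + pi))) (at s)"
      using support_has_derivative[of "s + pi"] by (simp add: DERIV_shift)
    have i: "\<i> * cis s = cis (s + pi / 2)" by (simp add: mult.commute flip: cis_mult cis_pi_half)
    have ip: "\<i> * cis (s + pi) = - cis (s + pi / 2)" unfolding i[symmetric] by (simp flip: cis_mult)
    have "inner (z s) (\<i> * cis s) + inner (z (s + pi)) (\<i> * cis (s + pi)) = - inner (z (s + pi) - z s) (cis (s + pi / 2))"
      unfolding i ip by (simp add: inner_diff_left)
    also have "\<dots> = 0"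
    proof -
      have e: "s + pi / 2 + pi / 2 = s + pi" "s + pi / 2 - pi / 2 = s" by simp_all
      show ?thesis using EL[of "s + pi / 2"] unfolding e by simp
    qed
    finally show ?thesis
      using DERIV_add[OF support_has_derivative[of s] d] unfolding w_def[abs_def] has_real_derivative_iff_has_vector_derivative by simp
  qed
  then have "w s = w 0" for s by (rule constant_if_vector_derivative_0)
  then show ?thesis unfolding constant_width_def support_eq by (intro exI[of _ "w 0"]) (simp add: w_def)
qed

text \<open>As h and h' are the coordinates of z in the frame at s, the equation relates h and h' at
  u + a to those at u - a, linearly and with constant coefficients; hence it acts diagonally on
  Fourier coefficients. The surviving h = r + c . cis is the support function of a ball with centre
  c.\<close>

lemma disk_of_euler_lagrange:
  assumes \<rho>: "\<rho> \<in> rigid_rotation_numbers"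
    and EL: "\<And>u. inner (z (u + pi * \<rho>) - z (u - pi * \<rho>)) (cis u) = 0"
  shows "\<exists>c r. r > 0 \<and> \<Omega> = ball c r"
proof -
  define a where "a = pi * \<rho>"
  define h where "h s = inner (z s) (cis s)" for s
  define h' where "h' s = inner (z s) (\<i> * cis s)" for s
  have hd: "(h has_real_derivative h' s) (at s)" for s
    unfolding h_def[abs_def] h'_def by (rule support_has_derivative)
  have hc: "continuous_on UNIV h" unfolding h_def[abs_def] by (rule support_continuous)
  have h'c: "continuous_on UNIV h'" unfolding h'_def[abs_def]
    by (intro continuous_on_inner z_continuous continuous_on_mult continuous_on_const continuous_on_cis continuous_on_id)
  have hper: "h (s + 2 * pi) = h s" "h' (s + 2 * pi) = h' s" for s
    by (simp_all add: h_def h'_def z_periodic flip: cis_mult)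
  have EL': "cos a * h (u + a) + (- sin a) * h' (u + a) = cos a * h (u - a) + sin a * h' (u - a)" for u
  proof -
    have i: "inner (cis u) (\<i> * cis v) = sin (u - v)" for v
      unfolding inner_commute[of "cis u"] by (rule inner_icis_cis)
    have e: "cis u = cos a *\<^sub>R cis (u + a) - sin a *\<^sub>R (\<i> * cis (u + a))"
      using cis_frame[of "cis u" "u + a"] unfolding i inner_cis_cis by simp
    have e': "cis u = cos a *\<^sub>R cis (u - a) + sin a *\<^sub>R (\<i> * cis (u - a))"
      using cis_frame[of "cis u" "u - a"] unfolding i inner_cis_cis by simp
    have "inner (z (u + a)) (cis u) = cos a * h (u + a) + (- sin a) * h' (u + a)"
      unfolding h_def h'_def by (subst e) (simp add: inner_diff_right)
    moreover have "inner (z (u - a)) (cis u) = cos a * h (u - a) + sin a * h' (u - a)"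
      unfolding h_def h'_def by (subst e') (simp add: inner_add_right)
    ultimately show ?thesis using EL[of u] unfolding a_def by (simp add: inner_diff_left)
  qed
  have coef: "fourier h k * of_real (sin (of_int k * a) * cos a - of_int k * cos (of_int k * a) * sin a) = 0" for k
  proof -
    have shc: "continuous_on UNIV (\<lambda>x. f (x + d))" if "continuous_on UNIV f" for f :: "real \<Rightarrow> real" and d
      by (rule continuous_on_compose2[OF that]) (auto intro!: continuous_intros)
    have "fourier (\<lambda>u. cos a * h (u + a) + (- sin a) * h' (u + a)) k = fourier (\<lambda>u. cos a * h (u + - a) + sin a * h' (u + - a)) k"
      using EL' by simp
    then have "of_real (cos a) * (cis (- of_int k * a) * fourier h k) + of_real (- sin a) * (cis (- of_int k * a) * (- \<i> * of_int k * fourier h k))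
        = of_real (cos a) * (cis (- of_int k * - a) * fourier h k) + of_real (sin a) * (cis (- of_int k * - a) * (- \<i> * of_int k * fourier h k))"
      unfolding fourier_linear[OF shc[OF hc] shc[OF h'c]] fourier_shift[of h, OF hc hper(1)] fourier_shift[of h', OF h'c hper(2)]
        fourier_derivative[of h h', OF hd h'c hper(1)] .
    then have "fourier h k * (of_real (cos a) * (cis (of_int k * a) - cis (- (of_int k * a))) - \<i> * of_int k * of_real (sin a) * (cis (of_int k * a) + cis (- (of_int k * a)))) = 0"
      by (simp add: algebra_simps)
    moreover have "of_real (cos a) * (cis (of_int k * a) - cis (- (of_int k * a))) - \<i> * of_int k * of_real (sin a) * (cis (of_int k * a) + cis (- (of_int k * a)))
       = 2 * \<i> * of_real (sin (of_int k * a) * cos a - of_int k * cos (of_int k * a) * sin a)"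
      by (simp add: complex_eq_iff)
    ultimately show ?thesis by simp
  qed
  have zero: "fourier h k = 0" if k: "\<bar>k\<bar> \<ge> 2" for k
  proof -
    \<comment> \<open>The factor in \<open>coef\<close> is odd in k, so its nonvanishing at n = |k|
      settles both signs.\<close>
    define n where "n = nat \<bar>k\<bar>"
    have n: "n \<ge> 2" "k = int n \<or> k = - int n" using k by (auto simp: n_def)
    have "sin (real n * a) * cos a \<noteq> real n * cos (real n * a) * sin a"
      using \<rho> n(1) unfolding mem_rigid_rotation_numbers_iff a_def by blast
    then have "sin (of_int k * a) * cos a - of_int k * cos (of_int k * a) * sin a \<noteq> 0"
      using n(2) by auto
    then show ?thesis using coef[of k] unfolding mult_eq_0_iff of_real_eq_0_iff by blast
  qed
  define H where "H w = (SUP x\<in>\<Omega>. inner x w)" for w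
  have Hh: "H (cis s) = h s" for s using support_eq[of s] by (simp add: H_def h_def support_function_def)
  have Hc: "continuous_on (sphere 0 1) H"
    unfolding H_def by (rule continuous_on_support[OF table_bounded table_nonempty])
  obtain r c where rc: "\<And>x. H (cis x) = r + inner c (cis x)"
    by (rule first_harmonics[OF Hc]) (use zero Hh in auto)
  have hrc: "h s = r + inner c (cis s)" for s using rc Hh by simp
  have zrc: "norm (z s - c) = \<bar>r\<bar>" for s
  proof -
    have "((\<lambda>s. r + inner c (cis s)) has_real_derivative inner c (\<i> * cis s)) (at s)"
      using DERIV_add[OF DERIV_const[of r] inner_has_real_derivative[OF has_vector_derivative_const[of c] cis_has_vector_derivative[OF DERIV_ident]]]
      by simp
    moreover have "(\<lambda>s. r + inner c (cis s)) = h" by (rule ext) (rule hrc[symmetric])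
    ultimately have "(h has_real_derivative inner c (\<i> * cis s)) (at s)" by simp
    then have 2: "inner (z s - c) (\<i> * cis s) = 0" using DERIV_unique[OF hd[of s]] by (simp add: h'_def inner_diff_left)
    have 1: "inner (z s - c) (cis s) = r" using hrc[of s] by (simp add: h_def inner_diff_left)
    define q where "q = cnj (z s - c) * cis s"
    have "Re q = r" using 1 by (simp add: q_def inner_complex_Re)
    moreover have "Im q = 0" using 2 by (simp add: q_def inner_complex_def algebra_simps)
    ultimately have "norm q = \<bar>r\<bar>" by (simp add: cmod_def)
    moreover have "norm q = norm (z s - c)" unfolding q_def norm_mult complex_mod_cnj by simp
    ultimately show ?thesis by simp
  qed
  have cb: "norm (x - c) \<le> r" if "x \<in> \<Omega>" for x
  proof -
    define s where "s = Arg (x - c)"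
    have x: "x - c = norm (x - c) *\<^sub>R cis s" using rcis_cmod_Arg[of "x - c"] by (simp only: s_def scaleR_conv_of_real rcis_def)
    have "norm (x - c) = inner (x - c) (cis s)" by (subst (2) x) (simp add: inner_cis_cis)
    also have "\<dots> \<le> inner (z s) (cis s) - inner c (cis s)"
      using supporting[of x s] that closure_subset by (auto simp: inner_diff_left)
    also have "\<dots> = r" using hrc[of s] by (simp add: h_def)
    finally show ?thesis .
  qed
  have sub: "\<Omega> \<subseteq> ball c r"
  proof -
    have "\<Omega> \<subseteq> cball c r" using cb by (auto simp: dist_norm norm_minus_commute)
    then have "\<Omega> \<subseteq> interior (cball c r)" using table_open by (rule interior_maximal)
    then show ?thesis by simp
  qed
  then have r: "r > 0" using table_nonempty by (metis ball_empty not_le subset_empty)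
  \<comment> \<open>Otherwise the connected ball, which meets \<Omega>, would meet its frontier; but
    all frontier points have distance r from c.\<close>
  have "ball c r \<subseteq> \<Omega>"
  proof (rule ccontr)
    assume "\<not> ball c r \<subseteq> \<Omega>"
    then have "ball c r - \<Omega> \<noteq> {}" by blast
    moreover have "ball c r \<inter> \<Omega> \<noteq> {}" using sub table_nonempty by blast
    ultimately have "ball c r \<inter> frontier \<Omega> \<noteq> {}"
      using connected_Int_frontier[OF connected_ball] by blast
    then obtain s where "z s \<in> ball c r" unfolding frontier_eq[symmetric] by blast
    then show False using zrc[of s] r by (simp add: dist_norm norm_minus_commute)
  qed
  then show ?thesis using sub r by blast
qed

end

theorem theorem4p1:
  fixes \<Omega> :: "complex set" and \<gamma> :: "real \<Rightarrow> complex"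
  assumes "open \<Omega>" and "bounded \<Omega>" and "strictly_convex \<Omega>" and "0 \<in> \<Omega>"
    and "C2_positively_curved_boundary \<Omega> \<gamma>"
  defines "D \<equiv> ball (0::complex) 1"
    and "perimeter \<equiv> closed_curve_length \<gamma>"
  shows
    "(\<forall>\<rho>\<in>{0..1/2}. mather_beta \<Omega> \<rho> \<le> perimeter / (2 * pi) * mather_beta D \<rho>) \<and>
     (\<forall>\<rho>\<in>{0..1/2}. mather_beta \<Omega> \<rho> = perimeter / (2 * pi) * mather_beta D \<rho> \<longrightarrow>
        constant_angle_invariant_curve \<Omega> (pi * \<rho>)) \<and>
     (mather_beta \<Omega> (1/2) = perimeter / (2 * pi) * mather_beta D (1/2) \<longrightarrow>
        constant_width \<Omega>) \<and>
     \<rat> \<inter> {0<..<1/2} \<subseteq> rigid_rotation_numbers \<and>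
     countable ({0<..1/2} - rigid_rotation_numbers) \<and>
     {0<..1/2} \<subseteq> closure ({0<..1/2} - rigid_rotation_numbers) \<and>
     (\<forall>\<rho>\<in>rigid_rotation_numbers.
        mather_beta \<Omega> \<rho> = perimeter / (2 * pi) * mather_beta D \<rho> \<longrightarrow>
        (\<exists>c r. r > 0 \<and> \<Omega> = ball c r))"
proof -
  obtain z R where z: "\<And>s. (z has_vector_derivative R s *\<^sub>R (\<i> * cis s)) (at s)" "\<And>s. R s > 0"
    "\<And>s. z (s + 2 * pi) = z s" "range z = frontier \<Omega>"
    "\<And>s p. p \<in> closure \<Omega> \<Longrightarrow> inner p (cis s) \<le> inner (z s) (cis s)"
    and per: "closed_curve_length \<gamma> = integral {0..2 * pi} (\<lambda>s. inner (z s) (cis s))"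
    by (rule C2_boundary_support_param[OF assms(1,3,5)], rule that)
  have zcl: "z s \<in> closure \<Omega>" for s using z(4) unfolding frontier_def by blast
  obtain B where B: "\<And>s. norm (z s) \<le> B"
    using bounded_closure[OF assms(2)] zcl unfolding bounded_iff by metis
  interpret T: smooth_table \<Omega> z R B
  proof
    show "support_function \<Omega> s = inner (z s) (cis s)" for s by (rule support_function_eq[OF zcl z(5)])
    show "\<Omega> \<noteq> {}" using assms(4) by blast
  qed (use z B assms(1-3) less_imp_le in blast)+
  have D: "perimeter / (2 * pi) * mather_beta D \<rho> = - 2 * sin (pi * \<rho>) * T.mean_support" if "0 < \<rho>" "\<rho> < 1" for \<rho>
    unfolding D_def perimeter_def per mather_beta_unit_disk[OF that] by simp
  have zero: "mather_beta A 0 = 0" for A by (simp add: mather_beta_def)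
  have EL: "inner (z (u + pi * \<rho>) - z (u - pi * \<rho>)) (cis u) = 0"
    if "0 < \<rho>" "\<rho> < 1" "mather_beta \<Omega> \<rho> = perimeter / (2 * pi) * mather_beta D \<rho>" for \<rho> u
    by (rule T.euler_lagrange_of_equality[OF that(1,2)]) (use that(3) in \<open>simp only: D[OF that(1,2)]\<close>)
  show ?thesis
  proof (intro conjI ballI impI)
    fix \<rho> :: real assume \<rho>: "\<rho> \<in> {0..1/2}"
    show "mather_beta \<Omega> \<rho> \<le> perimeter / (2 * pi) * mather_beta D \<rho>"
    proof (cases "\<rho> = 0")
      case True
      show ?thesis unfolding True zero by simp
    next
      case False
      then have "0 < \<rho>" "\<rho> < 1" using \<rho> by auto
      then show ?thesis unfolding D[OF \<open>0 < \<rho>\<close> \<open>\<rho> < 1\<close>] by (rule T.mather_beta_le_mean_support)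
    qed
    assume eq: "mather_beta \<Omega> \<rho> = perimeter / (2 * pi) * mather_beta D \<rho>"
    \<comment> \<open>At \<rho> = 0 equality always holds, both sides being 0, so the degenerate
      curve is treated without it.\<close>
    show "constant_angle_invariant_curve \<Omega> (pi * \<rho>)"
    proof (cases "\<rho> = 0")
      case True
      show ?thesis unfolding True using T.invariant_curve_0 by simp
    next
      case False
      then have "0 < \<rho>" "\<rho> < 1" "\<rho> \<le> 1 / 2" using \<rho> by auto
      moreover from this have "0 < pi * \<rho>" "pi * \<rho> \<le> pi / 2" by (auto simp: field_simps)
      ultimately show ?thesis using T.invariant_curve_of_euler_lagrange EL eq by blast
    qed
  next
    assume eq: "mather_beta \<Omega> (1/2) = perimeter / (2 * pi) * mather_beta D (1/2)"
    have "inner (z (u + pi / 2) - z (u - pi / 2)) (cis u) = 0" for u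
      using EL[OF _ _ eq, of u] by simp
    then show "constant_width \<Omega>" by (rule T.constant_width_of_euler_lagrange)
  next
    fix \<rho> assume \<rho>: "\<rho> \<in> rigid_rotation_numbers"
      and eq: "mather_beta \<Omega> \<rho> = perimeter / (2 * pi) * mather_beta D \<rho>"
    have "0 < \<rho>" "\<rho> < 1" using \<rho> by (auto simp: rigid_rotation_numbers_def)
    then show "\<exists>c r. r > 0 \<and> \<Omega> = ball c r"
      using T.disk_of_euler_lagrange[OF \<rho>] EL eq by blast
  qed (rule rationals_subset_rigid countable_non_rigid dense_non_rigid)+
qed

end
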